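(* Let $(\mathfrak g,\delta)$ with $\mathfrak g=\mathfrak l\oplus\mathfrak u$ be a nondegenerate (finite-dimensional) Lie bialgebra with a splitting, and let $\sigma_{\mathfrak l}^{\mathfrak g}\in\wedge^2(\mathfrak u)\otimes\mathbb C[[L^*]][1/P_{\mathfrak l}^{\mathfrak g}]$ be the inverse of the form $\omega$ defined in the context. Then $\sigma_{\mathfrak l}^{\mathfrak g}$ is a Poisson-Lie dynamical $r$-matrix for $(L^*,\mathfrak g,0)$.
   Context: The base field is $\mathbb C$; Lie bialgebras are finite dimensional. Formal groups. For a Lie algebra $\mathfrak x$ with formal group $X$, $\mathbb C[[X]]:=U(\mathfrak x)^*$ is the algebra of functions on $X$. For $\xi\in\mathfrak x$: $(\mathbf L_\xi f)(x)=\frac{d}{d\epsilon}|_{\epsilon=0}f(e^{-\epsilon\xi}x)$, $(\mathbf R_\xi f)(x)=\frac{d}{d\epsilon}|_{\epsilon=0}f(xe^{\epsilon\xi})$; one also allows $\xi\in\mathfrak x\otimes\mathbb C[[X]]$ (extend linearly over functions). Doubles and dressing action. For a Lie bialgebra $\mathfrak h$, $\mathfrak h^*$ is the dual Lie bialgebra, and $\mathfrak d(\mathfrak h)=\mathfrak h\oplus\mathfrak h^*$ is the double: $\mathfrak h,\mathfrak h^*$ are Lie subalgebras and the canonical symmetric pairing $\langle-,-\rangle$ is invariant. $H^*$ is the formal group of $\mathfrak h^*$. For $a\in\mathfrak h$, $\mathrm{dress}^L_a$ is the derivation of $\mathbb C[[H^*]]$ given by $(\mathrm{dress}^L_af)(x)=-\big(\mathbf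 R_{(\mathrm{Ad}(x^{-1})(a))_{\mathfrak h^*}}f\big)(x)$, where $\mathrm{Ad}(x^{-1})$ acts on $\mathfrak d(\mathfrak h)$ and $(\cdot)_{\mathfrak h^*}$ is the projection along $\mathfrak h$. It extends to localizations. PL dynamical $r$-matrices. Let $(\mathfrak g,\delta)$ be a Lie bialgebra, $\mathfrak h\subset\mathfrak g$ a Lie subbialgebra, $Z\in\wedge^3(\mathfrak g)^{\mathfrak g}$ with $\mathrm{Alt}((\delta\otimes\mathrm{id}^{\otimes2})(Z))=0$. For $f\in\mathbb C[[H^*]]$ set $d^L(f)=-\sum_ie_i\otimes\mathbf L_{\varepsilon^i}(f)$, with $(e_i),(\varepsilon^i)$ dual bases of $\mathfrak h,\mathfrak h^*$; for $\rho=\sum a_\alpha\otimes b_\alpha\otimes\ell_\alpha$, $d^L\rho=\sum a_\alpha\otimes b_\alpha\otimes d^L(\ell_\alpha)$. $\mathrm{Alt}(x)=x+x^{2,3,1}+x^{3,1,2}$ (permuting the first three tensor factors), $\mathrm{CYB}(\rho)=[\rho^{1,2},\rho^{1,3}]+[\rho^{1,2},\rho^{2,3}]+[\rho^{1,3},\rho^{2,3}]$. A PL dynamical $r$-matrix for $(H^*,\mathfrak g,Z)$ is $\rho\in\wedge^2(\mathfrak g)\otimes\mathbb C[[H^*]][1/\mathbf P]$ (some nonzero $\mathbf P\in\mathbb C[[H^*]]$) such that (a) $\mathrm{dress}^L_a(\rho)+[a\otimes1+1\otimes a,\rho]=0$ for all $a\in\mathfrak h$; (b) $\mathrm{CYB}(\rho)+\mathrm{Alt}(d^L\rho)+\mathrm{Alt}((\delta\otimes\mathrm{id})(\rho))=Z$.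 Splittings. A Lie bialgebra with a splitting is a Lie bialgebra $(\mathfrak g,\delta)$ with a Lie subbialgebra $\mathfrak l$ and a decomposition $\mathfrak g=\mathfrak l\oplus\mathfrak u$ with $[\mathfrak l,\mathfrak u]\subset\mathfrak u$ and $\delta(\mathfrak u)\subset(\mathfrak l\otimes\mathfrak u)\oplus(\mathfrak u\otimes\mathfrak l)\oplus(\mathfrak u\otimes\mathfrak u)$. Then $\mathfrak l^*$ is a Lie subalgebra and $\mathfrak u^*$ an ideal of $\mathfrak g^*=\mathfrak l^*\oplus\mathfrak u^*$. It is nondegenerate if for generic $\lambda\in\mathfrak l^*$ the form $(u,v)\mapsto\lambda([u,v]_{\mathfrak l})$ on $\mathfrak u$ is nondegenerate ($z\mapsto z_{\mathfrak l}$ is the projection along $\mathfrak u$). The form $\omega$. $L^*$ is the formal group of $\mathfrak l^*\subset\mathfrak g^*$, acting on $\mathfrak d(\mathfrak g)=\mathfrak g\oplus\mathfrak g^*$ by $\mathrm{Ad}$. For $x\in L^*$ and $u,v\in\mathfrak u$, $\omega_x(u,v)=\langle(\mathrm{Ad}(x^{-1})(u))_{\mathfrak g},(\mathrm{Ad}(x^{-1})(v))_{\mathfrak g^*}\rangle$; this is an antisymmetric form on $\mathfrak u$ with values in $\mathbb C[[L^*]]$. Fix a linear isomorphism $i:\mathfrak u\to\mathfrak u^*$, put $a(x)(u)=i^{-1}(\omega_x(u,-))$ and $P_{\mathfrak l}^{\mathfrak g}(x)=\det a(x)\in\mathbb C[[L^*]]$ (well defined up to a nonzero scalar, and nonzero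 by nondegeneracy). The element $\sigma_{\mathfrak l}^{\mathfrak g}=\sum_\alpha a_\alpha\otimes b_\alpha\otimes\ell_\alpha\in\wedge^2(\mathfrak u)\otimes\mathbb C[[L^*]][1/P_{\mathfrak l}^{\mathfrak g}]$ is uniquely determined by $\sum_\alpha a_\alpha\otimes\omega_x(v,b_\alpha)\ell_\alpha(x)=v\otimes1$ for all $v\in\mathfrak u$. *)

theory Defs
  imports
    "HOL-Library.Function_Algebras"
    "HOL-Library.Product_Plus"
    "HOL-Computational_Algebra.Fraction_Field"
    "Jordan_Normal_Form.Determinant"
begin

section \<open>Linear functionals on a tensor algebra\<close>

text \<open>
  A linear functional on the tensor algebra of a vector space is determined by its values on words
  (pure tensors), so \<open>U(x)\<^sup>*\<close>, for a Lie algebra \<open>x\<close>, will be a set of functions on words of elements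
  of \<open>x\<close>. All functions on words form a commutative ring under the product dual to the coproduct for
  which letters are primitive:
  \<open>(f g)(w) = \<Sum> f(w\<^sub>S) g(w\<^sub>T)\<close>, over all ways of splitting the positions of \<open>w\<close> into \<open>S\<close> and \<open>T\<close>.
  This ring is an integral domain, so localizations of \<open>U(x)\<^sup>*\<close> can be taken inside its field of
  fractions.
\<close>

datatype 'a wfun = Wfun (wcoeff: "'a list \<Rightarrow> complex")

lemma wfun_eqI: "(\<And>w. wcoeff f w = wcoeff g w) \<Longrightarrow> f = g"
  by (cases f; cases g) auto

definition wconst :: "complex \<Rightarrow> 'a wfun" where
  "wconst c = Wfun (\<lambda>w. if w = [] then c else 0)"

definition wtimes :: "'a wfun \<Rightarrow> 'a wfun \<Rightarrow> 'a wfun" where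
  "wtimes f g = Wfun (\<lambda>w. \<Sum>S\<in>Pow {..<length w}. wcoeff f (nths w S) * wcoeff g (nths w (- S)))"

definition wtail :: "'a \<Rightarrow> 'a wfun \<Rightarrow> 'a wfun" where
  "wtail x f = Wfun (\<lambda>w. wcoeff f (x # w))"

lemma wcoeff_wtail [simp]: "wcoeff (wtail x f) w = wcoeff f (x # w)"
  by (simp add: wtail_def)

lemma wtimes_Nil: "wcoeff (wtimes f g) [] = wcoeff f [] * wcoeff g []"
  by (simp add: wtimes_def)

lemma Pow_lessThan_Suc_shift:
  "Pow {..<Suc n} = (`) Suc ` Pow {..<n} \<union> (\<lambda>S. insert 0 (Suc ` S)) ` Pow {..<n}"
proof -
  have "{..<Suc n} = insert 0 (Suc ` {..<n})"
    by (rule lessThan_Suc_eq_insert_0)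
  then have "Pow {..<Suc n} = Pow (Suc ` {..<n}) \<union> insert 0 ` Pow (Suc ` {..<n})"
    by (simp only: Pow_insert)
  also have "Pow (Suc ` {..<n}) = (`) Suc ` Pow {..<n}"
    by (rule image_Pow_surj[symmetric]) simp
  finally show ?thesis by (simp only: image_image)
qed

lemma wtimes_Cons:
  "wcoeff (wtimes f g) (x # w) =
     wcoeff (wtimes (wtail x f) g) w + wcoeff (wtimes f (wtail x g)) w"
proof -
  let ?n = "length w"
  let ?F = "\<lambda>S. wcoeff f (nths (x # w) S) * wcoeff g (nths (x # w) (- S))"
  have i1: "inj_on ((`) Suc) (Pow {..<?n})"
    by (rule inj_onI) (simp only: inj_image_eq_iff[OF inj_Suc])
  have i2: "inj_on (\<lambda>S. insert 0 (Suc ` S)) (Pow {..<?n})"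
  proof (rule inj_onI)
    fix S T assume "insert 0 (Suc ` S) = insert 0 (Suc ` T)"
    then have "insert 0 (Suc ` S) - {0} = insert 0 (Suc ` T) - {0}" by (rule arg_cong)
    then have "Suc ` S = Suc ` T" by (simp add: insert_Diff_if)
    then show "S = T" by (simp only: inj_image_eq_iff[OF inj_Suc])
  qed
  have "wcoeff (wtimes f g) (x # w) = sum ?F (Pow {..<Suc ?n})"
    by (simp add: wtimes_def)
  also have "\<dots> = sum ?F ((`) Suc ` Pow {..<?n}) +
                  sum ?F ((\<lambda>S. insert 0 (Suc ` S)) ` Pow {..<?n})"
    unfolding Pow_lessThan_Suc_shift by (rule sum.union_disjoint) auto
  also have "sum ?F ((`) Suc ` Pow {..<?n}) = wcoeff (wtimes f (wtail x g)) w"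
  proof -
    have *: "{j. Suc j \<in> Suc ` S} = S" "{j. Suc j \<in> - Suc ` S} = - S"
         "0 \<notin> Suc ` S" "0 \<in> - (Suc ` S)" for S by auto
    show ?thesis
      unfolding sum.reindex[OF i1] wtimes_def by (simp add: nths_Cons * del: Compl_iff)
  qed
  also have "sum ?F ((\<lambda>S. insert 0 (Suc ` S)) ` Pow {..<?n}) = wcoeff (wtimes (wtail x f) g) w"
  proof -
    have *: "{j. Suc j \<in> insert 0 (Suc ` S)} = S" "{j. Suc j \<in> - insert 0 (Suc ` S)} = - S"
         "0 \<in> insert 0 (Suc ` S)" "0 \<notin> - insert 0 (Suc ` S)" for S by auto
    show ?thesis
      unfolding sum.reindex[OF i2] wtimes_def
      by (simp add: nths_Cons * del: Compl_iff insert_iff Compl_insert)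
  qed
  finally show ?thesis by simp
qed

instantiation wfun :: (type) comm_ring_1
begin

definition "zero_wfun = Wfun (\<lambda>_. 0)"
definition "one_wfun = (wconst 1 :: 'a wfun)"
definition "plus_wfun f g = Wfun (\<lambda>w. wcoeff f w + wcoeff g w)"
definition "minus_wfun f g = Wfun (\<lambda>w. wcoeff f w - wcoeff g w)"
definition "uminus_wfun f = Wfun (\<lambda>w. - wcoeff f w)"
definition "times_wfun = (wtimes :: 'a wfun \<Rightarrow> 'a wfun \<Rightarrow> 'a wfun)"

lemma wcoeff_simps [simp]:
  "wcoeff 0 w = 0"
  "wcoeff (f + g) w = wcoeff f w + wcoeff g w"
  "wcoeff (f - g) w = wcoeff f w - wcoeff g w"
  "wcoeff (- f) w = - wcoeff f w"
  by (simp_all add: zero_wfun_def plus_wfun_def minus_wfun_def uminus_wfun_def)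

lemma wcoeff_times:
  "wcoeff (f * g) [] = wcoeff f [] * wcoeff g []"
  "wcoeff (f * g) (x # w) = wcoeff (wtail x f * g) w + wcoeff (f * wtail x g) w"
  by (simp_all add: times_wfun_def wtimes_Nil wtimes_Cons)

lemma wtail_simps:
  "wtail x (f + g) = wtail x f + wtail x g"
  "wtail x (f * g) = wtail x f * g + f * wtail x g"
  "wtail x 1 = 0"
  by (rule wfun_eqI; simp add: wcoeff_times one_wfun_def wconst_def)+

lemma wcoeff_mult_add:
  "wcoeff ((f + g) * h) w = wcoeff (f * h) w + wcoeff (g * h) w"
  by (induction w arbitrary: f g h) (simp_all add: wcoeff_times wtail_simps algebra_simps)

lemma wcoeff_mult_commute: "wcoeff (f * g) w = wcoeff (g * f) w"
  by (induction w arbitrary: f g) (simp_all add: wcoeff_times)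

lemma wcoeff_mult_add2:
  "wcoeff (h * (f + g)) w = wcoeff (h * f) w + wcoeff (h * g) w"
  by (metis wcoeff_mult_add wcoeff_mult_commute)

lemma wcoeff_mult_zero: "wcoeff (0 * f) w = 0"
proof -
  have "(0 :: 'a wfun) + 0 = 0" by (rule wfun_eqI) simp
  then show ?thesis using wcoeff_mult_add[of 0 0 f w] by simp
qed

lemma wcoeff_mult_assoc: "wcoeff (f * g * h) w = wcoeff (f * (g * h)) w"
  by (induction w arbitrary: f g h)
    (simp_all add: wcoeff_times wtail_simps wcoeff_mult_add wcoeff_mult_add2)

lemma wcoeff_mult_one: "wcoeff (1 * f) w = wcoeff f w"
proof (induction w arbitrary: f)
  case Nil
  then show ?case by (simp add: wcoeff_times one_wfun_def wconst_def)
next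
  case (Cons x w)
  then show ?case by (simp add: wcoeff_times(2) wtail_simps wcoeff_mult_zero)
qed

instance
proof
  fix a b c :: "'a wfun"
  show "a * b * c = a * (b * c)" by (rule wfun_eqI) (rule wcoeff_mult_assoc)
  show "a * b = b * a" by (rule wfun_eqI) (rule wcoeff_mult_commute)
  show "1 * a = a" by (rule wfun_eqI) (rule wcoeff_mult_one)
  show "(a + b) * c = a * c + b * c" by (rule wfun_eqI) (simp add: wcoeff_mult_add)
  show "(0::'a wfun) \<noteq> 1"
    by (auto simp: zero_wfun_def one_wfun_def wconst_def fun_eq_iff)
qed (rule wfun_eqI; simp)+

end

lemma nths_in_shuffles: "w \<in> shuffles (nths w S) (nths w (- S))"
proof (induction w arbitrary: S)
  case (Cons x w)
  have "- {j. Suc j \<in> S} = {j. Suc j \<in> - S}" by auto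
  with Cons[of "{j. Suc j \<in> S}"] show ?case
    by (auto simp: nths_Cons intro: Cons_in_shuffles_leftI Cons_in_shuffles_rightI)
qed simp

lemma shuffles_imp_nths:
  "w \<in> shuffles u v \<Longrightarrow> \<exists>S \<in> Pow {..<length w}. nths w S = u \<and> nths w (- S) = v"
proof (induction w arbitrary: u v)
  case (Cons x w)
  from Cons.prems consider
      u' where "u = x # u'" "w \<in> shuffles u' v"
    | v' where "v = x # v'" "w \<in> shuffles u v'"
    by (auto simp: Cons_in_shuffles_iff neq_Nil_conv)
  then show ?case
  proof cases
    case 1
    from Cons.IH[OF 1(2)] obtain S where S: "S \<in> Pow {..<length w}"
      "nths w S = u'" "nths w (- S) = v" by auto
    have *: "{j. Suc j \<in> insert 0 (Suc ` S)} = S" "{j. Suc j \<in> - insert 0 (Suc ` S)} = - S"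
         "0 \<in> insert 0 (Suc ` S)" "0 \<notin> - insert 0 (Suc ` S)" by auto
    show ?thesis
      by (rule bexI[of _ "insert 0 (Suc ` S)"])
        (use S 1 * in \<open>auto simp: nths_Cons simp del: Compl_iff insert_iff Compl_insert\<close>)
  next
    case 2
    from Cons.IH[OF 2(2)] obtain S where S: "S \<in> Pow {..<length w}"
      "nths w S = u" "nths w (- S) = v'" by auto
    have *: "{j. Suc j \<in> Suc ` S} = S" "{j. Suc j \<in> - Suc ` S} = - S"
         "0 \<notin> Suc ` S" "0 \<in> - (Suc ` S)" by auto
    show ?thesis
      by (rule bexI[of _ "Suc ` S"])
        (use S 2 * in \<open>auto simp: nths_Cons simp del: Compl_iff\<close>)
  qed
qed simp

lemma shuffles_nonempty: "shuffles u v \<noteq> {}"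
  by (metis splice_in_shuffles empty_iff)

text \<open>Lowering one of two words (length-lexicographically) lowers a given shuffle of them.\<close>

lemma lenlex_shuffles:
  assumes "w \<in> shuffles u' v'"
    and "u = u' \<or> (u, u') \<in> lenlex r" and "v = v' \<or> (v, v') \<in> lenlex r"
  shows "\<exists>w'\<in>shuffles u v. (u = u' \<and> v = v' \<and> w' = w) \<or> (w', w) \<in> lenlex r"
  using assms
proof (induction w arbitrary: u v u' v')
  case Nil
  then show ?case by auto
next
  case (Cons x w)
  have len: "length u \<le> length u'" "length v \<le> length v'"
    using Cons.prems(2,3) by (auto dest: lenlex_length)
  have main: "\<exists>w'\<in>shuffles p q. (p = x # p' \<and> q = q' \<and> w' = x # w) \<or> (w', x # w) \<in> lenlex r"
    if w: "w \<in> shuffles p' q'" and p: "p = x # p' \<or> (p, x # p') \<in> lenlex r"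
      and q: "q = q' \<or> (q, q') \<in> lenlex r" for p q p' q'
  proof (cases "length p + length q < Suc (length p' + length q')")
    case True
    obtain w' where w': "w' \<in> shuffles p q" using shuffles_nonempty[of p q] by auto
    have "length w' < length (x # w)"
      using length_shuffles[OF w'] length_shuffles[OF w] True by simp
    then have "(w', x # w) \<in> lenlex r" by (auto simp: lenlex_conv)
    with w' show ?thesis by blast
  next
    case False
    have "length p \<le> Suc (length p')" "length q \<le> length q'"
      using p q by (auto dest: lenlex_length)
    with False have l: "length p = Suc (length p')" "length q = length q'" by auto
    then obtain y p1 where p1: "p = y # p1" by (cases p) auto
    show ?thesis
    proof (cases "y = x")
      case True
      then have pe: "p = x # p1" using p1 by simp
      from True have "p1 = p' \<or> (p1, p') \<in> lenlex r \<or> (x, x) \<in> r"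
        using p p1 l by (auto simp: Cons_lenlex_iff)
      then show ?thesis
      proof (elim disjE)
        assume "(x, x) \<in> r"
        obtain w' where w': "w' \<in> shuffles p1 q" using shuffles_nonempty by blast
        have "length w' = length w"
          using length_shuffles[OF w'] length_shuffles[OF w] l p1 by simp
        then have "(x # w', x # w) \<in> lenlex r" using \<open>(x, x) \<in> r\<close> by (simp add: Cons_lenlex_iff)
        moreover have "x # w' \<in> shuffles p q"
          unfolding pe by (rule Cons_in_shuffles_leftI[OF w'])
        ultimately show ?thesis by blast
      next
        assume "p1 = p'"
        from Cons.IH[OF w, of p1 q] this q obtain w' where w': "w' \<in> shuffles p1 q"
          "(p1 = p' \<and> q = q' \<and> w' = w) \<or> (w', w) \<in> lenlex r" by blast
        from w'(1) have "x # w' \<in> shuffles p q"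
          unfolding pe by (rule Cons_in_shuffles_leftI)
        moreover from w'(2) have "(p = x # p' \<and> q = q' \<and> x # w' = x # w)
            \<or> (x # w', x # w) \<in> lenlex r"
          using pe by (auto simp: Cons_lenlex_iff)
        ultimately show ?thesis by blast
      next
        assume "(p1, p') \<in> lenlex r"
        from Cons.IH[OF w, of p1 q] this q obtain w' where w': "w' \<in> shuffles p1 q"
          "(p1 = p' \<and> q = q' \<and> w' = w) \<or> (w', w) \<in> lenlex r" by blast
        from w'(1) have "x # w' \<in> shuffles p q"
          unfolding pe by (rule Cons_in_shuffles_leftI)
        moreover from w'(2) have "(p = x # p' \<and> q = q' \<and> x # w' = x # w)
            \<or> (x # w', x # w) \<in> lenlex r"
          using pe by (auto simp: Cons_lenlex_iff)
        ultimately show ?thesis by blast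
      qed
    next
      case False
      then have yx: "(y, x) \<in> r" using p p1 l by (auto simp: Cons_lenlex_iff)
      obtain w' where w': "w' \<in> shuffles p1 q" using shuffles_nonempty by blast
      have "length w' = length w"
        using length_shuffles[OF w'] length_shuffles[OF w] l p1 by simp
      then have "(y # w', x # w) \<in> lenlex r" using yx by (simp add: Cons_lenlex_iff)
      moreover have "y # w' \<in> shuffles p q"
        unfolding p1 by (rule Cons_in_shuffles_leftI[OF w'])
      ultimately show ?thesis by blast
    qed
  qed
  from Cons.prems(1) consider
      u1 where "u' = x # u1" "w \<in> shuffles u1 v'"
    | v1 where "v' = x # v1" "w \<in> shuffles u' v1"
    by (auto simp: Cons_in_shuffles_iff neq_Nil_conv)
  then show ?case
  proof cases
    case 1
    have "\<exists>w'\<in>shuffles u v. (u = x # u1 \<and> v = v' \<and> w' = x # w) \<or> (w', x # w) \<in> lenlex r"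
      using Cons.prems(2,3) unfolding 1(1) by (intro main[OF 1(2)])
    then show ?thesis unfolding 1(1) .
  next
    case 2
    have "w \<in> shuffles v1 u'" using 2(2) by (simp only: shuffles_commutes)
    then have "\<exists>w'\<in>shuffles v u. (v = x # v1 \<and> u = u' \<and> w' = x # w) \<or> (w', x # w) \<in> lenlex r"
      using Cons.prems(2,3) unfolding 2(1) by (intro main)
    then show ?thesis unfolding 2(1) by (simp only: shuffles_commutes[of v u] conj_commute conj_left_commute)
  qed
qed

lemma wfun_no_zero_divisors:
  fixes f g :: "'a wfun"
  assumes "f \<noteq> 0" "g \<noteq> 0"
  shows "f * g \<noteq> 0"
proof -
  from well_ordering[where 'a = 'a]
  obtain r0 :: "'a rel" where r0: "Well_order r0" "Field r0 = UNIV"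
    by (elim exE conjE) (rule that)
  define r where "r = r0 - Id"
  have "wf r" using r0 by (simp add: r_def well_order_on_def)
  have "total r" using r0 by (auto simp: r_def well_order_on_def linear_order_on_def total_on_def)
  let ?L = "lenlex r"
  have wfL: "wf ?L" using \<open>wf r\<close> by blast
  have totL: "total ?L" using \<open>total r\<close> by (rule total_lenlex)
  have irr: "(x, x) \<notin> ?L" for x using wfL by simp
  have ex: "\<exists>u. P u \<and> (\<forall>v. P v \<longrightarrow> u = v \<or> (u, v) \<in> ?L)" if P: "P u0" for P and u0 :: "'a list"
  proof -
    obtain u where "P u" "\<And>y. (y, u) \<in> ?L \<Longrightarrow> \<not> P y"
      using wfE_min[OF wfL, of u0 "Collect P"] P by (metis mem_Collect_eq)
    then show ?thesis using totL by (auto simp: total_on_def)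
  qed
  have "\<exists>u. wcoeff f u \<noteq> 0" "\<exists>u. wcoeff g u \<noteq> 0"
    using assms by (metis wfun_eqI wcoeff_simps(1))+
  then obtain u v where
    u: "wcoeff f u \<noteq> 0" "\<And>u'. wcoeff f u' \<noteq> 0 \<Longrightarrow> u = u' \<or> (u, u') \<in> ?L" and
    v: "wcoeff g v \<noteq> 0" "\<And>v'. wcoeff g v' \<noteq> 0 \<Longrightarrow> v = v' \<or> (v, v') \<in> ?L"
    using ex[of "\<lambda>u. wcoeff f u \<noteq> 0"] ex[of "\<lambda>u. wcoeff g u \<noteq> 0"] by metis
  obtain w where w: "w \<in> shuffles u v" "\<And>w'. w' \<in> shuffles u v \<Longrightarrow> w = w' \<or> (w, w') \<in> ?L"
    using ex[of "\<lambda>w. w \<in> shuffles u v"] shuffles_nonempty[of u v] by blast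
  let ?A = "{S \<in> Pow {..<length w}. nths w S = u \<and> nths w (- S) = v}"
  let ?F = "\<lambda>S. wcoeff f (nths w S) * wcoeff g (nths w (- S))"
  have "?F S = 0" if "S \<in> Pow {..<length w} - ?A" for S
  proof (rule ccontr)
    assume "?F S \<noteq> 0"
    then have "u = nths w S \<or> (u, nths w S) \<in> ?L" "v = nths w (- S) \<or> (v, nths w (- S)) \<in> ?L"
      using u(2) v(2) by auto
    from lenlex_shuffles[OF nths_in_shuffles this] that
    obtain w' where "w' \<in> shuffles u v" "(w', w) \<in> ?L" by auto
    with w(2) have "(w', w') \<in> ?L \<or> (w, w) \<in> ?L"
      by (metis \<open>wf r\<close> wf_lenlex wf_not_sym)
    then show False using irr by blast
  qed
  then have "wcoeff (f * g) w = sum ?F ?A"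
    unfolding times_wfun_def wtimes_def wfun.sel
    by (intro sum.mono_neutral_right) auto
  also have "\<dots> = of_nat (card ?A) * (wcoeff f u * wcoeff g v)"
    by simp
  finally have "wcoeff (f * g) w = of_nat (card ?A) * (wcoeff f u * wcoeff g v)" .
  moreover have "card ?A \<noteq> 0" using shuffles_imp_nths[OF w(1)] by auto
  ultimately show ?thesis using u(1) v(1) by auto
qed

instance wfun :: (type) idom
  by standard (rule wfun_no_zero_divisors)


text \<open>
  \<open>C[[X]] = U(x)\<^sup>*\<close> for a Lie algebra with carrier \<open>X\<close>, scalar multiplication \<open>sc\<close> and bracket \<open>br\<close>:
  functionals on the tensor algebra that vanish on the two-sided ideal generated by
  \<open>x y - y x - [x, y]\<close>. They are extended by \<open>0\<close> to words with letters outside \<open>X\<close>.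
\<close>

definition formal_functions ::
  "(complex \<Rightarrow> 'a \<Rightarrow> 'a) \<Rightarrow> 'a set \<Rightarrow> ('a \<Rightarrow> 'a \<Rightarrow> 'a) \<Rightarrow> 'a::ab_group_add wfun set" where
  "formal_functions sc X br = {f.
     (\<forall>w. \<not> set w \<subseteq> X \<longrightarrow> wcoeff f w = 0) \<and>
     (\<forall>p q. set p \<subseteq> X \<and> set q \<subseteq> X \<longrightarrow>
       (\<forall>x\<in>X. \<forall>y\<in>X. wcoeff f (p @ [x + y] @ q) = wcoeff f (p @ [x] @ q) + wcoeff f (p @ [y] @ q)) \<and>
       (\<forall>c. \<forall>x\<in>X. wcoeff f (p @ [sc c x] @ q) = c * wcoeff f (p @ [x] @ q)) \<and>
       (\<forall>x\<in>X. \<forall>y\<in>X. wcoeff f (p @ [x, y] @ q) - wcoeff f (p @ [y, x] @ q)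
                       = wcoeff f (p @ [br x y] @ q)))}"

definition word_function :: "'a set \<Rightarrow> ('a list \<Rightarrow> complex) \<Rightarrow> 'a wfun" where
  "word_function X F = Wfun (\<lambda>w. if set w \<subseteq> X then F w else 0)"

text \<open>
  \<open>(L\<^sub>\<xi> f)(x) = d/d\<epsilon> f(e\<^sup>-\<^sup>\<epsilon>\<^sup>\<xi> x)\<close> and \<open>(R\<^sub>\<xi> f)(x) = d/d\<epsilon> f(x e\<^sup>\<epsilon>\<^sup>\<xi>)\<close> at \<open>\<epsilon> = 0\<close>, the word
  \<open>x\<^sub>1 \<dots> x\<^sub>n\<close> being the product \<open>x\<^sub>1 \<cdots> x\<^sub>n\<close> in \<open>U(x)\<close>.
\<close>

definition L_der :: "'a \<Rightarrow> 'a wfun \<Rightarrow> 'a wfun" where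
  "L_der \<xi> f = Wfun (\<lambda>w. - wcoeff f (\<xi> # w))"

definition R_der :: "'a \<Rightarrow> 'a wfun \<Rightarrow> 'a wfun" where
  "R_der \<xi> f = Wfun (\<lambda>w. wcoeff f (w @ [\<xi>]))"

definition fract_const :: "complex \<Rightarrow> 'a wfun fract" where
  "fract_const c = Fract (wconst c) 1"

definition localization :: "'a wfun set \<Rightarrow> 'a wfun \<Rightarrow> 'a wfun fract set" where
  "localization S P = {Fract f (P ^ n) | f n. f \<in> S}"

text \<open>The extension of a derivation to fractions (quotient rule).\<close>

definition fract_der :: "('a wfun \<Rightarrow> 'a wfun) \<Rightarrow> 'a wfun fract \<Rightarrow> 'a wfun fract" where
  "fract_der D q = (THE r. \<forall>a b. b \<noteq> 0 \<and> q = Fract a b \<longrightarrow> r = Fract (b * D a - a * D b) (b * b))"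


section \<open>Duals and tensors\<close>

text \<open>
  Tensors in \<open>g\<^sup>\<otimes>\<^sup>k\<close>, for finite-dimensional \<open>g\<close>, are represented by the multilinear forms
  on \<open>g\<^sup>*\<close> that they define: \<open>a \<otimes> b\<close> is \<open>(\<phi>, \<psi>) \<mapsto> \<phi>(a) \<psi>(b)\<close>. Tensors with coefficients in an algebra
  are forms with values in this algebra. All tensors are extended by \<open>0\<close> outside \<open>g\<^sup>*\<close>.
\<close>

type_synonym 'g functional = "'g \<Rightarrow> complex"
type_synonym ('g, 'r) tensor2 = "'g functional \<Rightarrow> 'g functional \<Rightarrow> 'r"
type_synonym ('g, 'r) tensor3 = "'g functional \<Rightarrow> 'g functional \<Rightarrow> 'g functional \<Rightarrow> 'r"
type_synonym 'g fractions = "'g functional wfun fract"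

text \<open>\<open>[x \<otimes> 1 + 1 \<otimes> x, T]\<close>\<close>

definition ad2 :: "('g \<Rightarrow> 'g \<Rightarrow> 'g) \<Rightarrow> 'g \<Rightarrow> ('g, 'r::plus) tensor2 \<Rightarrow> ('g, 'r) tensor2" where
  "ad2 br x T = (\<lambda>\<phi> \<psi>. T (\<lambda>z. \<phi> (br x z)) \<psi> + T \<phi> (\<lambda>z. \<psi> (br x z)))"

definition Alt :: "('g, 'r::plus) tensor3 \<Rightarrow> ('g, 'r) tensor3" where
  "Alt T = (\<lambda>\<phi> \<psi> \<chi>. T \<phi> \<psi> \<chi> + T \<psi> \<chi> \<phi> + T \<chi> \<phi> \<psi>)"

text \<open>\<open>(\<delta> \<otimes> id)(T)\<close>: for \<open>T = a \<otimes> b\<close> this is \<open>\<delta>(a)(\<phi>, \<psi>) \<chi>(b)\<close>.\<close>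

definition cobracket_first ::
  "('g \<Rightarrow> ('g, complex) tensor2) \<Rightarrow> ('g, 'r) tensor2 \<Rightarrow> ('g, 'r) tensor3" where
  "cobracket_first \<delta> T = (\<lambda>\<phi> \<psi> \<chi>. T (\<lambda>x. \<delta> x \<phi> \<psi>) \<chi>)"

locale complex_space = vector_space scale
  for scale :: "complex \<Rightarrow> 'g::ab_group_add \<Rightarrow> 'g"
begin

text \<open>The dual of a subspace \<open>V\<close>; functionals on \<open>V\<close> are extended by \<open>0\<close> (not linearly) outside \<open>V\<close>.\<close>

definition dual :: "'g set \<Rightarrow> 'g functional set" where
  "dual V = {\<phi>. (\<forall>x\<in>V. \<forall>y\<in>V. \<phi> (x + y) = \<phi> x + \<phi> y) \<and>
                (\<forall>c. \<forall>x\<in>V. \<phi> (scale c x) = c * \<phi> x) \<and> (\<forall>x. x \<notin> V \<longrightarrow> \<phi> x = 0)}"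

definition basis_of :: "'g set \<Rightarrow> 'g set" where
  "basis_of V = (SOME B. B \<subseteq> V \<and> independent B \<and> span B = V)"

definition dual_vector :: "'g set \<Rightarrow> 'g \<Rightarrow> 'g functional" where
  "dual_vector V e = (\<lambda>x. if x \<in> V then representation (basis_of V) x e else 0)"

definition pure2 :: "'g \<Rightarrow> 'g \<Rightarrow> ('g, complex) tensor2" where
  "pure2 a b = (\<lambda>\<phi> \<psi>. if \<phi> \<in> dual UNIV \<and> \<psi> \<in> dual UNIV then \<phi> a * \<psi> b else 0)"

definition pure3 :: "'g \<Rightarrow> 'g \<Rightarrow> 'g \<Rightarrow> ('g, complex) tensor3" where
  "pure3 a b c = (\<lambda>\<phi> \<psi> \<chi>. if \<chi> \<in> dual UNIV then pure2 a b \<phi> \<psi> * \<chi> c else 0)"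

definition tensors2 :: "'g set \<Rightarrow> 'g set \<Rightarrow> ('g, complex) tensor2 set" where
  "tensors2 A B = {T. \<exists>(n::nat) a b. (\<forall>i<n. a i \<in> A \<and> b i \<in> B) \<and>
     T = (\<lambda>\<phi> \<psi>. \<Sum>i<n. pure2 (a i) (b i) \<phi> \<psi>)}"

definition wedge2 :: "'g set \<Rightarrow> ('g, complex) tensor2 set" where
  "wedge2 A = {T \<in> tensors2 A A. \<forall>\<phi> \<psi>. T \<psi> \<phi> = - T \<phi> \<psi>}"

definition wedge3 :: "'g set \<Rightarrow> ('g, complex) tensor3 set" where
  "wedge3 A = {T. (\<exists>(n::nat) a b c. (\<forall>i<n. a i \<in> A \<and> b i \<in> A \<and> c i \<in> A) \<and>
       T = (\<lambda>\<phi> \<psi> \<chi>. \<Sum>i<n. pure3 (a i) (b i) (c i) \<phi> \<psi> \<chi>)) \<and>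
     (\<forall>\<phi> \<psi> \<chi>. T \<psi> \<phi> \<chi> = - T \<phi> \<psi> \<chi> \<and> T \<phi> \<chi> \<psi> = - T \<phi> \<psi> \<chi>)}"

text \<open>\<open>\<Sum>\<^sub>i a\<^sub>i \<otimes> b\<^sub>i \<otimes> f\<^sub>i\<close>\<close>

definition tensor_sum ::
  "nat \<Rightarrow> (nat \<Rightarrow> 'g) \<Rightarrow> (nat \<Rightarrow> 'g) \<Rightarrow> (nat \<Rightarrow> 'g fractions) \<Rightarrow> ('g, 'g fractions) tensor2" where
  "tensor_sum n a b f = (\<lambda>\<phi> \<psi>. \<Sum>i<n. fract_const (pure2 (a i) (b i) \<phi> \<psi>) * f i)"

definition wedge2_over :: "'g set \<Rightarrow> 'g fractions set \<Rightarrow> ('g, 'g fractions) tensor2 set" where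
  "wedge2_over A S = {T. (\<exists>n a b f. (\<forall>i<n. a i \<in> A \<and> b i \<in> A \<and> f i \<in> S) \<and> T = tensor_sum n a b f) \<and>
     (\<forall>\<phi> \<psi>. T \<psi> \<phi> = - T \<phi> \<psi>)}"

inductive_set polynomial_functions :: "'g set \<Rightarrow> ('g functional \<Rightarrow> complex) set" for V :: "'g set" where
  const: "(\<lambda>_. c) \<in> polynomial_functions V"
| eval: "x \<in> V \<Longrightarrow> (\<lambda>\<phi>. \<phi> x) \<in> polynomial_functions V"
| add: "p \<in> polynomial_functions V \<Longrightarrow> q \<in> polynomial_functions V \<Longrightarrow>
    (\<lambda>\<phi>. p \<phi> + q \<phi>) \<in> polynomial_functions V"
| mult: "p \<in> polynomial_functions V \<Longrightarrow> q \<in> polynomial_functions V \<Longrightarrow>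
    (\<lambda>\<phi>. p \<phi> * q \<phi>) \<in> polynomial_functions V"

text \<open>\<open>Q\<close> holds for generic elements of the dual of \<open>V\<close>: off the zero set of a nonzero polynomial.\<close>

definition generic_in_dual :: "'g set \<Rightarrow> ('g functional \<Rightarrow> bool) \<Rightarrow> bool" where
  "generic_in_dual V Q \<longleftrightarrow> (\<exists>p \<in> polynomial_functions V.
     (\<exists>\<phi>\<in>dual V. p \<phi> \<noteq> 0) \<and> (\<forall>\<phi>\<in>dual V. p \<phi> \<noteq> 0 \<longrightarrow> Q \<phi>))"

end


section \<open>Lie bialgebras and Poisson-Lie dynamical r-matrices\<close>

locale lie_bialgebra = complex_space scale
  for scale :: "complex \<Rightarrow> 'g::ab_group_add \<Rightarrow> 'g" +
  fixes br :: "'g \<Rightarrow> 'g \<Rightarrow> 'g"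
    and \<delta> :: "'g \<Rightarrow> ('g, complex) tensor2"
  assumes finite_dim: "\<exists>B. finite B \<and> span B = UNIV"
    and br_add: "br (x + y) z = br x z + br y z"
    and br_scale: "br (scale c x) z = scale c (br x z)"
    and br_self: "br x x = 0"
    and br_add_right: "br z (x + y) = br z x + br z y"
    and br_scale_right: "br z (scale c x) = scale c (br z x)"
    and jacobi: "br x (br y z) + br y (br z x) + br z (br x y) = 0"
    and cobr_wedge: "\<delta> x \<in> wedge2 UNIV"
    and cobr_add: "\<delta> (x + y) \<phi> \<psi> = \<delta> x \<phi> \<psi> + \<delta> y \<phi> \<psi>"
    and cobr_scale: "\<delta> (scale c x) \<phi> \<psi> = c * \<delta> x \<phi> \<psi>"
    and co_jacobi: "\<lbrakk>\<phi> \<in> dual UNIV; \<psi> \<in> dual UNIV; \<chi> \<in> dual UNIV\<rbrakk> \<Longrightarrow>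
      Alt (cobracket_first \<delta> (\<delta> x)) \<phi> \<psi> \<chi> = 0"
    and cocycle: "\<lbrakk>\<phi> \<in> dual UNIV; \<psi> \<in> dual UNIV\<rbrakk> \<Longrightarrow>
      \<delta> (br x y) \<phi> \<psi> = ad2 br x (\<delta> y) \<phi> \<psi> - ad2 br y (\<delta> x) \<phi> \<psi>"
begin

definition lie_subbialgebra :: "'g set \<Rightarrow> bool" where
  "lie_subbialgebra h \<longleftrightarrow> subspace h \<and> (\<forall>x\<in>h. \<forall>y\<in>h. br x y \<in> h) \<and> (\<forall>x\<in>h. \<delta> x \<in> tensors2 h h)"

text \<open>
  The dual Lie bracket on the dual of a Lie subbialgebra \<open>h\<close>, \<open>[\<phi>, \<psi>](x) = (\<phi> \<otimes> \<psi>)(\<delta>(x))\<close>. To be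
  applied to \<open>\<delta>(x) \<in> h \<otimes> h \<subseteq> g \<otimes> g\<close>, functionals on \<open>h\<close> are extended to \<open>g\<close> linearly; the value does not
  depend on the extension.
\<close>

definition linear_extension :: "'g set \<Rightarrow> 'g functional \<Rightarrow> 'g functional" where
  "linear_extension h \<phi> = (SOME \<phi>'. \<phi>' \<in> dual UNIV \<and> (\<forall>x\<in>h. \<phi>' x = \<phi> x))"

definition dual_bracket :: "'g set \<Rightarrow> 'g functional \<Rightarrow> 'g functional \<Rightarrow> 'g functional" where
  "dual_bracket h \<phi> \<psi> =
     (\<lambda>x. if x \<in> h then \<delta> x (linear_extension h \<phi>) (linear_extension h \<psi>) else 0)"

text \<open>
  The bracket of the double \<open>h \<oplus> h\<^sup>*\<close>. Since \<open>h\<close> and \<open>h\<^sup>*\<close> are Lie subalgebras, invariance of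
  \<open>\<langle>(x, \<phi>), (y, \<psi>)\<rangle> = \<phi>(y) + \<psi>(x)\<close> forces \<open>[x, \<phi>] = (\<phi> \<otimes> id)(\<delta>(x)) - \<phi> \<circ> ad x\<close>: the first
  component pairs with \<open>\<psi>\<close> to \<open>\<langle>[x, \<phi>], \<psi>\<rangle> = \<langle>x, [\<phi>, \<psi>]\<rangle>\<close>, the second one with \<open>y\<close> to
  \<open>\<langle>[x, \<phi>], y\<rangle> = - \<langle>\<phi>, [x, y]\<rangle>\<close>.
\<close>

definition contract_cobracket :: "'g set \<Rightarrow> 'g functional \<Rightarrow> 'g \<Rightarrow> 'g" where
  "contract_cobracket h \<phi> x = (THE a. a \<in> h \<and> (\<forall>\<psi>\<in>dual h. \<psi> a = dual_bracket h \<phi> \<psi> x))"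

definition ad_transpose :: "'g set \<Rightarrow> 'g \<Rightarrow> 'g functional \<Rightarrow> 'g functional" where
  "ad_transpose h x \<phi> = (\<lambda>z. if z \<in> h then \<phi> (br x z) else 0)"

definition double_bracket ::
  "'g set \<Rightarrow> 'g \<times> 'g functional \<Rightarrow> 'g \<times> 'g functional \<Rightarrow> 'g \<times> 'g functional" where
  "double_bracket h X Y = (case X of (x, \<phi>) \<Rightarrow> case Y of (y, \<psi>) \<Rightarrow>
     (br x y + contract_cobracket h \<psi> x - contract_cobracket h \<phi> y,
      dual_bracket h \<phi> \<psi> - ad_transpose h x \<psi> + ad_transpose h y \<phi>))"

text \<open>
  \<open>Ad(x\<^sup>-\<^sup>1)\<close> on the double of \<open>h\<close>, for \<open>x\<close> in the formal group of \<open>h\<^sup>*\<close>. As a function of \<open>x\<close> it takes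
  the word \<open>\<xi>\<^sub>1 \<dots> \<xi>\<^sub>n\<close> to \<open>(- ad \<xi>\<^sub>n) \<cdots> (- ad \<xi>\<^sub>1)\<close>.
\<close>

definition Ad_inverse ::
  "'g set \<Rightarrow> 'g functional list \<Rightarrow> 'g \<times> 'g functional \<Rightarrow> 'g \<times> 'g functional" where
  "Ad_inverse h w X = foldl (\<lambda>Y \<xi>. - double_bracket h (0, \<xi>) Y) X w"

definition dual_group_functions :: "'g set \<Rightarrow> 'g functional wfun set" where
  "dual_group_functions h = formal_functions (\<lambda>c \<phi> x. c * \<phi> x) (dual h) (dual_bracket h)"

text \<open>
  \<open>(dress\<^sub>a f)(x) = - (R\<^sub>\<xi>\<^sub>(\<^sub>x\<^sub>) f)(x)\<close> with \<open>\<xi>(x) = (Ad(x\<^sup>-\<^sup>1)(a))\<close> projected to \<open>h\<^sup>*\<close>, expanded as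
  \<open>\<Sum>\<^sub>e \<langle>\<xi>(x), e\<rangle> e\<^sup>*\<close> over a basis of \<open>h\<close>.
\<close>

definition dress :: "'g set \<Rightarrow> 'g \<Rightarrow> 'g functional wfun \<Rightarrow> 'g functional wfun" where
  "dress h a f = - (\<Sum>e\<in>basis_of h.
     word_function (dual h) (\<lambda>w. snd (Ad_inverse h w (a, 0)) e) * R_der (dual_vector h e) f)"

text \<open>
  \<open>d\<^sup>L(f) = - \<Sum>\<^sub>e e \<otimes> L\<^sub>e\<^sub>* f\<close>, applied to the coefficients of \<open>\<rho>\<close>; the factor \<open>e\<close> goes to the third
  place.
\<close>

definition dL :: "'g set \<Rightarrow> ('g, 'g fractions) tensor2 \<Rightarrow> ('g, 'g fractions) tensor3" where
  "dL h \<rho> = (\<lambda>\<phi> \<psi> \<chi>. - (\<Sum>e\<in>basis_of h.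
     fract_const (\<chi> e) * fract_der (L_der (dual_vector h e)) (\<rho> \<phi> \<psi>)))"

text \<open>
  For \<open>\<rho> = \<Sum> a \<otimes> b \<otimes> f\<close>, a term of \<open>[\<rho>\<^sup>1\<^sup>2, \<rho>\<^sup>1\<^sup>3]\<close> is \<open>[a, a'] \<otimes> b \<otimes> b' \<otimes> f f'\<close>; here \<open>a\<close> and \<open>a'\<close> are
  expanded in a basis, and similarly for the other two summands.
\<close>

definition CYB :: "('g, 'g fractions) tensor2 \<Rightarrow> ('g, 'g fractions) tensor3" where
  "CYB \<rho> = (\<lambda>\<phi> \<psi> \<chi>.
     let B = basis_of UNIV; d = dual_vector UNIV in
       (\<Sum>e\<in>B. \<Sum>e'\<in>B. fract_const (\<phi> (br e e')) * (\<rho> (d e) \<psi> * \<rho> (d e') \<chi>)) +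
       (\<Sum>e\<in>B. \<Sum>e'\<in>B. fract_const (\<psi> (br e e')) * (\<rho> \<phi> (d e) * \<rho> (d e') \<chi>)) +
       (\<Sum>e\<in>B. \<Sum>e'\<in>B. fract_const (\<chi> (br e e')) * (\<rho> \<phi> (d e) * \<rho> \<psi> (d e'))))"

text \<open>
  The condition on \<open>Z \<in> \<Lambda>\<^sup>3(g)\<^sup>g\<close>: \<open>Alt((\<delta> \<otimes> id \<otimes> id)(Z)) = 0\<close>, where \<open>Alt\<close> permutes the first three
  of the four tensor factors.
\<close>

definition admissible_trivector :: "('g, complex) tensor3 \<Rightarrow> bool" where
  "admissible_trivector Z \<longleftrightarrow> Z \<in> wedge3 UNIV \<and>
     (\<forall>x. \<forall>\<phi>\<in>dual UNIV. \<forall>\<psi>\<in>dual UNIV. \<forall>\<chi>\<in>dual UNIV.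
        Z (\<lambda>z. \<phi> (br x z)) \<psi> \<chi> + Z \<phi> (\<lambda>z. \<psi> (br x z)) \<chi> + Z \<phi> \<psi> (\<lambda>z. \<chi> (br x z)) = 0) \<and>
     (\<forall>\<phi>\<in>dual UNIV. \<forall>\<psi>\<in>dual UNIV. \<forall>\<chi>\<in>dual UNIV. \<forall>\<theta>\<in>dual UNIV.
        Alt (\<lambda>\<alpha> \<beta> \<gamma>. Z (\<lambda>x. \<delta> x \<alpha> \<beta>) \<gamma> \<theta>) \<phi> \<psi> \<chi> = 0)"

definition PL_dynamical_r_matrix ::
  "'g set \<Rightarrow> ('g, complex) tensor3 \<Rightarrow> ('g, 'g fractions) tensor2 \<Rightarrow> bool" where
  "PL_dynamical_r_matrix h Z \<rho> \<longleftrightarrow>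
     lie_subbialgebra h \<and> admissible_trivector Z \<and>
     (\<exists>P \<in> dual_group_functions h. P \<noteq> 0 \<and>
        \<rho> \<in> wedge2_over UNIV (localization (dual_group_functions h) P)) \<and>
     (\<forall>a\<in>h. \<forall>\<phi>\<in>dual UNIV. \<forall>\<psi>\<in>dual UNIV.
        fract_der (dress h a) (\<rho> \<phi> \<psi>) + ad2 br a \<rho> \<phi> \<psi> = 0) \<and>
     (\<forall>\<phi>\<in>dual UNIV. \<forall>\<psi>\<in>dual UNIV. \<forall>\<chi>\<in>dual UNIV.
        CYB \<rho> \<phi> \<psi> \<chi> + Alt (dL h \<rho>) \<phi> \<psi> \<chi> + Alt (cobracket_first \<delta> \<rho>) \<phi> \<psi> \<chi>
          = fract_const (Z \<phi> \<psi> \<chi>))"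

end


section \<open>Lie bialgebras with a splitting\<close>

locale split_lie_bialgebra = lie_bialgebra scale br \<delta>
  for scale :: "complex \<Rightarrow> 'g::ab_group_add \<Rightarrow> 'g" and br and \<delta> +
  fixes l u :: "'g set"
  assumes l_subbialgebra: "lie_subbialgebra l"
    and u_subspace: "subspace u"
    and decomp_inter: "l \<inter> u = {0}"
    and decomp_sum: "\<exists>y\<in>l. \<exists>z\<in>u. x = y + z"
    and br_l_u: "\<lbrakk>x \<in> l; y \<in> u\<rbrakk> \<Longrightarrow> br x y \<in> u"
    and cobr_u: "x \<in> u \<Longrightarrow> \<exists>T1\<in>tensors2 l u. \<exists>T2\<in>tensors2 u l. \<exists>T3\<in>tensors2 u u. \<delta> x = T1 + T2 + T3"
begin

definition l_part :: "'g \<Rightarrow> 'g" where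
  "l_part x = (THE y. y \<in> l \<and> x - y \<in> u)"

text \<open>The embedding of \<open>l\<^sup>*\<close> into \<open>g\<^sup>* = l\<^sup>* \<oplus> u\<^sup>*\<close>.\<close>

definition embed :: "'g functional \<Rightarrow> 'g functional" where
  "embed \<xi> = (\<lambda>x. \<xi> (l_part x))"

definition nondegenerate :: bool where
  "nondegenerate \<longleftrightarrow>
     generic_in_dual l (\<lambda>\<xi>. \<forall>x\<in>u. (\<forall>y\<in>u. \<xi> (l_part (br x y)) = 0) \<longrightarrow> x = 0)"

text \<open>
  \<open>\<omega>\<^sub>x(y, z) = \<langle>(Ad(x\<^sup>-\<^sup>1)(y))\<^sub>g, (Ad(x\<^sup>-\<^sup>1)(z))\<^sub>g\<^sub>*\<rangle>\<close> with the pairing expanded in a basis of \<open>g\<close>; both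
  factors are functions on \<open>L\<^sup>*\<close>, and the product is the one of functions.
\<close>

definition Ad_inverse_l :: "'g functional list \<Rightarrow> 'g \<Rightarrow> 'g \<times> 'g functional" where
  "Ad_inverse_l w x = Ad_inverse UNIV (map embed w) (x, 0)"

definition omega :: "'g \<Rightarrow> 'g \<Rightarrow> 'g functional wfun" where
  "omega x y = (\<Sum>e\<in>basis_of UNIV.
     word_function (dual l) (\<lambda>w. dual_vector UNIV e (fst (Ad_inverse_l w x))) *
     word_function (dual l) (\<lambda>w. snd (Ad_inverse_l w y) e))"

definition linear_iso_to_dual :: "('g \<Rightarrow> 'g functional) \<Rightarrow> bool" where
  "linear_iso_to_dual \<iota> \<longleftrightarrow> bij_betw \<iota> u (dual u) \<and>
     (\<forall>x\<in>u. \<forall>y\<in>u. \<forall>z. \<iota> (x + y) z = \<iota> x z + \<iota> y z) \<and>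
     (\<forall>c. \<forall>x\<in>u. \<forall>z. \<iota> (scale c x) z = c * \<iota> x z)"

text \<open>\<open>a(x)(y) = \<iota>\<^sup>-\<^sup>1(\<omega>\<^sub>x(y, -))\<close>, word by word: an endomorphism of \<open>u\<close> with coefficients in \<open>C[[L\<^sup>*]]\<close>.\<close>

definition omega_endo :: "('g \<Rightarrow> 'g functional) \<Rightarrow> 'g \<Rightarrow> 'g functional list \<Rightarrow> 'g" where
  "omega_endo \<iota> y w = inv_into u \<iota> (\<lambda>z. if z \<in> u then wcoeff (omega y z) w else 0)"

definition P_det :: "('g \<Rightarrow> 'g functional) \<Rightarrow> 'g functional wfun" where
  "P_det \<iota> = (let es = (SOME es. distinct es \<and> set es = basis_of u); n = length es in
     det (mat n n (\<lambda>(j, k). Wfun (\<lambda>w. dual_vector u (es ! j) (omega_endo \<iota> (es ! k) w)))))"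

text \<open>\<open>\<Sum>\<^sub>j a\<^sub>j \<otimes> \<omega>(v, b\<^sub>j) f\<^sub>j = v \<otimes> 1\<close> is tested against functionals on \<open>g\<close>.\<close>

definition is_sigma :: "('g \<Rightarrow> 'g functional) \<Rightarrow> ('g, 'g fractions) tensor2 \<Rightarrow> bool" where
  "is_sigma \<iota> \<sigma> \<longleftrightarrow>
     (let S = localization (dual_group_functions l) (P_det \<iota>) in
       \<sigma> \<in> wedge2_over u S \<and>
       (\<exists>n a b f. (\<forall>j<n. a j \<in> u \<and> b j \<in> u \<and> f j \<in> S) \<and> \<sigma> = tensor_sum n a b f \<and>
          (\<forall>v\<in>u. \<forall>\<phi>\<in>dual UNIV.
             (\<Sum>j<n. fract_const (\<phi> (a j)) * (Fract (omega v (b j)) 1 * f j)) = fract_const (\<phi> v))))"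

definition sigma :: "('g \<Rightarrow> 'g functional) \<Rightarrow> ('g, 'g fractions) tensor2" where
  "sigma \<iota> = (THE \<sigma>. is_sigma \<iota> \<sigma>)"

end

end

theory Submission
  imports Defs "HOL-Computational_Algebra.Formal_Power_Series"
begin

text \<open>
  Write \<open>A(y) = Ad(x\<^sup>-\<^sup>1)(y)\<close> for \<open>y\<close> in the double, \<open>p\<close> and \<open>q\<close> for its components along \<open>g\<close> and \<open>g\<^sup>*\<close>,
  and \<open>\<omega>(y, z) = \<langle>p(y), q(z)\<rangle>\<close>. Since \<open>\<sigma>\<close> is the inverse of \<open>\<omega>\<close> on \<open>u\<close>, both axioms of a dynamical r-matrix
  are equivalent to identities for \<open>\<omega>\<close>. As \<open>A\<close> is an automorphism of the Lie algebra \<open>d(g)\<close>,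
  \<open>dress\<^sub>a A(y) = A([a, y]) - [p(a), A(y)]\<close>, and invariance of \<open>\<omega>\<close> reduces to \<open>\<langle>p(a), [q(y), q(z)]\<rangle> = 0\<close>, which
  holds because \<open>u\<^sup>*\<close> is an ideal of \<open>g\<^sup>*\<close>. The left derivative of \<open>\<omega>\<close> gives the \<open>l \<otimes> u \<otimes> u\<close> component of
  the dynamical Yang-Baxter equation. Its \<open>u \<otimes> u \<otimes> u\<close> component says that the elements
  \<open>y + \<omega>(y, -)\<close>, which span \<open>Ad(x)(g)\<close>, form a Lagrangian subalgebra of \<open>d(g)\<close>. Other components vanish.
  Finally \<open>\<omega>\<close> is invertible because its linear term at \<open>\<xi> \<in> l\<^sup>*\<close> is \<open>\<xi>([y, z])\<close>.
\<close>

section \<open>Convolution of functions on words\<close>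

text \<open>A function on \<open>L*\<close> is stored by its values on words, so no group element
  \<open>x\<close> is at hand. Identities between products of such functions become identities
  between convolutions, proved by induction on the word: dropping the first letter is, up to sign, a
  left derivative, hence an induction step is a differential equation and the empty word is its
  initial value at the identity of the group. This also replaces the description of
  \<open>Ad(x)(g)\<close>: its elements y + \<omega>(y, -) satisfy a linear differential equation
  whose flow preserves the invariant three-form. The remaining components of the dynamical equation
  vanish for a simple reason: \<sigma> lies in u \<otimes> u, so every term of \<open>CYB\<close>
  and of \<open>dL\<close> keeps two legs in \<open>u\<close>, while \<delta>(u) has no component in
  l \<otimes> l. At most one leg can therefore lie in \<open>l\<close>. As \<sigma> is known only as
  an inverse, its derivatives come from differentiating the relation between \<sigma> and \<omega>.
  The choice of \<iota> changes the denominator only by a nonzero scalar.\<close>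

fun conv :: "('a \<Rightarrow> 'b \<Rightarrow> 'c::ab_group_add) \<Rightarrow> ('x list \<Rightarrow> 'a) \<Rightarrow> ('x list \<Rightarrow> 'b) \<Rightarrow> 'x list \<Rightarrow> 'c" where
  "conv b f g [] = b (f []) (g [])"
| "conv b f g (x # w) = conv b (\<lambda>v. f (x # v)) g w + conv b f (\<lambda>v. g (x # v)) w"

text \<open>Both ways of nesting two convolutions reduce to this symmetric form, in which
  associativity and permutations of the three factors are easy to state.\<close>

fun conv3 :: "('a \<Rightarrow> 'b \<Rightarrow> 'c \<Rightarrow> 'd::ab_group_add) \<Rightarrow>
    ('x list \<Rightarrow> 'a) \<Rightarrow> ('x list \<Rightarrow> 'b) \<Rightarrow> ('x list \<Rightarrow> 'c) \<Rightarrow> 'x list \<Rightarrow> 'd" where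
  "conv3 t f g h [] = t (f []) (g []) (h [])"
| "conv3 t f g h (x # w) = conv3 t (\<lambda>v. f (x # v)) g h w + conv3 t f (\<lambda>v. g (x # v)) h w
     + conv3 t f g (\<lambda>v. h (x # v)) w"

text \<open>Additivity is what the type class structure of pairs and functions can express. Complex
  scalars live in \<open>scale\<close> and are treated separately where they matter.\<close>

definition biadditive :: "('a::ab_group_add \<Rightarrow> 'b::ab_group_add \<Rightarrow> 'c::ab_group_add) \<Rightarrow> bool" where
  "biadditive b \<longleftrightarrow> (\<forall>x. additive (b x)) \<and> (\<forall>y. additive (\<lambda>x. b x y))"

lemma biadditiveI:
  assumes "\<And>x x' y. b (x + x') y = b x y + b x' y" "\<And>x y y'. b x (y + y') = b x y + b x y'"
  shows "biadditive b"
  using assms by (simp add: biadditive_def additive_def)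

lemma biadditiveD:
  assumes "biadditive b"
  shows "b (x + x') y = b x y + b x' y" "b x (y + y') = b x y + b x y'" "b 0 y = 0" "b x 0 = 0"
    "b (- x) y = - b x y" "b x (- y) = - b x y"
    "b (x - x') y = b x y - b x' y" "b x (y - y') = b x y - b x y'"
proof -
  have l: "additive (\<lambda>x. b x y)" and r: "additive (b x)" for x y
    using assms by (simp_all add: biadditive_def)
  show "b (x + x') y = b x y + b x' y" "b 0 y = 0" "b (- x) y = - b x y"
    "b (x - x') y = b x y - b x' y"
    by (fact additive.add[OF l] additive.zero[OF l] additive.minus[OF l] additive.diff[OF l])+
  show "b x (y + y') = b x y + b x y'" "b x 0 = 0" "b x (- y) = - b x y"
    "b x (y - y') = b x y - b x y'"
    by (fact additive.add[OF r] additive.zero[OF r] additive.minus[OF r] additive.diff[OF r])+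
qed

lemma conv_add_left:
  assumes "\<And>x y z. b (x + y) z = b x z + b y z"
  shows "conv b (\<lambda>v. f v + f' v) g w = conv b f g w + conv b f' g w"
  by (induction w arbitrary: f f' g) (simp_all add: assms)

lemma conv_add_right:
  assumes "\<And>x y z. b x (y + z) = b x y + b x z"
  shows "conv b f (\<lambda>v. g v + g' v) w = conv b f g w + conv b f g' w"
  by (induction w arbitrary: f g g') (simp_all add: assms)

lemma conv_eq_0:
  assumes "\<And>u v. b (f u) (g v) = 0"
  shows "conv b f g w = 0"
  using assms by (induction w arbitrary: f g) simp_all

lemma conv_cong:
  assumes "\<And>u v. set u \<subseteq> set w \<Longrightarrow> set v \<subseteq> set w \<Longrightarrow> b (f u) (g v) = b' (f' u) (g' v)"
  shows "conv b f g w = conv b' f' g' w"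
  using assms
proof (induction w arbitrary: f g f' g')
  case (Cons x w)
  have "b (f (x # u)) (g v) = b' (f' (x # u)) (g' v)" "b (f u) (g (x # v)) = b' (f' u) (g' (x # v))"
    if "set u \<subseteq> set w" "set v \<subseteq> set w" for u v
    using that by (auto intro!: Cons.prems)
  then show ?case
    using Cons.IH[of "\<lambda>v. f (x # v)" g "\<lambda>v. f' (x # v)" g']
      Cons.IH[of f "\<lambda>v. g (x # v)" f' "\<lambda>v. g' (x # v)"] by simp
qed simp

lemma conv_sum:
  "conv (\<lambda>x y. \<Sum>i\<in>I. b i x y) f g w = (\<Sum>i\<in>I. conv (b i) f g w)"
  by (induction w arbitrary: f g) (simp_all add: sum.distrib)

lemma conv_plus:
  "conv (\<lambda>x y. b x y + b' x y) f g w = conv b f g w + conv b' f g w"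
  by (induction w arbitrary: f g) (simp_all)

lemma conv_swap: "conv b f g w = conv (\<lambda>y x. b x y) g f w"
  by (induction w arbitrary: f g) (simp_all add: add.commute)

lemma conv_compose: "conv b (\<lambda>w. h (f w)) (\<lambda>w. k (g w)) w = conv (\<lambda>x y. b (h x) (k y)) f g w"
  by (induction w arbitrary: f g) simp_all

text \<open>A function supported on the empty word is a constant function on the formal
  group.\<close>

lemma conv_unit_left:
  assumes "\<And>y. b 0 y = 0"
  shows "conv b (\<lambda>v. if v = [] then c else 0) g w = b c (g w)"
proof (induction w arbitrary: g)
  case (Cons x w)
  have "conv b (\<lambda>v. 0) g w = 0" by (rule conv_eq_0) (rule assms)
  then show ?case using Cons by simp
qed simp

text \<open>The recursion of \<open>conv\<close> removes first letters, which suits left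
  derivatives. Splittings of a word can equally be read from its end, so last letters obey the same
  Leibniz rule; this is the version for \<open>R_der\<close>.\<close>

lemma conv_snoc:
  "conv b f g (w @ [x]) = conv b (\<lambda>v. f (v @ [x])) g w + conv b f (\<lambda>v. g (v @ [x])) w"
  by (induction w arbitrary: f g) (simp_all add: add_ac)

lemma conv_conv_left:
  assumes "\<And>x y z. b (x + y) z = b x z + b y z"
  shows "conv b (conv c f g) h w = conv3 (\<lambda>x y z. b (c x y) z) f g h w"
proof (induction w arbitrary: f g h)
  case (Cons a w)
  then show ?case by (simp add: conv_add_left[of b, OF assms])
qed simp

lemma conv_conv_right:
  assumes "\<And>x y z. b x (y + z) = b x y + b x z"
  shows "conv b f (conv c g h) w = conv3 (\<lambda>x y z. b x (c y z)) f g h w"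
proof (induction w arbitrary: f g h)
  case (Cons a w)
  then show ?case by (simp add: conv_add_right[of b, OF assms])
qed simp

lemma conv3_swap: "conv3 t f g h w = conv3 (\<lambda>y x z. t x y z) g f h w"
  by (induction w arbitrary: f g h) (simp_all add: add_ac)

lemma conv3_rotate: "conv3 t f g h w = conv3 (\<lambda>y z x. t x y z) g h f w"
  by (induction w arbitrary: f g h) (simp_all add: add_ac)

lemma conv3_eq_0:
  assumes "\<And>u v w. t (f u) (g v) (h w) = 0"
  shows "conv3 t f g h w = 0"
  using assms by (induction w arbitrary: f g h) simp_all

lemma conv3_plus:
  "conv3 (\<lambda>x y z. t x y z + t' x y z) f g h w = conv3 t f g h w + conv3 t' f g h w"
  by (induction w arbitrary: f g h) simp_all

lemma conv3_minus: "conv3 (\<lambda>x y z. - t x y z) f g h w = - conv3 t f g h w"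
  by (induction w arbitrary: f g h) simp_all

lemma conv3_sum:
  "conv3 (\<lambda>x y z. \<Sum>i\<in>I. t i x y z) f g h w = (\<Sum>i\<in>I. conv3 (t i) f g h w)"
  by (induction w arbitrary: f g h) (simp_all add: sum.distrib)

lemma conv3_compose_left:
  "conv3 t (\<lambda>w. k (f w)) g h w = conv3 (\<lambda>x y z. t (k x) y z) f g h w"
  by (induction w arbitrary: f g h) simp_all

lemma conv3_left_add:
  assumes "\<And>x x' y z. t (x + x') y z = t x y z + t x' y z"
  shows "conv3 t (\<lambda>v. f v + f' v) g h w = conv3 t f g h w + conv3 t f' g h w"
  by (induction w arbitrary: f f' g h) (simp_all add: assms)

lemma conv3_cong:
  assumes "\<And>u v w. t (f u) (g v) (h w) = t' (f u) (g v) (h w)"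
  shows "conv3 t f g h w = conv3 t' f g h w"
  using assms by (induction w arbitrary: f g h) simp_all

lemma conv3_unit1:
  assumes "\<And>y z. t 0 y z = 0"
  shows "conv3 t (\<lambda>v. if v = [] then x else 0) g h w = conv (t x) g h w"
proof (induction w arbitrary: g h)
  case (Cons a w)
  have "conv3 t (\<lambda>v. 0) g h w = 0" by (rule conv3_eq_0) (rule assms)
  then show ?case using Cons by simp
qed simp

lemma conv3_unit2:
  assumes "\<And>y z. t 0 y z = 0" "\<And>x z. t x 0 z = 0"
  shows "conv3 t (\<lambda>v. if v = [] then x else 0) (\<lambda>v. if v = [] then y else 0) h w = t x y (h w)"
  by (simp add: conv3_unit1 conv_unit_left assms)

lemma conv3_compose:
  "conv3 t (\<lambda>w. h (f w)) (\<lambda>w. k (g w)) (\<lambda>w. m (p w)) w = conv3 (\<lambda>x y z. t (h x) (k y) (m z)) f g p w"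
  by (induction w arbitrary: f g p) simp_all

section \<open>Products, truncation and constants of scalar functions on words\<close>

lemma wcoeff_times_conv: "wcoeff (f * g) w = conv (*) (wcoeff f) (wcoeff g) w"
proof (induction w arbitrary: f g)
  case (Cons x w)
  then show ?case by (simp add: wcoeff_times)
qed (simp add: wcoeff_times)

text \<open>A letter outside \<open>X\<close> has to land in one of the two subwords of a splitting
  and annihilates that factor, so truncation to words over \<open>X\<close> is
  multiplicative.\<close>

lemma word_function_mult:
  "word_function X F * word_function X G = word_function X (conv (*) F G)"
proof (rule wfun_eqI)
  fix w
  show "wcoeff (word_function X F * word_function X G) w = wcoeff (word_function X (conv (*) F G)) w"
  proof (cases "set w \<subseteq> X")
    case True
    then have "set u \<subseteq> X" if "set u \<subseteq> set w" for u using that by blast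
    with True show ?thesis unfolding wcoeff_times_conv
      by (simp add: word_function_def) (rule conv_cong, simp)
  next
    case False
    have "conv (*) (\<lambda>w. if set w \<subseteq> X then F w else 0) (\<lambda>w. if set w \<subseteq> X then G w else 0) w = 0"
      for F G :: "'a list \<Rightarrow> complex" using False
    proof (induction w arbitrary: F G)
      case (Cons x w)
      show ?case
      proof (cases "x \<in> X")
        case True
        then have "\<not> set w \<subseteq> X" using Cons.prems by simp
        from Cons.IH[OF this, of "\<lambda>v. F (x # v)" G] Cons.IH[OF this, of F "\<lambda>v. G (x # v)"]
        show ?thesis using True by simp
      next
        case False
        then show ?thesis by (simp add: conv_eq_0)
      qed
    qed simp
    then show ?thesis using False unfolding wcoeff_times_conv by (simp add: word_function_def)
  qed
qed

lemma word_function_add: "word_function X F + word_function X G = word_function X (\<lambda>w. F w + G w)"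
  by (rule wfun_eqI) (simp add: word_function_def)

lemma word_function_uminus: "- word_function X F = word_function X (\<lambda>w. - F w)"
  by (rule wfun_eqI) (simp add: word_function_def)

lemma word_function_zero: "word_function X (\<lambda>w. 0) = 0"
  by (rule wfun_eqI) (simp add: word_function_def)

lemma word_function_sum:
  "(\<Sum>i\<in>I. word_function X (F i)) = word_function X (\<lambda>w. \<Sum>i\<in>I. F i w)"
  by (induction I rule: infinite_finite_induct)
    (simp_all add: word_function_zero word_function_add)

lemma word_function_cong:
  "(\<And>w. set w \<subseteq> X \<Longrightarrow> F w = G w) \<Longrightarrow> word_function X F = word_function X G"
  by (rule wfun_eqI) (simp add: word_function_def)

lemma wcoeff_word_function: "set w \<subseteq> X \<Longrightarrow> wcoeff (word_function X F) w = F w"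
  by (simp add: word_function_def)

lemma wcoeff_wconst_mult: "wcoeff (wconst c * f) w = c * wcoeff f w"
  unfolding wcoeff_times_conv wconst_def wfun.sel by (subst conv_unit_left) simp_all

lemma wconst_simps:
  "wconst 0 = 0" "wconst 1 = 1" "wconst (a + b) = wconst a + wconst b"
  "wconst (a * b) = wconst a * wconst b" "wconst (- a) = - wconst a" "wconst (a - b) = wconst a - wconst b"
proof -
  show "wconst 1 = 1" by (simp add: one_wfun_def)
  show "wconst (a * b) = wconst a * wconst b"
    by (rule wfun_eqI, subst wcoeff_wconst_mult) (simp add: wconst_def)
qed (rule wfun_eqI, simp add: wconst_def)+

lemma wconst_eq_0_iff: "wconst c = 0 \<longleftrightarrow> c = 0"
proof
  assume "wconst c = 0"
  from arg_cong[OF this, of "\<lambda>f. wcoeff f []"] show "c = 0" by (simp add: wconst_def)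
qed (simp add: wconst_simps)

lemma fract_const_simps:
  "fract_const 0 = 0" "fract_const 1 = 1" "fract_const (a + b) = fract_const a + fract_const b"
  "fract_const (a * b) = fract_const a * fract_const b" "fract_const (- a) = - fract_const a"
  "fract_const (a - b) = fract_const a - fract_const b"
  by (simp_all add: fract_const_def wconst_simps fract_collapse)

lemma fract_const_sum: "fract_const (\<Sum>i\<in>I. f i) = (\<Sum>i\<in>I. fract_const (f i))"
  by (induction I rule: infinite_finite_induct) (simp_all add: fract_const_simps)

section \<open>Derivations\<close>

text \<open>Only the ring structure enters. That a particular derivation kills the complex constants
  is proved for it separately.\<close>

definition derivation :: "('r \<Rightarrow> 'r::comm_ring_1) \<Rightarrow> bool" where
  "derivation D \<longleftrightarrow> (\<forall>a b. D (a + b) = D a + D b) \<and> (\<forall>a b. D (a * b) = D a * b + a * D b)"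

lemma derivation_add: "derivation D \<Longrightarrow> D (a + b) = D a + D b"
  and derivation_mult: "derivation D \<Longrightarrow> D (a * b) = D a * b + a * D b"
  by (simp_all add: derivation_def)

lemma derivation_additive: "derivation D \<Longrightarrow> additive D"
  by (simp add: derivation_def additive_def)

lemma derivation_0: "derivation D \<Longrightarrow> D 0 = 0"
  by (simp add: derivation_additive additive.zero)

lemma derivation_1: "derivation D \<Longrightarrow> D 1 = 0"
  using derivation_mult[of D 1 1] by simp

lemma derivation_sum: "derivation D \<Longrightarrow> D (\<Sum>i\<in>I. f i) = (\<Sum>i\<in>I. D (f i))"
  using additive.sum[OF derivation_additive] .

lemma derivation_scaled_sum:
  assumes "\<And>i. i \<in> I \<Longrightarrow> derivation (D i)"
  shows "derivation (\<lambda>a. \<Sum>i\<in>I. c i * D i a)"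
  unfolding derivation_def
proof (intro conjI allI)
  fix a b
  show "(\<Sum>i\<in>I. c i * D i (a + b)) = (\<Sum>i\<in>I. c i * D i a) + (\<Sum>i\<in>I. c i * D i b)"
    using assms by (simp add: derivation_add ring_distribs sum.distrib)
  show "(\<Sum>i\<in>I. c i * D i (a * b)) = (\<Sum>i\<in>I. c i * D i a) * b + a * (\<Sum>i\<in>I. c i * D i b)"
    using assms
    by (simp add: derivation_mult sum.distrib sum_distrib_left sum_distrib_right algebra_simps)
qed

lemma derivation_neg: "derivation D \<Longrightarrow> derivation (\<lambda>a. - D a)"
  by (simp add: derivation_def)

lemma L_der_eq: "L_der \<xi> f = - wtail \<xi> f"
  by (rule wfun_eqI) (simp add: L_der_def)

lemma derivation_L_der: "derivation (L_der \<xi>)"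
  by (simp add: derivation_def L_der_eq wtail_simps)

lemma derivation_R_der: "derivation (R_der \<xi>)"
  unfolding derivation_def
proof (intro conjI allI; rule wfun_eqI)
  fix f g :: "'a wfun" and w
  show "wcoeff (R_der \<xi> (f * g)) w = wcoeff (R_der \<xi> f * g + f * R_der \<xi> g) w"
    by (simp add: wcoeff_times_conv R_der_def conv_snoc)
qed (simp add: R_der_def)

lemma R_der_word_function: "\<xi> \<in> X \<Longrightarrow> R_der \<xi> (word_function X F) = word_function X (\<lambda>w. F (w @ [\<xi>]))"
  by (rule wfun_eqI) (simp add: R_der_def word_function_def)

context
  fixes D :: "'a wfun \<Rightarrow> 'a wfun"
  assumes D: "derivation D"
begin

lemma fract_der_Fract:
  assumes "b \<noteq> 0"
  shows "fract_der D (Fract a b) = Fract (b * D a - a * D b) (b * b)"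
  unfolding fract_der_def
proof (rule the_equality)
  show "\<forall>a' b'. b' \<noteq> 0 \<and> Fract a b = Fract a' b' \<longrightarrow>
    Fract (b * D a - a * D b) (b * b) = Fract (b' * D a' - a' * D b') (b' * b')"
  proof (intro allI impI, elim conjE)
    fix a' b' assume b': "b' \<noteq> 0" "Fract a b = Fract a' b'"
    then have e: "a * b' = a' * b" using assms by (simp add: eq_fract)
    have e': "D a * b' + a * D b' = D a' * b + a' * D b"
      using arg_cong[OF e, of D] by (simp add: derivation_mult[OF D])
    \<comment> \<open>The cross-multiplied difference of the two quotient rules is a combination of
      the relation \<open>e\<close> and its derivative \<open>e'\<close>, so it vanishes.\<close>
    have "(b * D a - a * D b) * (b' * b') - (b' * D a' - a' * D b') * (b * b)
      = b * b' * (D a * b' + a * D b' - D a' * b - a' * D b)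
        - (a * b' - a' * b) * (b' * D b + b * D b')"
      by (simp add: algebra_simps)
    then show "Fract (b * D a - a * D b) (b * b) = Fract (b' * D a' - a' * D b') (b' * b')"
      using e e' assms b' by (simp add: eq_fract)
  qed
next
  fix r assume "\<forall>a' b'. b' \<noteq> 0 \<and> Fract a b = Fract a' b' \<longrightarrow>
    r = Fract (b' * D a' - a' * D b') (b' * b')"
  then show "r = Fract (b * D a - a * D b) (b * b)" using assms by blast
qed

lemma derivation_fract_der: "derivation (fract_der D)"
  unfolding derivation_def
proof (intro conjI allI)
  fix p q :: "'a wfun fract"
  obtain a b where p: "p = Fract a b" "b \<noteq> 0" by (cases p) auto
  obtain c d where q: "q = Fract c d" "d \<noteq> 0" by (cases q) auto
  show "fract_der D (p + q) = fract_der D p + fract_der D q"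
    using p(2) q(2) unfolding p(1) q(1)
    by (simp add: fract_der_Fract eq_fract derivation_mult[OF D] derivation_add[OF D])
      (simp add: algebra_simps)
  show "fract_der D (p * q) = fract_der D p * q + p * fract_der D q"
    using p(2) q(2) unfolding p(1) q(1)
    by (simp add: fract_der_Fract eq_fract derivation_mult[OF D] derivation_add[OF D])
      (simp add: algebra_simps)
qed

lemma fract_der_of_wfun: "fract_der D (Fract a 1) = Fract (D a) 1"
  by (simp add: fract_der_Fract derivation_1[OF D])

end

section \<open>The ring of functions on a formal group\<close>

locale letters =
  fixes sc :: "complex \<Rightarrow> 'a \<Rightarrow> 'a::ab_group_add" and X :: "'a set" and br :: "'a \<Rightarrow> 'a \<Rightarrow> 'a"
  assumes X_add: "\<And>x y. x \<in> X \<Longrightarrow> y \<in> X \<Longrightarrow> x + y \<in> X"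
    and X_sc: "\<And>c x. x \<in> X \<Longrightarrow> sc c x \<in> X"
    and X_br: "\<And>x y. x \<in> X \<Longrightarrow> y \<in> X \<Longrightarrow> br x y \<in> X"
begin

abbreviation "FF \<equiv> formal_functions sc X br"

text \<open>The relations of the enveloping algebra imposed only at the start of a word, as
  equations between tails. Since taking tails is a derivation, this form passes easily to sums and
  products.\<close>

definition letter_relations :: "'a wfun \<Rightarrow> bool" where
  "letter_relations f \<longleftrightarrow>
     (\<forall>x\<in>X. \<forall>y\<in>X. wtail (x + y) f = wtail x f + wtail y f) \<and>
     (\<forall>c. \<forall>x\<in>X. wtail (sc c x) f = wconst c * wtail x f) \<and>
     (\<forall>x\<in>X. \<forall>y\<in>X. wtail y (wtail x f) - wtail x (wtail y f) = wtail (br x y) f) \<and>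
     (\<forall>x. x \<notin> X \<longrightarrow> wtail x f = 0)"

lemma FF_D:
  assumes "f \<in> FF" "set p \<subseteq> X" "set q \<subseteq> X" "x \<in> X" "y \<in> X"
  shows "wcoeff f (p @ [x + y] @ q) = wcoeff f (p @ [x] @ q) + wcoeff f (p @ [y] @ q)"
    "wcoeff f (p @ [x, y] @ q) - wcoeff f (p @ [y, x] @ q) = wcoeff f (p @ [br x y] @ q)"
    "wcoeff f (p @ [sc c x] @ q) = c * wcoeff f (p @ [x] @ q)"
  using assms unfolding formal_functions_def mem_Collect_eq by blast+

lemma FF_outside: "f \<in> FF \<Longrightarrow> \<not> set w \<subseteq> X \<Longrightarrow> wcoeff f w = 0"
  unfolding formal_functions_def by blast

lemma FF_I:
  assumes "\<And>w. \<not> set w \<subseteq> X \<Longrightarrow> wcoeff f w = 0"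
    and "\<And>p q x y. set p \<subseteq> X \<Longrightarrow> set q \<subseteq> X \<Longrightarrow> x \<in> X \<Longrightarrow> y \<in> X \<Longrightarrow>
      wcoeff f (p @ [x + y] @ q) = wcoeff f (p @ [x] @ q) + wcoeff f (p @ [y] @ q)"
    and "\<And>p q x c. set p \<subseteq> X \<Longrightarrow> set q \<subseteq> X \<Longrightarrow> x \<in> X \<Longrightarrow>
      wcoeff f (p @ [sc c x] @ q) = c * wcoeff f (p @ [x] @ q)"
    and "\<And>p q x y. set p \<subseteq> X \<Longrightarrow> set q \<subseteq> X \<Longrightarrow> x \<in> X \<Longrightarrow> y \<in> X \<Longrightarrow>
      wcoeff f (p @ [x, y] @ q) - wcoeff f (p @ [y, x] @ q) = wcoeff f (p @ [br x y] @ q)"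
  shows "f \<in> FF"
  unfolding formal_functions_def mem_Collect_eq
  by (intro conjI allI impI ballI; (elim conjE)?) (erule assms; assumption)+

lemma FF_wtail:
  assumes f: "f \<in> FF"
  shows "wtail x f \<in> FF"
proof (cases "x \<in> X")
  case True
  show ?thesis
  proof (rule FF_I)
    fix w assume "\<not> set w \<subseteq> X"
    then show "wcoeff (wtail x f) w = 0" by (simp add: FF_outside[OF f])
  next
    fix p q y z assume "set p \<subseteq> X" "set q \<subseteq> X" "y \<in> X" "z \<in> X"
    then have "set (x # p) \<subseteq> X" "set q \<subseteq> X" "y \<in> X" "z \<in> X" using True by simp_all
    note D = FF_D[OF f this]
    show "wcoeff (wtail x f) (p @ [y + z] @ q)
        = wcoeff (wtail x f) (p @ [y] @ q) + wcoeff (wtail x f) (p @ [z] @ q)"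
      "wcoeff (wtail x f) (p @ [y, z] @ q) - wcoeff (wtail x f) (p @ [z, y] @ q)
        = wcoeff (wtail x f) (p @ [br y z] @ q)"
      using D(1,2) by simp_all
  next
    fix p q y c assume "set p \<subseteq> X" "set q \<subseteq> X" "y \<in> X"
    then have "set (x # p) \<subseteq> X" "set q \<subseteq> X" "y \<in> X" "y \<in> X" using True by simp_all
    from FF_D(3)[OF f this] show "wcoeff (wtail x f) (p @ [sc c y] @ q)
        = c * wcoeff (wtail x f) (p @ [y] @ q)"
      by simp
  qed
next
  case False
  have "wtail x f = 0" by (rule wfun_eqI) (use False in \<open>simp add: FF_outside[OF f]\<close>)
  then show ?thesis by (auto intro!: FF_I)
qed

lemma letter_relationsD:
  assumes "letter_relations f" "x \<in> X"
  shows "y \<in> X \<Longrightarrow> wtail (x + y) f = wtail x f + wtail y f"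
    "wtail (sc c x) f = wconst c * wtail x f"
    "y \<in> X \<Longrightarrow> wtail (br x y) f = wtail y (wtail x f) - wtail x (wtail y f)"
  using assms unfolding letter_relations_def by (blast, blast, metis)

lemma letter_relations_outside: "letter_relations f \<Longrightarrow> x \<notin> X \<Longrightarrow> wtail x f = 0"
  unfolding letter_relations_def by blast

lemma letter_relationsI:
  assumes "\<And>x y. x \<in> X \<Longrightarrow> y \<in> X \<Longrightarrow> wtail (x + y) f = wtail x f + wtail y f"
    and "\<And>x c. x \<in> X \<Longrightarrow> wtail (sc c x) f = wconst c * wtail x f"
    and "\<And>x y. x \<in> X \<Longrightarrow> y \<in> X \<Longrightarrow> wtail (br x y) f = wtail y (wtail x f) - wtail x (wtail y f)"
    and "\<And>x. x \<notin> X \<Longrightarrow> wtail x f = 0"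
  shows "letter_relations f"
  unfolding letter_relations_def using assms by metis

lemma FF_letter_relations:
  assumes f: "f \<in> FF"
  shows "letter_relations f"
proof (rule letter_relationsI; rule wfun_eqI)
  note out = FF_outside[OF f]
  fix x w c assume x: "x \<in> X"
  show "wcoeff (wtail (sc c x) f) w = wcoeff (wconst c * wtail x f) w"
    using FF_D(3)[OF f, of "[]" w x x c] x
    by (cases "set w \<subseteq> X") (simp_all add: wcoeff_wconst_mult out)
  fix y assume y: "y \<in> X"
  show "wcoeff (wtail (x + y) f) w = wcoeff (wtail x f + wtail y f) w"
    using FF_D(1)[OF f, of "[]" w x y] x y by (cases "set w \<subseteq> X") (simp_all add: out)
  show "wcoeff (wtail (br x y) f) w = wcoeff (wtail y (wtail x f) - wtail x (wtail y f)) w"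
    using FF_D(2)[OF f, of "[]" w x y] x y by (cases "set w \<subseteq> X") (simp_all add: out)
next
  fix x w assume "x \<notin> X"
  then show "wcoeff (wtail x f) w = wcoeff 0 w" by (simp add: FF_outside[OF f])
qed

text \<open>A relation behind a prefix \<open>p\<close> is a relation at the start of the word for
  the iterated tail along \<open>p\<close>. So \<open>FF\<close> is the largest class closed under
  tails whose members satisfy \<open>letter_relations\<close>.\<close>

lemma formal_functions_coinduct:
  assumes P: "P f" and tail: "\<And>f x. P f \<Longrightarrow> x \<in> X \<Longrightarrow> P (wtail x f)"
    and rel: "\<And>f. P f \<Longrightarrow> letter_relations f"
  shows "f \<in> FF"
proof -
  have out: "wcoeff f w = 0" if "P f" "\<not> set w \<subseteq> X" for f w
    using that
  proof (induction w arbitrary: f)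
    case (Cons x w)
    show ?case
    proof (cases "x \<in> X")
      case True
      then show ?thesis using Cons.IH[of "wtail x f"] Cons.prems tail by auto
    next
      case False
      then have "wtail x f = 0" by (rule letter_relations_outside[OF rel[OF Cons.prems(1)]])
      then have "wcoeff (wtail x f) w = 0" by simp
      then show ?thesis by simp
    qed
  qed simp
  have rels: "wcoeff f (p @ [x + y] @ q) = wcoeff f (p @ [x] @ q) + wcoeff f (p @ [y] @ q) \<and>
     wcoeff f (p @ [x, y] @ q) - wcoeff f (p @ [y, x] @ q) = wcoeff f (p @ [br x y] @ q) \<and>
     wcoeff f (p @ [sc c x] @ q) = c * wcoeff f (p @ [x] @ q)"
    if "P f" "set p \<subseteq> X" "x \<in> X" "y \<in> X" for f p q x y c
    using that
  proof (induction p arbitrary: f)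
    case Nil
    note D = letter_relationsD[OF rel[OF Nil(1)] Nil(3)]
    have "wcoeff (wtail (x + y) f) q = wcoeff (wtail x f + wtail y f) q"
      "wcoeff (wtail y (wtail x f) - wtail x (wtail y f)) q = wcoeff (wtail (br x y) f) q"
      "wcoeff (wtail (sc c x) f) q = wcoeff (wconst c * wtail x f) q"
      by (simp_all only: D Nil(4))
    then show ?case by (simp add: wcoeff_wconst_mult)
  next
    case (Cons z p)
    have "P (wtail z f)" using Cons.prems tail by simp
    from Cons.IH[OF this] Cons.prems show ?case by simp
  qed
  show ?thesis
    by (rule FF_I) (use out[OF P] rels[OF P] in blast)+
qed

lemma wtail_0: "wtail x 0 = 0"
  and wtail_wconst: "wtail x (wconst c) = 0"
  by (rule wfun_eqI, simp add: wconst_def)+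

lemma letter_relations_add:
  assumes f: "letter_relations f" and g: "letter_relations g"
  shows "letter_relations (f + g)"
proof (rule letter_relationsI)
  fix x c assume x: "x \<in> X"
  show "wtail (sc c x) (f + g) = wconst c * wtail x (f + g)"
    by (simp add: letter_relationsD(2)[OF f x] letter_relationsD(2)[OF g x] wtail_simps distrib_left)
  fix y assume y: "y \<in> X"
  show "wtail (x + y) (f + g) = wtail x (f + g) + wtail y (f + g)"
    by (simp add: letter_relationsD(1)[OF f x y] letter_relationsD(1)[OF g x y] wtail_simps)
  show "wtail (br x y) (f + g) = wtail y (wtail x (f + g)) - wtail x (wtail y (f + g))"
    by (simp add: letter_relationsD(3)[OF f x y] letter_relationsD(3)[OF g x y] wtail_simps)
qed (simp add: wtail_simps letter_relations_outside[OF f] letter_relations_outside[OF g])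

text \<open>The bracket relation survives because a commutator of derivations is again a derivation:
  the mixed terms cancel.\<close>

lemma letter_relations_mult:
  assumes f: "letter_relations f" and g: "letter_relations g"
  shows "letter_relations (f * g)"
proof (rule letter_relationsI)
  fix x c assume x: "x \<in> X"
  show "wtail (sc c x) (f * g) = wconst c * wtail x (f * g)"
    by (simp add: letter_relationsD(2)[OF f x] letter_relationsD(2)[OF g x] wtail_simps
        distrib_left mult_ac)
  fix y assume y: "y \<in> X"
  show "wtail (x + y) (f * g) = wtail x (f * g) + wtail y (f * g)"
    by (simp add: letter_relationsD(1)[OF f x y] letter_relationsD(1)[OF g x y] wtail_simps
        distrib_left distrib_right)
  show "wtail (br x y) (f * g) = wtail y (wtail x (f * g)) - wtail x (wtail y (f * g))"
    by (simp add: letter_relationsD(3)[OF f x y] letter_relationsD(3)[OF g x y] wtail_simps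
        left_diff_distrib right_diff_distrib)
qed (simp add: wtail_simps letter_relations_outside[OF f] letter_relations_outside[OF g])

lemma FF_add: "f \<in> FF \<Longrightarrow> g \<in> FF \<Longrightarrow> f + g \<in> FF"
proof (rule formal_functions_coinduct[where P = "\<lambda>h. \<exists>f g. f \<in> FF \<and> g \<in> FF \<and> h = f + g"])
  show "\<exists>f' g'. f' \<in> FF \<and> g' \<in> FF \<and> wtail x f = f' + g'"
    if "\<exists>f' g'. f' \<in> FF \<and> g' \<in> FF \<and> f = f' + g'" for f x
    using that FF_wtail by (metis wtail_simps(1))
qed (auto intro: letter_relations_add FF_letter_relations)

lemma FF_wconst: "wconst c \<in> FF"
proof (rule formal_functions_coinduct[where P = "\<lambda>h. \<exists>c. h = wconst c"])
  show "\<exists>c. wtail x f = wconst c" if "\<exists>c. f = wconst c" for f x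
    using that wtail_wconst wconst_simps(1) by metis
qed (auto simp: wtail_wconst wtail_0 intro!: letter_relationsI)

lemma FF_0: "0 \<in> FF" and FF_1: "1 \<in> FF"
  using FF_wconst wconst_simps(1,2) by metis+

lemma FF_mult: "f \<in> FF \<Longrightarrow> g \<in> FF \<Longrightarrow> f * g \<in> FF"
proof -
  \<comment> \<open>A tail of a product is a sum of two products, so the class closed under tails
    has to consist of finite sums of products.\<close>
  let ?P = "\<lambda>h. \<exists>(n::nat) a b. (\<forall>i<n. a i \<in> FF \<and> b i \<in> FF) \<and> h = (\<Sum>i<n. a i * b i)"
  have lr0: "letter_relations 0" using FF_0 by (rule FF_letter_relations)
  assume fg: "f \<in> FF" "g \<in> FF"
  show ?thesis
  proof (rule formal_functions_coinduct[where P = ?P])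
    show "?P (f * g)"
      using fg by (intro exI[of _ 1] exI[of _ "\<lambda>_. f"] exI[of _ "\<lambda>_. g"]) simp
  next
    fix h x assume "?P h" "x \<in> X"
    then obtain n :: nat and a b where ab: "\<And>i. i < n \<Longrightarrow> a i \<in> FF" "\<And>i. i < n \<Longrightarrow> b i \<in> FF"
      "h = (\<Sum>i<n. a i * b i)" by blast
    have tsum: "wtail x (\<Sum>i<n. F i) = (\<Sum>i<n. wtail x (F i))" for F and n :: nat
      by (induction n) (simp_all add: wtail_0 wtail_simps)
    \<comment> \<open>The Leibniz rule as a single sum of length \<open>n + n\<close>: the first
      half differentiates the left factors, the second half the right ones.\<close>
    let ?a = "\<lambda>i. if i < n then wtail x (a i) else a (i - n)"
    let ?b = "\<lambda>i. if i < n then b i else wtail x (b (i - n))"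
    have "(\<Sum>i<n + n. ?a i * ?b i) = (\<Sum>i<n. wtail x (a i) * b i) + (\<Sum>i<n. a i * wtail x (b i))"
      by (simp add: lessThan_atLeast0 sum.nat_group sum.atLeastLessThan_concat[of 0 n "n + n", symmetric]
          sum.atLeastLessThan_shift_bounds[of _ 0 n n, simplified])
    then have "wtail x h = (\<Sum>i<n + n. ?a i * ?b i)"
      unfolding ab(3) tsum by (simp add: wtail_simps sum.distrib)
    moreover have "\<forall>i<n + n. ?a i \<in> FF \<and> ?b i \<in> FF" using ab FF_wtail by auto
    ultimately show "?P (wtail x h)" by (intro exI[of _ "n + n"] exI[of _ ?a] exI[of _ ?b]) simp
  next
    fix h assume "?P h"
    then obtain n :: nat and a b where ab: "\<And>i. i < n \<Longrightarrow> a i \<in> FF" "\<And>i. i < n \<Longrightarrow> b i \<in> FF"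
      "h = (\<Sum>i<n. a i * b i)" by blast
    show "letter_relations h" using ab(1,2) unfolding ab(3)
    proof (induction n)
      case (Suc n)
      have "letter_relations (a n * b n)"
        by (intro letter_relations_mult FF_letter_relations Suc.prems lessI)
      then show ?case using Suc by (simp add: letter_relations_add)
    qed (simp add: lr0)
  qed
qed

lemma FF_uminus: "f \<in> FF \<Longrightarrow> - f \<in> FF"
  using FF_mult[OF FF_wconst[of "- 1"]] by (simp add: wconst_simps)

lemma FF_sum: "(\<And>i. i \<in> I \<Longrightarrow> f i \<in> FF) \<Longrightarrow> (\<Sum>i\<in>I. f i) \<in> FF"
  by (induction I rule: infinite_finite_induct) (auto simp: FF_0 FF_add)

lemma FF_prod: "(\<And>i. i \<in> I \<Longrightarrow> f i \<in> FF) \<Longrightarrow> (\<Prod>i\<in>I. f i) \<in> FF"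
  by (induction I rule: infinite_finite_induct) (auto simp: FF_1 FF_mult)

lemma FF_det:
  assumes "A \<in> carrier_mat n n" "\<And>i j. i < n \<Longrightarrow> j < n \<Longrightarrow> A $$ (i, j) \<in> FF"
  shows "det A \<in> FF"
proof -
  have "signof p * (\<Prod>i = 0..<n. A $$ (i, p i)) \<in> FF" if "p permutes {0..<n}" for p
  proof -
    have "(\<Prod>i = 0..<n. A $$ (i, p i)) \<in> FF"
      using permutes_in_image[OF that] assms(2) by (intro FF_prod) auto
    then show ?thesis by (auto simp: sign_def FF_uminus)
  qed
  then show ?thesis unfolding det_def'[OF assms(1)] by (intro FF_sum) simp
qed

end

section \<open>Bases and dual bases\<close>

context lie_bialgebra
begin

lemma dualD:
  assumes "\<phi> \<in> dual V"
  shows "x \<in> V \<Longrightarrow> y \<in> V \<Longrightarrow> \<phi> (x + y) = \<phi> x + \<phi> y" "x \<in> V \<Longrightarrow> \<phi> (scale c x) = c * \<phi> x"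
    "x \<notin> V \<Longrightarrow> \<phi> x = 0"
  using assms by (simp_all add: dual_def)

lemma dual_UNIV_iff: "\<phi> \<in> dual UNIV \<longleftrightarrow> (\<forall>x y. \<phi> (x + y) = \<phi> x + \<phi> y) \<and> (\<forall>c x. \<phi> (scale c x) = c * \<phi> x)"
  by (simp add: dual_def)

lemma dual_additive: "\<phi> \<in> dual UNIV \<Longrightarrow> additive \<phi>"
  by (simp add: additive_def dual_UNIV_iff)

lemma dual_simps:
  assumes "\<phi> \<in> dual UNIV"
  shows "\<phi> (x + y) = \<phi> x + \<phi> y" "\<phi> (scale c x) = c * \<phi> x" "\<phi> 0 = 0" "\<phi> (- x) = - \<phi> x"
    "\<phi> (x - y) = \<phi> x - \<phi> y" "\<phi> (\<Sum>i\<in>I. f i) = (\<Sum>i\<in>I. \<phi> (f i))"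
  using assms additive.zero[OF dual_additive] additive.minus[OF dual_additive]
    additive.diff[OF dual_additive] additive.sum[OF dual_additive]
  by (simp_all add: dual_UNIV_iff)

lemma dual_zero: "(\<lambda>_. 0) \<in> dual V"
  and dual_add: "\<phi> \<in> dual V \<Longrightarrow> \<psi> \<in> dual V \<Longrightarrow> (\<lambda>x. \<phi> x + \<psi> x) \<in> dual V"
  and dual_scale: "\<phi> \<in> dual V \<Longrightarrow> (\<lambda>x. c * \<phi> x) \<in> dual V"
  and dual_uminus: "\<phi> \<in> dual V \<Longrightarrow> (\<lambda>x. - \<phi> x) \<in> dual V"
  and dual_diff: "\<phi> \<in> dual V \<Longrightarrow> \<psi> \<in> dual V \<Longrightarrow> (\<lambda>x. \<phi> x - \<psi> x) \<in> dual V"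
  by (simp_all add: dual_def algebra_simps)

lemma dual_sum: "(\<And>i. i \<in> I \<Longrightarrow> \<phi> i \<in> dual V) \<Longrightarrow> (\<lambda>x. \<Sum>i\<in>I. \<phi> i x) \<in> dual V"
  by (induction I rule: infinite_finite_induct) (simp_all add: dual_zero dual_add)

context
  fixes V assumes V: "subspace V"
begin

lemma basis_of: "basis_of V \<subseteq> V" "independent (basis_of V)" "span (basis_of V) = V"
proof -
  obtain B where B: "B \<subseteq> V" "independent B" "V \<subseteq> span B"
    using maximal_independent_subset[of V] by blast
  then have "span B = V" using V span_minimal[of B V] by blast
  then have "\<exists>B. B \<subseteq> V \<and> independent B \<and> span B = V" using B by blast
  from someI_ex[OF this] show "basis_of V \<subseteq> V" "independent (basis_of V)" "span (basis_of V) = V"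
    unfolding basis_of_def by blast+
qed

lemma finite_basis_of: "finite (basis_of V)"
proof -
  obtain B where "finite B" "span B = UNIV" using finite_dim by blast
  then show ?thesis using independent_span_bound[of B "basis_of V"] basis_of(2) by blast
qed

lemma dual_vector_in_dual: "dual_vector V e \<in> dual V"
  using V by (simp add: dual_def dual_vector_def basis_of representation_add representation_scale
      subspace_add subspace_scale)

lemma dual_vector_basis:
  "e \<in> basis_of V \<Longrightarrow> e' \<in> basis_of V \<Longrightarrow> dual_vector V e e' = (if e' = e then 1 else 0)"
  using basis_of by (auto simp: dual_vector_def representation_basis)

lemma basis_expansion: "x \<in> V \<Longrightarrow> x = (\<Sum>e\<in>basis_of V. scale (dual_vector V e x) e)"
  using sum_representation_eq[of "basis_of V" x "basis_of V"] basis_of finite_basis_of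
  by (simp add: dual_vector_def)

lemma dual_expansion:
  assumes "\<phi> \<in> dual V" "x \<in> V"
  shows "\<phi> x = (\<Sum>e\<in>basis_of V. \<phi> e * dual_vector V e x)"
proof -
  \<comment> \<open>Membership of the partial sums in \<open>V\<close> is carried along because
    \<phi> is additive on \<open>V\<close> only.\<close>
  have "\<phi> (\<Sum>e\<in>I. scale (c e) e) = (\<Sum>e\<in>I. c e * \<phi> e) \<and> (\<Sum>e\<in>I. scale (c e) e) \<in> V"
    if "finite I" "I \<subseteq> V" for I c
    using that
  proof (induction I)
    case empty
    have "\<phi> (scale 0 x) = 0 * \<phi> x" by (rule dualD(2)[OF assms])
    then show ?case using V by (simp add: subspace_0)
  next
    case (insert e I)
    then have "scale (c e) e \<in> V" "e \<in> V" using V by (auto simp: subspace_scale)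
    with insert show ?case
      by (simp add: dualD[OF assms(1)] subspace_add[OF V])
  qed
  from this[OF finite_basis_of basis_of(1), of "\<lambda>e. dual_vector V e x"]
  show ?thesis using basis_expansion[OF assms(2)] by (simp add: mult.commute)
qed

lemma dual_eq_sum: "\<phi> \<in> dual V \<Longrightarrow> \<phi> = (\<lambda>x. \<Sum>e\<in>basis_of V. \<phi> e * dual_vector V e x)"
  using dual_expansion dualD(3)[OF dual_vector_in_dual]
  by (intro ext) (metis (no_types, lifting) dualD(3) mult_zero_right sum.neutral)

end

lemma dual_separates:
  assumes "\<And>\<phi>. \<phi> \<in> dual UNIV \<Longrightarrow> \<phi> x = \<phi> y"
  shows "x = y"
proof -
  have "dual_vector UNIV e x = dual_vector UNIV e y" for e
    by (rule assms[OF dual_vector_in_dual[OF subspace_UNIV]])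
  then show ?thesis
    using basis_expansion[OF subspace_UNIV, of x] basis_expansion[OF subspace_UNIV, of y] by simp
qed

section \<open>The double as a Lie algebra with an invariant form\<close>

lemma cobr_antisym: "\<delta> x \<psi> \<phi> = - \<delta> x \<phi> \<psi>"
  using cobr_wedge[of x] unfolding wedge2_def by blast

lemma tensors2E:
  assumes "T \<in> tensors2 A B"
  obtains n :: nat and a b where "\<And>i. i < n \<Longrightarrow> a i \<in> A" "\<And>i. i < n \<Longrightarrow> b i \<in> B"
    "\<And>\<phi> \<psi>. \<phi> \<in> dual UNIV \<Longrightarrow> \<psi> \<in> dual UNIV \<Longrightarrow> T \<phi> \<psi> = (\<Sum>i<n. \<phi> (a i) * \<psi> (b i))"
    "\<And>\<phi> \<psi>. \<phi> \<notin> dual UNIV \<or> \<psi> \<notin> dual UNIV \<Longrightarrow> T \<phi> \<psi> = 0"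
proof -
  obtain n :: nat and a b where ab: "\<forall>i<n. a i \<in> A \<and> b i \<in> B"
    and T: "T = (\<lambda>\<phi> \<psi>. \<Sum>i<n. pure2 (a i) (b i) \<phi> \<psi>)"
    using assms unfolding tensors2_def by blast
  show ?thesis
    by (rule that[of n a b]) (use ab in \<open>auto simp: T pure2_def\<close>)
qed

lemma cobr_tensors: "\<delta> x \<in> tensors2 UNIV UNIV"
  using cobr_wedge[of x] unfolding wedge2_def by blast

lemma cobr_outside: "\<phi> \<notin> dual UNIV \<or> \<psi> \<notin> dual UNIV \<Longrightarrow> \<delta> x \<phi> \<psi> = 0"
  by (rule tensors2E[OF cobr_tensors[of x]]) blast

text \<open>Linearity is read off a representation of \<delta>(x) by pure tensors; if \<psi> is not
  in the dual, all terms are zero by the convention for tensors.\<close>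

lemma cobr_linear_left:
  assumes "\<phi> \<in> dual UNIV" "\<phi>' \<in> dual UNIV"
  shows "\<delta> x (\<lambda>z. \<phi> z + \<phi>' z) \<psi> = \<delta> x \<phi> \<psi> + \<delta> x \<phi>' \<psi>"
    "\<delta> x (\<lambda>z. c * \<phi> z) \<psi> = c * \<delta> x \<phi> \<psi>"
proof -
  obtain n :: nat and a b where d:
    "\<And>\<phi> \<psi>. \<phi> \<in> dual UNIV \<Longrightarrow> \<psi> \<in> dual UNIV \<Longrightarrow> \<delta> x \<phi> \<psi> = (\<Sum>i<n. \<phi> (a i) * \<psi> (b i))"
    by (rule tensors2E[OF cobr_tensors[of x]]) blast
  show "\<delta> x (\<lambda>z. \<phi> z + \<phi>' z) \<psi> = \<delta> x \<phi> \<psi> + \<delta> x \<phi>' \<psi>"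
    "\<delta> x (\<lambda>z. c * \<phi> z) \<psi> = c * \<delta> x \<phi> \<psi>"
    by (cases "\<psi> \<in> dual UNIV"; simp add: d assms dual_add dual_scale cobr_outside ring_distribs
        sum.distrib sum_distrib_left mult_ac)+
qed

lemma cobr_linear_right:
  assumes "\<phi> \<in> dual UNIV" "\<phi>' \<in> dual UNIV"
  shows "\<delta> x \<psi> (\<lambda>z. \<phi> z + \<phi>' z) = \<delta> x \<psi> \<phi> + \<delta> x \<psi> \<phi>'"
    "\<delta> x \<psi> (\<lambda>z. c * \<phi> z) = c * \<delta> x \<psi> \<phi>"
  by (simp_all only: cobr_antisym[of x \<psi>] cobr_linear_left[OF assms] minus_add_distrib
      mult_minus_right)

lemma cobr_dual: "(\<lambda>x. \<delta> x \<phi> \<psi>) \<in> dual UNIV"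
  by (simp add: dual_UNIV_iff cobr_add cobr_scale)

lemma cobr_zero: "\<delta> 0 \<phi> \<psi> = 0"
  using dual_simps(3)[OF cobr_dual] .

lemma cobr_sum_right:
  assumes "\<And>i. \<psi> i \<in> dual UNIV"
  shows "\<delta> x \<phi> (\<lambda>z. \<Sum>i\<in>I. c i * \<psi> i z) = (\<Sum>i\<in>I. c i * \<delta> x \<phi> (\<psi> i))"
proof (induction I rule: infinite_finite_induct)
  case (insert i I)
  have "\<delta> x \<phi> (\<lambda>z. c i * \<psi> i z + (\<Sum>i\<in>I. c i * \<psi> i z))
      = \<delta> x \<phi> (\<lambda>z. c i * \<psi> i z) + \<delta> x \<phi> (\<lambda>z. \<Sum>i\<in>I. c i * \<psi> i z)"
    by (intro cobr_linear_right dual_sum dual_scale assms)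
  with insert show ?case by (simp add: cobr_linear_right(2)[OF assms assms])
qed (use cobr_linear_right(2)[OF dual_zero dual_zero, of x \<phi> 0] in simp_all)

lemma cobr_sum_left:
  assumes "\<And>i. \<psi> i \<in> dual UNIV"
  shows "\<delta> x (\<lambda>z. \<Sum>i\<in>I. c i * \<psi> i z) \<phi> = (\<Sum>i\<in>I. c i * \<delta> x (\<psi> i) \<phi>)"
  unfolding cobr_antisym[of x _ \<phi>] cobr_sum_right[OF assms] by (simp add: sum_negf)

lemma br_antisym: "br y x = - br x y"
proof -
  have "br x y + br y x = br (x + y) (x + y)"
    by (simp only: br_add) (simp add: br_add_right br_self add.commute)
  also have "\<dots> = 0" by (rule br_self)
  finally show ?thesis by (metis minus_unique)
qed

lemma br_additive: "biadditive br"
  by (rule biadditiveI) (simp_all add: br_add br_add_right)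

lemmas br_simps = biadditiveD[OF br_additive]

lemma dual_br_right: "\<phi> \<in> dual UNIV \<Longrightarrow> (\<lambda>z. \<phi> (br x z)) \<in> dual UNIV"
  by (simp add: dual_UNIV_iff br_add_right br_scale_right)

lemma dual_br_left: "\<phi> \<in> dual UNIV \<Longrightarrow> (\<lambda>z. \<phi> (br z x)) \<in> dual UNIV"
  by (simp add: dual_UNIV_iff br_add br_scale)

text \<open>
  Projecting arbitrary functions onto the dual makes the bracket and the form of the double
  biadditive on all of \<open>'g \<times> 'g functional\<close>, so that no carrier needs to be tracked.
\<close>

definition proj :: "'g functional \<Rightarrow> 'g functional" where
  "proj \<phi> = (\<lambda>x. \<Sum>e\<in>basis_of UNIV. \<phi> e * dual_vector UNIV e x)"

lemma proj_in_dual [simp]: "proj \<phi> \<in> dual UNIV"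
  unfolding proj_def by (intro dual_sum dual_scale dual_vector_in_dual subspace_UNIV)

lemma proj_id [simp]: "\<phi> \<in> dual UNIV \<Longrightarrow> proj \<phi> = \<phi>"
  unfolding proj_def by (rule dual_eq_sum[symmetric]) (rule subspace_UNIV)

lemma proj_add: "proj (\<phi> + \<psi>) = (\<lambda>x. proj \<phi> x + proj \<psi> x)"
  and proj_scale: "proj (\<lambda>x. c * \<phi> x) = (\<lambda>x. c * proj \<phi> x)"
  by (simp_all add: proj_def ring_distribs sum.distrib sum_distrib_left mult.assoc)

lemma proj_0 [simp]: "proj 0 = (\<lambda>_. 0)"
  by (simp add: proj_def zero_fun_def)

text \<open>This is (\<phi> \<otimes> id)(\<delta>(x)), written as an explicit sum. Unlike the
  description by \<open>THE\<close> in \<open>contract_cobracket\<close>, it is additive in both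
  arguments without conditions on them.\<close>

definition contract :: "'g functional \<Rightarrow> 'g \<Rightarrow> 'g" where
  "contract \<phi> x = (\<Sum>e\<in>basis_of UNIV. scale (\<delta> x (proj \<phi>) (dual_vector UNIV e)) e)"

lemma dual_contract: "\<psi> \<in> dual UNIV \<Longrightarrow> \<psi> (contract \<phi> x) = \<delta> x (proj \<phi>) \<psi>"
proof -
  assume psi: "\<psi> \<in> dual UNIV"
  have "\<psi> (contract \<phi> x) = (\<Sum>e\<in>basis_of UNIV. \<psi> e * \<delta> x (proj \<phi>) (dual_vector UNIV e))"
    unfolding contract_def by (simp add: dual_simps[OF psi] mult.commute)
  also have "\<dots> = \<delta> x (proj \<phi>) (\<lambda>z. \<Sum>e\<in>basis_of UNIV. \<psi> e * dual_vector UNIV e z)"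
    by (rule cobr_sum_right[symmetric]) (rule dual_vector_in_dual[OF subspace_UNIV])
  also have "(\<lambda>z. \<Sum>e\<in>basis_of UNIV. \<psi> e * dual_vector UNIV e z) = \<psi>"
    using dual_eq_sum[OF subspace_UNIV psi] by simp
  finally show ?thesis .
qed

lemma contract_add: "contract (\<phi> + \<psi>) x = contract \<phi> x + contract \<psi> x"
  and contract_add_right: "contract \<phi> (x + y) = contract \<phi> x + contract \<phi> y"
  and contract_scale: "contract (\<lambda>z. c * \<phi> z) x = scale c (contract \<phi> x)"
  and contract_scale_right: "contract \<phi> (scale c x) = scale c (contract \<phi> x)"
  by (rule dual_separates, simp add: dual_simps dual_contract proj_add proj_scale
      cobr_linear_left[OF proj_in_dual proj_in_dual] cobr_add cobr_scale)+

definition dbl :: "'g \<times> 'g functional \<Rightarrow> 'g \<times> 'g functional \<Rightarrow> 'g \<times> 'g functional" where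
  "dbl X Y = (br (fst X) (fst Y) + contract (snd Y) (fst X) - contract (snd X) (fst Y),
     (\<lambda>z. \<delta> z (proj (snd X)) (proj (snd Y)) - proj (snd Y) (br (fst X) z)
        + proj (snd X) (br (fst Y) z)))"

definition form :: "'g \<times> 'g functional \<Rightarrow> 'g \<times> 'g functional \<Rightarrow> complex" where
  "form X Y = proj (snd X) (fst Y) + proj (snd Y) (fst X)"

definition form3 :: "'g \<times> 'g functional \<Rightarrow> 'g \<times> 'g functional \<Rightarrow> 'g \<times> 'g functional \<Rightarrow> complex" where
  "form3 X Y Z = form (dbl X Y) Z"

lemma snd_dbl_in_dual: "snd (dbl X Y) \<in> dual UNIV"
  unfolding dbl_def snd_conv
  by (intro dual_add dual_diff cobr_dual dual_br_right) simp_all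

lemma dbl_antisym: "dbl Y X = - dbl X Y"
  by (simp add: dbl_def br_antisym[of "fst Y"] cobr_antisym[of _ "proj (snd Y)"] fun_eq_iff)

lemma biadditive_dbl: "biadditive dbl"
proof -
  have l: "dbl (X + X') Y = dbl X Y + dbl X' Y" for X X' Y
    by (simp add: dbl_def prod_eq_iff contract_add contract_add_right br_simps proj_add fun_eq_iff
        cobr_linear_left[OF proj_in_dual proj_in_dual] dual_simps[OF proj_in_dual])
  then have "dbl Y (X + X') = dbl Y X + dbl Y X'" for X X' Y
    by (simp only: dbl_antisym[of Y] minus_add_distrib)
  with l show ?thesis by (intro biadditiveI)
qed

lemma biadditive_form: "biadditive form"
  by (rule biadditiveI) (simp_all add: form_def proj_add dual_simps[OF proj_in_dual])

lemmas dbl_simps = biadditiveD[OF biadditive_dbl]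
lemmas form_simps = biadditiveD[OF biadditive_form]

lemma form_commute: "form X Y = form Y X"
  by (simp add: form_def)

text \<open>Written out, the expression is visibly cyclic in \<open>X\<close>, \<open>Y\<close>,
  \<open>Z\<close>. This cyclicity is the invariance of the form, and the same formula later turns
  isotropy of the graphs into an identity for \<omega>.\<close>

lemma form3_formula:
  "form3 X Y Z =
     proj (snd Z) (br (fst X) (fst Y)) + proj (snd X) (br (fst Y) (fst Z))
     + proj (snd Y) (br (fst Z) (fst X))
     + \<delta> (fst X) (proj (snd Y)) (proj (snd Z)) + \<delta> (fst Y) (proj (snd Z)) (proj (snd X))
     + \<delta> (fst Z) (proj (snd X)) (proj (snd Y))"
proof -
  have "proj (snd (dbl X Y)) = snd (dbl X Y)" by (simp add: snd_dbl_in_dual)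
  then show ?thesis
    unfolding form3_def form_def
    by (simp add: dbl_def dual_simps[OF proj_in_dual] dual_contract
        br_antisym[of "fst X" "fst Z"] cobr_antisym[of _ "proj (snd X)" "proj (snd Z)"])
qed

lemma form3_rotate: "form3 X Y Z = form3 Y Z X"
  by (simp add: form3_formula)

lemma form3_swap: "form3 Y X Z = - form3 X Y Z"
  unfolding form3_def dbl_antisym[of Y X] by (simp add: form_simps)

text \<open>Minus the pairing of the Jacobiator of \<open>X\<close>, \<open>Y\<close>,
  \<open>Z\<close> with \<open>W\<close>, after invariance has moved one bracket to
  \<open>W\<close>. In this shape it is antisymmetric in all four arguments. Its components of mixed
  type are the Jacobi identity of \<open>g\<close>, the cocycle identity and the co-Jacobi
  identity.\<close>

definition jac4 where
  "jac4 X Y Z W = form (dbl X Y) (dbl Z W) + form (dbl Y Z) (dbl X W) + form (dbl Z X) (dbl Y W)"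

lemma jac4_swap12: "jac4 Y X Z W = - jac4 X Y Z W"
  unfolding jac4_def dbl_antisym[of Y X] dbl_antisym[of Z X] dbl_antisym[of Z Y]
  by (simp add: form_simps)

lemma jac4_swap23: "jac4 X Z Y W = - jac4 X Y Z W"
  unfolding jac4_def dbl_antisym[of Z Y] dbl_antisym[of X Z] dbl_antisym[of Y X]
  by (simp add: form_simps)

lemma jac4_swap34: "jac4 X Y W Z = - jac4 X Y Z W"
  unfolding jac4_def dbl_antisym[of W Z] dbl_antisym[of Y Z] dbl_antisym[of X Z]
    dbl_antisym[of W X]
  by (simp add: form_simps form_commute)

lemma jac4_add: "jac4 (X + X') Y Z W = jac4 X Y Z W + jac4 X' Y Z W"
  unfolding jac4_def by (simp add: dbl_simps form_simps)

lemma form_pairs: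
  "form (x, \<phi>) (y, \<psi>) = proj \<phi> y + proj \<psi> x"
  by (simp add: form_def)

lemma contract_0: "contract 0 x = 0" "contract \<phi> 0 = 0"
  using contract_scale[of 0 0 x] contract_scale_right[of \<phi> 0 0] by (simp_all add: zero_fun_def)

lemma cobr_zero_functional: "\<delta> z (\<lambda>_. 0) \<phi> = 0" "\<delta> z \<phi> (\<lambda>_. 0) = 0"
  using cobr_linear_left(2)[OF dual_zero dual_zero, of z 0]
    cobr_linear_right(2)[OF dual_zero dual_zero, of z _ 0] by simp_all

lemma dbl_gg: "dbl (x, 0) (y, 0) = (br x y, 0)"
  by (simp add: dbl_def contract_0 cobr_zero_functional fun_eq_iff)

lemma dbl_ga: "\<phi> \<in> dual UNIV \<Longrightarrow> dbl (x, 0) (0, \<phi>) = (contract \<phi> x, \<lambda>z. - \<phi> (br x z))"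
  by (simp add: dbl_def contract_0 br_simps cobr_zero_functional)

lemma dbl_ag: "\<phi> \<in> dual UNIV \<Longrightarrow> dbl (0, \<phi>) (x, 0) = (- contract \<phi> x, \<lambda>z. \<phi> (br x z))"
  by (simp add: dbl_def contract_0 br_simps cobr_zero_functional)

lemma dbl_aa: "\<phi> \<in> dual UNIV \<Longrightarrow> \<psi> \<in> dual UNIV \<Longrightarrow> dbl (0, \<phi>) (0, \<psi>) = (0, \<lambda>z. \<delta> z \<phi> \<psi>)"
  by (simp add: dbl_def contract_0 br_simps dual_simps)

lemma jac4_gggg: "jac4 (x, 0) (y, 0) (z, 0) (v, 0) = 0"
  by (simp add: jac4_def dbl_gg form_pairs)

lemma jac4_ggga: "\<phi> \<in> dual UNIV \<Longrightarrow> jac4 (x, 0) (y, 0) (z, 0) (0, \<phi>) = 0"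
proof -
  assume phi: "\<phi> \<in> dual UNIV"
  have "br z (br x y) + br x (br y z) + br y (br z x) = 0"
    using jacobi[of z x y] by (simp add: add.commute add.left_commute)
  then have "\<phi> (br z (br x y)) + \<phi> (br x (br y z)) + \<phi> (br y (br z x)) = 0"
    by (metis dual_simps(1,3) phi)
  moreover have "jac4 (x, 0) (y, 0) (z, 0) (0, \<phi>)
      = - (\<phi> (br z (br x y)) + \<phi> (br x (br y z)) + \<phi> (br y (br z x)))"
    using phi by (simp add: jac4_def dbl_gg dbl_ga form_pairs dual_uminus dual_br_right)
  ultimately show ?thesis by simp
qed

lemma jac4_ggaa:
  assumes "\<phi> \<in> dual UNIV" "\<psi> \<in> dual UNIV"
  shows "jac4 (x, 0) (y, 0) (0, \<phi>) (0, \<psi>) = 0"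
proof -
  have c: "\<phi> (br a (contract \<psi> b)) = \<delta> b \<psi> (\<lambda>z. \<phi> (br a z))"
    if "\<phi> \<in> dual UNIV" "\<psi> \<in> dual UNIV" for a b \<phi> \<psi>
    using dual_contract[OF dual_br_right[OF that(1)], of a \<psi> b] that by simp
  show ?thesis
    using assms cocycle[OF assms, of x y]
    by (simp add: jac4_def dbl_gg dbl_ga dbl_ag dbl_aa form_pairs dual_uminus dual_br_right cobr_dual c
        dual_simps br_simps ad2_def cobr_antisym[of _ \<psi> \<phi>]
        cobr_antisym[of _ \<psi> "\<lambda>z. \<phi> (br _ z)"] cobr_antisym[of _ \<phi> "\<lambda>z. \<psi> (br _ z)"]
        algebra_simps)
qed

lemma cobr_contract: "\<phi> \<in> dual UNIV \<Longrightarrow> \<delta> (contract \<phi> x) \<psi> \<chi> = \<delta> x \<phi> (\<lambda>z. \<delta> z \<psi> \<chi>)"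
  using dual_contract[OF cobr_dual, of \<phi> x \<psi> \<chi>] by simp

lemma jac4_gaaa:
  assumes "\<phi> \<in> dual UNIV" "\<psi> \<in> dual UNIV" "\<chi> \<in> dual UNIV"
  shows "jac4 (x, 0) (0, \<phi>) (0, \<psi>) (0, \<chi>) = 0"
proof -
  have "\<delta> x (\<lambda>z. \<delta> z \<phi> \<psi>) \<chi> + \<delta> x (\<lambda>z. \<delta> z \<psi> \<chi>) \<phi> + \<delta> x (\<lambda>z. \<delta> z \<chi> \<phi>) \<psi> = 0"
    using co_jacobi[OF assms, of x] by (simp add: Alt_def cobracket_first_def)
  moreover have "(\<lambda>z. \<delta> z \<chi> \<phi>) = (\<lambda>z. - 1 * \<delta> z \<phi> \<chi>)" by (simp add: cobr_antisym[of _ \<chi>])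
  ultimately show ?thesis
    using assms
    by (simp add: jac4_def dbl_ga dbl_ag dbl_aa form_pairs cobr_dual dual_simps cobr_contract
       cobr_linear_left(2)[OF cobr_dual cobr_dual, of _ "- 1", simplified] dual_simps(4)[OF cobr_dual]
       cobr_antisym[of x _ "\<lambda>z. \<delta> z _ _"] algebra_simps)
qed

lemma jac4_aaaa:
  assumes "\<phi> \<in> dual UNIV" "\<psi> \<in> dual UNIV" "\<chi> \<in> dual UNIV" "\<theta> \<in> dual UNIV"
  shows "jac4 (0, \<phi>) (0, \<psi>) (0, \<chi>) (0, \<theta>) = 0"
  using assms by (simp add: jac4_def dbl_aa form_pairs cobr_dual dual_simps cobr_zero)

lemma dbl_proj: "dbl (fst X, proj (snd X)) Y = dbl X Y"
proof -
  have "contract (proj \<phi>) x = contract \<phi> x" for \<phi> x by (simp add: contract_def)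
  then show ?thesis by (simp add: dbl_def)
qed

lemma jac4_split:
  assumes "\<And>x. jac4 (x, 0) Y Z W = 0" "\<And>\<phi>. \<phi> \<in> dual UNIV \<Longrightarrow> jac4 (0, \<phi>) Y Z W = 0"
  shows "jac4 X Y Z W = 0"
proof -
  have d: "dbl Y (fst X, proj (snd X)) = dbl Y X" for Y
    using dbl_proj[of X Y] dbl_antisym[of _ Y] by simp
  \<comment> \<open>The second component of \<open>X\<close> is an arbitrary function, but the
    bracket sees only its projection, so it can be replaced by a linear functional.\<close>
  have "jac4 X Y Z W = jac4 (fst X, proj (snd X)) Y Z W"
    unfolding jac4_def by (simp add: dbl_proj d)
  also have "(fst X, proj (snd X)) = (fst X, 0) + (0, proj (snd X))" by simp
  finally show ?thesis by (simp only: jac4_add) (simp add: assms)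
qed

text \<open>\<open>jac4\<close> is totally antisymmetric, so five types of arguments suffice.\<close>

lemma jac4_eq_0: "jac4 X Y Z W = 0"
proof -
  have e12: "jac4 Y X Z W = 0" if "jac4 X Y Z W = 0" for X Y Z W
    using that jac4_swap12[of X Y Z W] by simp
  have e23: "jac4 X Z Y W = 0" if "jac4 X Y Z W = 0" for X Y Z W
    using that jac4_swap23[of X Y Z W] by simp
  have e34: "jac4 X Y W Z = 0" if "jac4 X Y Z W = 0" for X Y Z W
    using that jac4_swap34[of X Y Z W] by simp
  note split1 = jac4_split
  have split2: "jac4 X Y Z W = 0"
    if "\<And>y. jac4 X (y, 0) Z W = 0" "\<And>\<phi>. \<phi> \<in> dual UNIV \<Longrightarrow> jac4 X (0, \<phi>) Z W = 0" for X Y Z W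
    by (rule e12, rule jac4_split; rule e12) (fact that)+
  have split3: "jac4 X Y Z W = 0"
    if "\<And>z. jac4 X Y (z, 0) W = 0" "\<And>\<phi>. \<phi> \<in> dual UNIV \<Longrightarrow> jac4 X Y (0, \<phi>) W = 0" for X Y Z W
    by (rule e23, rule split2; rule e23) (fact that)+
  have split4: "jac4 X Y Z W = 0"
    if "\<And>w. jac4 X Y Z (w, 0) = 0" "\<And>\<phi>. \<phi> \<in> dual UNIV \<Longrightarrow> jac4 X Y Z (0, \<phi>) = 0" for X Y Z W
    by (rule e34, rule split3; rule e34) (fact that)+
  note ggga = jac4_ggga note ggag = ggga[THEN e34] note gagg = ggag[THEN e23] note aggg = gagg[THEN e12]
  note ggaa = jac4_ggaa note gaga = ggaa[THEN e23] note agga = gaga[THEN e12]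
  note gaag = gaga[THEN e34] note agag = gaag[THEN e12] note aagg = agag[THEN e23]
  note gaaa = jac4_gaaa note agaa = gaaa[THEN e12] note aaga = agaa[THEN e23] note aaag = aaga[THEN e34]
  show ?thesis
    by (rule split1; rule split2; rule split3; rule split4)
      (rule jac4_gggg jac4_aaaa ggga ggag gagg aggg ggaa gaga agga gaag agag aagg gaaa agaa aaga aaag;
        assumption)+
qed

lemma form_nondegenerate:
  assumes "snd X \<in> dual UNIV" "\<And>W. form X W = 0"
  shows "X = 0"
proof -
  have "snd X w = 0" for w using assms(2)[of "(w, 0)"] assms(1) by (simp add: form_def)
  moreover have "\<phi> (fst X) = \<phi> 0" if "\<phi> \<in> dual UNIV" for \<phi>
    using assms(2)[of "(0, \<phi>)"] assms(1) that by (simp add: form_def dual_simps)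
  ultimately show ?thesis using dual_separates[of "fst X" 0] by (simp add: prod_eq_iff fun_eq_iff)
qed

lemma dbl_jacobi: "dbl X (dbl Y Z) + dbl Y (dbl Z X) + dbl Z (dbl X Y) = 0"
proof (rule form_nondegenerate)
  show "snd (dbl X (dbl Y Z) + dbl Y (dbl Z X) + dbl Z (dbl X Y)) \<in> dual UNIV"
    by (simp add: plus_fun_def) (intro dual_add snd_dbl_in_dual)
  fix W
  \<comment> \<open>Invariance moves the outer bracket onto \<open>W\<close>; the cyclic sum of
    these terms is \<open>jac4\<close> up to sign.\<close>
  have "form (dbl X (dbl Y Z)) W = - form (dbl Y Z) (dbl X W)" for X Y Z
    using form3_swap[of X "dbl Y Z" W] form3_rotate[of "dbl Y Z" X W]  form3_rotate[of X W "dbl Y Z"]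
    by (simp add: form3_def form_commute)
  then have "form (dbl X (dbl Y Z) + dbl Y (dbl Z X) + dbl Z (dbl X Y)) W = - jac4 X Y Z W"
    by (simp add: jac4_def form_simps)
  then show "form (dbl X (dbl Y Z) + dbl Y (dbl Z X) + dbl Z (dbl X Y)) W = 0"
    by (simp add: jac4_eq_0)
qed

lemma dbl_derivation: "dbl X (dbl Y Z) = dbl (dbl X Y) Z + dbl Y (dbl X Z)"
  using dbl_jacobi[of X Y Z] dbl_antisym[of Z X] dbl_antisym[of Z "dbl X Y"]
  by (simp add: dbl_simps algebra_simps add_eq_0_iff)

lemma form_invariant: "form (dbl X Y) Z + form Y (dbl X Z) = 0"
  using form3_rotate[of Z X Y] form3_swap[of Z X Y]
  by (simp add: form3_def form_commute[of Y])

text \<open>The adjoint action respects both the bracket and the form, hence the three-form built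
  from them. This is the induction step behind \<open>graph_isotropic\<close>.\<close>

lemma form3_invariant:
  "form3 (dbl X Y) Z W + form3 Y (dbl X Z) W + form3 Y Z (dbl X W) = 0"
proof -
  have "form (dbl X (dbl Y Z)) W + form (dbl Y Z) (dbl X W) = 0" by (rule form_invariant)
  then show ?thesis unfolding dbl_derivation[of X Y Z] by (simp add: form3_def form_simps)
qed

end

section \<open>Agreement with the given bracket of the double, and the half of the form that defines
  omega\<close>

context lie_bialgebra
begin

lemma linear_extension_UNIV:
  assumes "\<phi> \<in> dual UNIV"
  shows "linear_extension UNIV \<phi> = \<phi>"
proof -
  have "\<exists>\<phi>'. \<phi>' \<in> dual UNIV \<and> (\<forall>x\<in>UNIV. \<phi>' x = \<phi> x)" using assms by blast
  from someI_ex[OF this] show ?thesis unfolding linear_extension_def by (simp add: fun_eq_iff)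
qed

lemma contract_cobracket_UNIV:
  assumes "\<phi> \<in> dual UNIV"
  shows "contract_cobracket UNIV \<phi> x = contract \<phi> x"
  unfolding contract_cobracket_def
proof (rule the_equality)
  show "contract \<phi> x \<in> UNIV \<and> (\<forall>\<psi>\<in>dual UNIV. \<psi> (contract \<phi> x) = dual_bracket UNIV \<phi> \<psi> x)"
    using assms by (simp add: dual_bracket_def linear_extension_UNIV dual_contract)
  fix a assume "a \<in> UNIV \<and> (\<forall>\<psi>\<in>dual UNIV. \<psi> a = dual_bracket UNIV \<phi> \<psi> x)"
  then show "a = contract \<phi> x" using assms
    by (intro dual_separates) (simp add: dual_bracket_def linear_extension_UNIV dual_contract)
qed

lemma double_bracket_UNIV:
  assumes "snd X \<in> dual UNIV" "snd Y \<in> dual UNIV"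
  shows "double_bracket UNIV X Y = dbl X Y"
  using assms
  by (simp add: double_bracket_def dbl_def split_beta contract_cobracket_UNIV dual_bracket_def
      linear_extension_UNIV ad_transpose_def fun_eq_iff)

lemma dual_vector_0: "dual_vector V e 0 = 0"
  by (simp add: dual_vector_def representation_zero)

text \<open>The half of the form that occurs in \<omega>: the \<open>g\<close> part of
  \<open>X\<close> paired with the \<open>g*\<close> part of \<open>Y\<close>. The other half is its
  transpose, so isotropy of \<open>g\<close> will make \<omega> antisymmetric.\<close>

definition beta :: "'g \<times> 'g functional \<Rightarrow> 'g \<times> 'g functional \<Rightarrow> complex" where
  "beta X Y = proj (snd Y) (fst X)"

lemma biadditive_beta: "biadditive beta"
  by (rule biadditiveI) (simp_all add: beta_def proj_add dual_simps[OF proj_in_dual])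

lemmas beta_simps = biadditiveD[OF biadditive_beta]

lemma form_beta: "form X Y = beta X Y + beta Y X"
  by (simp add: form_def beta_def)

definition dscale :: "complex \<Rightarrow> 'g \<times> 'g functional \<Rightarrow> 'g \<times> 'g functional" where
  "dscale c X = (scale c (fst X), \<lambda>z. c * snd X z)"

lemma dbl_dscale: "dbl X (dscale c Y) = dscale c (dbl X Y)" "dbl (dscale c X) Y = dscale c (dbl X Y)"
proof -
  show "dbl X (dscale c Y) = dscale c (dbl X Y)" for X Y
    by (simp add: dbl_def dscale_def br_scale_right br_scale contract_scale contract_scale_right
        scale_right_diff_distrib scale_right_distrib proj_scale fun_eq_iff
        cobr_linear_right(2)[OF proj_in_dual proj_in_dual] dual_simps[OF proj_in_dual] algebra_simps)
  have m: "- dscale c X = dscale c (- X)" for X by (simp add: dscale_def scale_minus_right fun_eq_iff)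
  show "dbl (dscale c X) Y = dscale c (dbl X Y)"
    unfolding dbl_antisym[of _ Y] dbl_antisym[of X Y] \<open>dbl Y (dscale c X) = _\<close> m ..
qed

lemma beta_dscale: "beta (dscale c X) Y = c * beta X Y" "beta X (dscale c Y) = c * beta X Y"
  by (simp_all add: beta_def dscale_def proj_scale dual_simps[OF proj_in_dual])

end

context split_lie_bialgebra
begin

section \<open>The splitting\<close>

lemma l_subspace: "subspace l"
  and br_l: "x \<in> l \<Longrightarrow> y \<in> l \<Longrightarrow> br x y \<in> l"
  and cobr_l: "x \<in> l \<Longrightarrow> \<delta> x \<in> tensors2 l l"
  using l_subbialgebra by (auto simp: lie_subbialgebra_def)

lemma l_part_unique:
  assumes "y \<in> l" "x - y \<in> u"
  shows "l_part x = y"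
  unfolding l_part_def
proof (rule the_equality)
  fix y' assume y': "y' \<in> l \<and> x - y' \<in> u"
  have "y' - y \<in> l" using y' assms l_subspace subspace_diff by blast
  moreover have "y' - y = (x - y) - (x - y')" by simp
  then have "y' - y \<in> u" using y' assms u_subspace subspace_diff by metis
  ultimately have "y' - y = 0" using decomp_inter by blast
  then show "y' = y" by simp
qed (use assms in blast)

lemma l_part: "l_part x \<in> l" "x - l_part x \<in> u"
proof -
  obtain y z where "y \<in> l" "z \<in> u" "x = y + z" using decomp_sum by blast
  then have "l_part x = y" by (intro l_part_unique) simp_all
  then show "l_part x \<in> l" "x - l_part x \<in> u" using \<open>y \<in> l\<close> \<open>z \<in> u\<close> \<open>x = y + z\<close> by simp_all
qed

lemma l_part_l: "x \<in> l \<Longrightarrow> l_part x = x"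
  by (rule l_part_unique) (simp_all add: subspace_0[OF u_subspace])

lemma l_part_u: "x \<in> u \<Longrightarrow> l_part x = 0"
  by (rule l_part_unique) (simp_all add: subspace_0[OF l_subspace])

lemma l_part_add: "l_part (x + y) = l_part x + l_part y"
proof (rule l_part_unique)
  have "x + y - (l_part x + l_part y) = (x - l_part x) + (y - l_part y)" by simp
  then show "x + y - (l_part x + l_part y) \<in> u" using subspace_add[OF u_subspace] l_part(2) by metis
qed (intro subspace_add[OF l_subspace] l_part)

lemma l_part_scale: "l_part (scale c x) = scale c (l_part x)"
proof (rule l_part_unique)
  have "scale c x - scale c (l_part x) = scale c (x - l_part x)" by (simp add: scale_right_diff_distrib)
  then show "scale c x - scale c (l_part x) \<in> u" using subspace_scale[OF u_subspace] l_part(2) by metis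
qed (intro subspace_scale[OF l_subspace] l_part)

lemma embed_in_dual: "\<xi> \<in> dual l \<Longrightarrow> embed \<xi> \<in> dual UNIV"
  by (simp add: dual_UNIV_iff embed_def l_part_add l_part_scale dualD(1,2) l_part)

lemma embed_l: "x \<in> l \<Longrightarrow> embed \<xi> x = \<xi> x"
  by (simp add: embed_def l_part_l)

text \<open>Like \<open>proj\<close>, \<open>lift\<close> makes \<open>embed\<close> total: the two agree on the dual of \<open>l\<close>.\<close>

definition lift :: "'g functional \<Rightarrow> 'g functional" where
  "lift \<xi> = (\<lambda>x. \<Sum>e\<in>basis_of l. \<xi> e * embed (dual_vector l e) x)"

lemma lift_in_dual [simp]: "lift \<xi> \<in> dual UNIV"
  unfolding lift_def
  by (intro dual_sum dual_scale embed_in_dual dual_vector_in_dual l_subspace)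

lemma lift_embed: "\<xi> \<in> dual l \<Longrightarrow> lift \<xi> = embed \<xi>"
  unfolding lift_def embed_def using dual_expansion[OF l_subspace _ l_part(1)] by (simp add: fun_eq_iff)

lemma lift_u: "x \<in> u \<Longrightarrow> lift \<xi> x = 0"
  by (simp add: lift_def embed_def l_part_u dual_vector_0)

lemma lift_add: "lift (\<xi> + \<eta>) = (\<lambda>x. lift \<xi> x + lift \<eta> x)"
  and lift_scale: "lift (\<lambda>x. c * \<xi> x) = (\<lambda>x. c * lift \<xi> x)"
  by (simp_all add: lift_def ring_distribs sum.distrib sum_distrib_left mult.assoc)

lemma cobr_l_cong:
  assumes "x \<in> l" "\<And>z. z \<in> l \<Longrightarrow> \<phi> z = \<phi>' z" "\<And>z. z \<in> l \<Longrightarrow> \<psi> z = \<psi>' z"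
    and "\<phi> \<in> dual UNIV" "\<phi>' \<in> dual UNIV" "\<psi> \<in> dual UNIV" "\<psi>' \<in> dual UNIV"
  shows "\<delta> x \<phi> \<psi> = \<delta> x \<phi>' \<psi>'"
  by (rule tensors2E[OF cobr_l[OF assms(1)]]) (simp add: assms)

text \<open>In terms of the dual bracket: if \<phi> annihilates \<open>l\<close>, so does
  [\<phi>, \<psi>]. This says that \<open>u*\<close> is an ideal of \<open>g*\<close>.\<close>

lemma cobr_l_vanish:
  assumes "x \<in> l" "\<And>z. z \<in> l \<Longrightarrow> \<phi> z = 0"
  shows "\<delta> x \<phi> \<psi> = 0"
proof (cases "\<phi> \<in> dual UNIV \<and> \<psi> \<in> dual UNIV")
  case True
  show ?thesis by (rule tensors2E[OF cobr_l[OF assms(1)]]) (use True assms in simp)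
qed (auto simp: cobr_outside)

lemma cobr_l_vanish_right:
  assumes "x \<in> l" "\<And>z. z \<in> l \<Longrightarrow> \<psi> z = 0"
  shows "\<delta> x \<phi> \<psi> = 0"
  using cobr_l_vanish[of x \<psi> \<phi>] cobr_antisym[of x \<phi> \<psi>] assms by simp

text \<open>In terms of the dual bracket: \<open>l*\<close>, the annihilator of \<open>u\<close>, is
  a subalgebra of \<open>g*\<close>. Each of the three components allowed for \<delta>(u) has a leg
  in \<open>u\<close>, where one of the functionals vanishes.\<close>

lemma cobr_u_vanish:
  assumes "x \<in> u" "\<And>z. z \<in> u \<Longrightarrow> \<phi> z = 0" "\<And>z. z \<in> u \<Longrightarrow> \<psi> z = 0"
  shows "\<delta> x \<phi> \<psi> = 0"
proof (cases "\<phi> \<in> dual UNIV \<and> \<psi> \<in> dual UNIV")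
  case True
  obtain T1 T2 T3 where T: "T1 \<in> tensors2 l u" "T2 \<in> tensors2 u l" "T3 \<in> tensors2 u u"
    "\<delta> x = T1 + T2 + T3" using cobr_u[OF assms(1)] by blast
  have "T1 \<phi> \<psi> = 0" by (rule tensors2E[OF T(1)]) (use True assms in simp)
  moreover have "T2 \<phi> \<psi> = 0" by (rule tensors2E[OF T(2)]) (use True assms in simp)
  moreover have "T3 \<phi> \<psi> = 0" by (rule tensors2E[OF T(3)]) (use True assms in simp)
  ultimately show ?thesis using T(4) by simp
qed (auto simp: cobr_outside)

text \<open>The coordinates on \<open>u\<close> extended by zero on \<open>l\<close>, hence linear
  on \<open>g\<close>. By contrast \<open>dual_vector u e\<close> is zero off \<open>u\<close> and
  is not linear on \<open>g\<close>.\<close>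

definition u_coord :: "'g \<Rightarrow> 'g functional" where
  "u_coord e = (\<lambda>x. dual_vector u e (x - l_part x))"

lemma u_coord_in_dual [simp]: "u_coord e \<in> dual UNIV"
proof -
  note D = dualD[OF dual_vector_in_dual[OF u_subspace]]
  have e: "x + y - l_part (x + y) = (x - l_part x) + (y - l_part y)"
    "scale c x - l_part (scale c x) = scale c (x - l_part x)" for x y c
    by (simp_all add: l_part_add l_part_scale scale_right_diff_distrib)
  show ?thesis
    unfolding dual_UNIV_iff u_coord_def e by (intro conjI allI D(1,2) l_part)
qed

lemma u_coord_l: "x \<in> l \<Longrightarrow> u_coord e x = 0"
  by (simp add: u_coord_def l_part_l dual_vector_0)

lemma u_coord_u: "x \<in> u \<Longrightarrow> u_coord e x = dual_vector u e x"
  by (simp add: u_coord_def l_part_u)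

lemma u_expansion: "x \<in> u \<Longrightarrow> x = (\<Sum>e\<in>basis_of u. scale (u_coord e x) e)"
  using basis_expansion[OF u_subspace] by (simp add: u_coord_u)

lemma dual_split:
  assumes "\<phi> \<in> dual UNIV"
  shows "\<phi> x = \<phi> (l_part x) + (\<Sum>e\<in>basis_of u. \<phi> e * u_coord e x)"
proof -
  have "\<phi> x = \<phi> (l_part x) + \<phi> (x - l_part x)" using dual_simps(1)[OF assms, of "l_part x" "x - l_part x"] by simp
  also have "\<phi> (x - l_part x) = (\<Sum>e\<in>basis_of u. \<phi> e * u_coord e x)"
    by (subst u_expansion[OF l_part(2)])
      (simp add: dual_simps[OF assms] u_coord_def mult.commute l_part_add l_part_u l_part(2))
  finally show ?thesis .
qed

lemma mem_u_iff: "x \<in> u \<longleftrightarrow> l_part x = 0"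
  by (metis diff_zero l_part(2) l_part_u)

lemma contract_l: "x \<in> l \<Longrightarrow> contract \<phi> x \<in> l"
proof -
  assume x: "x \<in> l"
  have "contract \<phi> x = l_part (contract \<phi> x)"
  proof (rule dual_separates)
    fix \<psi> assume psi: "\<psi> \<in> dual UNIV"
    have "(\<lambda>z. \<psi> (z - l_part z)) \<in> dual UNIV"
      by (simp add: dual_UNIV_iff l_part_add l_part_scale dual_simps[OF psi] right_diff_distrib)
    from dual_contract[OF this, of \<phi> x]
    have "\<psi> (contract \<phi> x - l_part (contract \<phi> x)) = \<delta> x (proj \<phi>) (\<lambda>z. \<psi> (z - l_part z))" by simp
    also have "\<dots> = 0" by (rule cobr_l_vanish_right[OF x]) (simp add: l_part_l dual_simps[OF psi])
    finally show "\<psi> (contract \<phi> x) = \<psi> (l_part (contract \<phi> x))" by (simp add: dual_simps[OF psi])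
  qed
  then show ?thesis using l_part(1)[of "contract \<phi> x"] by simp
qed

text \<open>Here \<phi> lies in \<open>l*\<close>. A component of the result in \<open>l\<close>
  would come from the l \<otimes> l component of \<delta>(x), which is absent for \<open>x\<close>
  in \<open>u\<close>.\<close>

lemma contract_u:
  assumes "x \<in> u" "\<And>z. z \<in> u \<Longrightarrow> proj \<phi> z = 0"
  shows "contract \<phi> x \<in> u"
proof -
  have "l_part (contract \<phi> x) = 0"
  proof (rule dual_separates)
    fix \<psi> assume psi: "\<psi> \<in> dual UNIV"
    have "(\<lambda>z. \<psi> (l_part z)) \<in> dual UNIV"
      by (simp add: dual_UNIV_iff l_part_add l_part_scale dual_simps[OF psi])
    from dual_contract[OF this, of \<phi> x]
    have "\<psi> (l_part (contract \<phi> x)) = \<delta> x (proj \<phi>) (\<lambda>z. \<psi> (l_part z))" by simp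
    also have "\<dots> = 0"
      by (rule cobr_u_vanish[OF assms]) (simp_all add: l_part_u dual_simps[OF psi])
    finally show "\<psi> (l_part (contract \<phi> x)) = \<psi> 0" by (simp add: dual_simps[OF psi])
  qed
  then show ?thesis by (simp add: mem_u_iff)
qed

lemma linear_extension_l:
  assumes "\<xi> \<in> dual l"
  shows "linear_extension l \<xi> \<in> dual UNIV" "x \<in> l \<Longrightarrow> linear_extension l \<xi> x = \<xi> x"
proof -
  have "\<exists>\<phi>'. \<phi>' \<in> dual UNIV \<and> (\<forall>x\<in>l. \<phi>' x = \<xi> x)"
    using embed_in_dual[OF assms] embed_l by blast
  from someI_ex[OF this]
  show "linear_extension l \<xi> \<in> dual UNIV" "x \<in> l \<Longrightarrow> linear_extension l \<xi> x = \<xi> x"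
    unfolding linear_extension_def by blast+
qed

lemma dual_bracket_l:
  assumes "\<xi> \<in> dual l" "\<eta> \<in> dual l" "x \<in> l"
  shows "dual_bracket l \<xi> \<eta> x = \<delta> x (embed \<xi>) (embed \<eta>)"
  using assms by (simp add: dual_bracket_def)
    (intro cobr_l_cong; simp add: linear_extension_l embed_in_dual embed_l)

lemma dual_bracket_in_dual: "dual_bracket l \<xi> \<eta> \<in> dual l"
  using l_subspace
  by (simp add: dual_def dual_bracket_def subspace_add subspace_scale cobr_add cobr_scale)

text \<open>Both sides vanish on \<open>u\<close> because \<open>l*\<close> is a subalgebra of
  \<open>g*\<close>, so it is enough to compare them on \<open>l\<close>.\<close>

lemma embed_dual_bracket:
  assumes "\<xi> \<in> dual l" "\<eta> \<in> dual l"
  shows "embed (dual_bracket l \<xi> \<eta>) = (\<lambda>x. \<delta> x (embed \<xi>) (embed \<eta>))"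
proof
  fix x
  have "\<delta> (x - l_part x) (embed \<xi>) (embed \<eta>) = 0"
    using assms by (intro cobr_u_vanish l_part) (simp_all add: lift_embed[symmetric] lift_u)
  then have "\<delta> x (embed \<xi>) (embed \<eta>) = \<delta> (l_part x) (embed \<xi>) (embed \<eta>)"
    using cobr_add[of "x - l_part x" "l_part x"] by simp
  then show "embed (dual_bracket l \<xi> \<eta>) x = \<delta> x (embed \<xi>) (embed \<eta>)"
    using dual_bracket_l[OF assms l_part(1), of x] by (simp add: embed_def)
qed

lemma contract_cobracket_l:
  assumes "\<xi> \<in> dual l" "x \<in> l"
  shows "contract_cobracket l \<xi> x = contract (embed \<xi>) x"
  unfolding contract_cobracket_def
proof (rule the_equality)
  have c: "\<psi> (contract (embed \<xi>) x) = dual_bracket l \<xi> \<psi> x" if "\<psi> \<in> dual l" for \<psi>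
    using dual_contract[OF embed_in_dual[OF that], of "embed \<xi>" x] assms that
    by (simp add: embed_l contract_l embed_in_dual dual_bracket_l)
  then show "contract (embed \<xi>) x \<in> l \<and>
      (\<forall>\<psi>\<in>dual l. \<psi> (contract (embed \<xi>) x) = dual_bracket l \<xi> \<psi> x)"
    using contract_l[OF assms(2)] by blast
  fix a assume a: "a \<in> l \<and> (\<forall>\<psi>\<in>dual l. \<psi> a = dual_bracket l \<xi> \<psi> x)"
  have "dual_vector l e a = dual_vector l e (contract (embed \<xi>) x)" for e
    using a c dual_vector_in_dual[OF l_subspace] by simp
  then show "a = contract (embed \<xi>) x"
    using basis_expansion[OF l_subspace, of a] a
      basis_expansion[OF l_subspace contract_l[OF assms(2), of "embed \<xi>"]] by simp
qed

text \<open>The action of \<open>l*\<close> on its own double agrees with its action on the double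
  of \<open>g\<close>. This is needed because \<open>dress\<close> refers to the first double and
  \<open>omega\<close> to the second.\<close>

lemma double_bracket_l:
  assumes "\<xi> \<in> dual l" "p \<in> l" "q \<in> dual l"
  obtains p' q' where "p' \<in> l" "q' \<in> dual l" "double_bracket l (0, \<xi>) (p, q) = (p', q')"
    "dbl (0, lift \<xi>) (p, embed q) = (p', embed q')"
proof -
  define q' where "q' = dual_bracket l \<xi> q - ad_transpose l 0 q + ad_transpose l p \<xi>"
  have l0: "0 \<in> l" by (rule subspace_0[OF l_subspace])
  have z: "\<zeta> 0 = 0" if "\<zeta> \<in> dual l" for \<zeta> using dualD(2)[OF that l0, of 0] by simp
  have q'_eq: "q' x = (if x \<in> l then dual_bracket l \<xi> q x + \<xi> (br p x) else 0)" for x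
    using z[OF assms(3)]
    by (simp add: q'_def ad_transpose_def br_simps dualD(3)[OF dual_bracket_in_dual])
  have "q' \<in> dual l"
    using l_subspace assms br_l dualD(1,2)[OF dual_bracket_in_dual]
    by (auto simp: dual_def[of l] q'_eq subspace_add subspace_scale br_add_right br_scale_right
        dualD(1,2)[OF assms(1)] algebra_simps)
  moreover have "double_bracket l (0, \<xi>) (p, q) = (- contract (embed \<xi>) p, q')"
    using assms by (simp add: double_bracket_def contract_cobracket_l l0 br_simps contract_0 q'_def)
  moreover have "embed q' x = \<delta> x (embed \<xi>) (embed q) + embed \<xi> (br p x)" for x
  proof -
    \<comment> \<open>As \<open>p\<close> lies in \<open>l\<close>, bracketing with \<open>p\<close>
      preserves both summands of the splitting and so commutes with the projection to
      \<open>l\<close>.\<close>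
    have "br p x = br p (l_part x) + br p (x - l_part x)" by (simp add: br_simps)
    moreover have "br p (x - l_part x) \<in> u" by (rule br_l_u[OF assms(2) l_part(2)])
    ultimately have "l_part (br p x) = br p (l_part x)"
      using l_part_add l_part_u l_part_l br_l[OF assms(2) l_part(1)] by simp
    then show ?thesis
      using fun_cong[OF embed_dual_bracket[OF assms(1,3)], of x] by (simp add: embed_def q'_eq l_part)
  qed
  then have "dbl (0, lift \<xi>) (p, embed q) = (- contract (embed \<xi>) p, embed q')"
    using assms by (simp add: dbl_def lift_embed embed_in_dual contract_0 br_simps dual_simps fun_eq_iff)
  ultimately show ?thesis
    using that subspace_neg[OF l_subspace contract_l[OF assms(2)]] by blast
qed

section \<open>The adjoint action of the dual group\<close>

text \<open>The action \<open>Ad_inverse UNIV\<close> along embedded letters, with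
  \<open>dbl\<close> and \<open>lift\<close> in place of the partial notions, so that additivity
  holds for all pairs and all words.\<close>

definition AdI :: "'g \<times> 'g functional \<Rightarrow> 'g functional list \<Rightarrow> 'g \<times> 'g functional" where
  "AdI X w = foldl (\<lambda>Y \<xi>. - dbl (0, lift \<xi>) Y) X w"

lemma AdI_Nil: "AdI X [] = X"
  and AdI_Cons': "AdI X (\<xi> # w) = AdI (- dbl (0, lift \<xi>) X) w"
  and AdI_snoc: "AdI X (w @ [\<xi>]) = - dbl (0, lift \<xi>) (AdI X w)"
  and AdI_append: "AdI X (w @ w') = AdI (AdI X w) w'"
  by (simp_all add: AdI_def)

lemma AdI_add: "AdI (X + Y) w = AdI X w + AdI Y w"
proof (induction w arbitrary: X Y)
  case (Cons \<xi> w)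
  have "- dbl (0, lift \<xi>) (X + Y) = - dbl (0, lift \<xi>) X + - dbl (0, lift \<xi>) Y"
    by (simp add: dbl_simps)
  then show ?case by (simp only: AdI_Cons' Cons)
qed (simp add: AdI_Nil)

lemma AdI_additive: "additive (\<lambda>X. AdI X w)"
  by (simp add: additive_def AdI_add)

lemmas AdI_uminus = additive.minus[OF AdI_additive]
lemmas AdI_diff = additive.diff[OF AdI_additive]

lemma AdI_Cons: "AdI X (\<xi> # w) = - AdI (dbl (0, lift \<xi>) X) w"
  by (simp add: AdI_Cons' AdI_uminus)

lemma AdI_dscale: "AdI (dscale c X) w = dscale c (AdI X w)"
proof (induction w arbitrary: X)
  case (Cons \<xi> w)
  have "- dbl (0, lift \<xi>) (dscale c X) = dscale c (- dbl (0, lift \<xi>) X)"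
    unfolding dbl_dscale by (simp add: dscale_def scale_minus_right fun_eq_iff)
  then show ?case by (simp add: AdI_Cons' Cons)
qed (simp add: AdI_Nil)

lemma AdI_snd_in_dual: "snd X \<in> dual UNIV \<Longrightarrow> snd (AdI X w) \<in> dual UNIV"
proof (induction w arbitrary: X)
  case (Cons \<xi> w)
  have "snd (- dbl (0, lift \<xi>) X) \<in> dual UNIV"
    using dual_uminus[OF snd_dbl_in_dual] by (simp add: fun_Compl_def)
  then show ?case unfolding AdI_Cons' by (rule Cons.IH)
qed (simp add: AdI_Nil)

text \<open>\<open>Ad(x^-1)\<close> is an automorphism of the double: each letter acts by a
  derivation, and convolution distributes the letters over the two arguments.\<close>

lemma AdI_dbl: "AdI (dbl X Y) w = conv dbl (AdI X) (AdI Y) w"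
proof (induction w arbitrary: X Y)
  case (Cons \<xi> w)
  have "AdI (dbl X Y) (\<xi> # w) = AdI (dbl (- dbl (0, lift \<xi>) X) Y + dbl X (- dbl (0, lift \<xi>) Y)) w"
    unfolding AdI_Cons' dbl_derivation[of "(0, lift \<xi>)"] by (simp add: dbl_simps)
  also have "\<dots> = conv dbl (AdI X) (AdI Y) (\<xi> # w)"
    by (simp only: AdI_add Cons conv.simps AdI_Cons')
  finally show ?case .
qed (simp add: AdI_Nil)

text \<open>\<open>Ad(x^-1)\<close> preserves the form. The right side is the constant function with
  value \<open>form X Y\<close>: its derivatives vanish by invariance.\<close>

lemma AdI_form: "conv form (AdI X) (AdI Y) w = (if w = [] then form X Y else 0)"
proof (induction w arbitrary: X Y)
  case (Cons \<xi> w)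
  have "conv form (AdI X) (AdI Y) (\<xi> # w) =
      (if w = [] then - (form (dbl (0, lift \<xi>) X) Y + form X (dbl (0, lift \<xi>) Y)) else 0)"
    by (simp add: AdI_Cons' Cons form_simps)
  then show ?case by (simp add: form_invariant)
qed (simp add: AdI_Nil)

text \<open>\<open>g*\<close> is a subalgebra of the double and contains all the letters, so it is
  stable.\<close>

lemma AdI_fst_0: "fst X = 0 \<Longrightarrow> fst (AdI X w) = 0"
  by (induction w arbitrary: X) (simp_all add: AdI_Nil AdI_Cons' dbl_def br_simps contract_0)

text \<open>Membership in l \<oplus> l*, with \<open>l*\<close> realized as the annihilator of
  \<open>u\<close>. Together with u \<oplus> u* it gives an orthogonal decomposition of the double
  that is stable under \<open>l*\<close>.\<close>

definition in_dl :: "'g \<times> 'g functional \<Rightarrow> bool" where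
  "in_dl X \<longleftrightarrow> fst X \<in> l \<and> snd X \<in> dual UNIV \<and> (\<forall>z\<in>u. snd X z = 0)"

definition in_du :: "'g \<times> 'g functional \<Rightarrow> bool" where
  "in_du X \<longleftrightarrow> fst X \<in> u \<and> snd X \<in> dual UNIV \<and> (\<forall>z\<in>l. snd X z = 0)"

lemma dbl_lift: "snd X \<in> dual UNIV \<Longrightarrow> dbl (0, lift \<xi>) X =
  (- contract (lift \<xi>) (fst X), \<lambda>z. \<delta> z (lift \<xi>) (snd X) + lift \<xi> (br (fst X) z))"
  by (simp add: dbl_def br_simps contract_0 dual_simps)

lemma in_dl_AdI: "in_dl X \<Longrightarrow> in_dl (AdI X w)"
proof (induction w arbitrary: X)
  case (Cons \<xi> w)
  have "in_dl (- dbl (0, lift \<xi>) X)"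
    using Cons.prems snd_dbl_in_dual[of "(0, lift \<xi>)" X, THEN dual_uminus]
    by (auto simp: in_dl_def dbl_lift contract_l fun_Compl_def cobr_u_vanish lift_u br_l_u)
  then show ?case by (simp add: AdI_Cons' Cons.IH)
qed (simp add: AdI_Nil)

text \<open>Three facts are used: contraction with \<open>l*\<close> maps \<open>u\<close> to
  \<open>u\<close>, \<open>u*\<close> is an ideal of \<open>g*\<close>, and [u, l] lies in
  \<open>u\<close>, where letters vanish.\<close>

lemma in_du_AdI: "in_du X \<Longrightarrow> in_du (AdI X w)"
proof (induction w arbitrary: X)
  case (Cons \<xi> w)
  have "lift \<xi> (br x z) = 0" if "x \<in> u" "z \<in> l" for x z
    using br_l_u[OF that(2,1)] br_antisym[of x z] by (simp add: lift_u dual_simps[OF lift_in_dual])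
  then have "in_du (- dbl (0, lift \<xi>) X)"
    using Cons.prems snd_dbl_in_dual[of "(0, lift \<xi>)" X, THEN dual_uminus]
    by (auto simp: in_du_def dbl_lift contract_u fun_Compl_def cobr_l_vanish_right lift_u)
  then show ?case by (simp add: AdI_Cons' Cons.IH)
qed (simp add: AdI_Nil)

abbreviation AdIg :: "'g \<Rightarrow> 'g functional list \<Rightarrow> 'g \<times> 'g functional" where
  "AdIg x \<equiv> AdI (x, 0)"

lemma zero_in_dual [simp]: "0 \<in> dual V"
  using dual_zero[of V] by (simp add: zero_fun_def)

lemma AdIg_snd_in_dual: "snd (AdIg x w) \<in> dual UNIV"
  by (rule AdI_snd_in_dual) simp

lemma in_dl_AdIg: "x \<in> l \<Longrightarrow> in_dl (AdIg x w)"
  and in_du_AdIg: "x \<in> u \<Longrightarrow> in_du (AdIg x w)"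
  by (rule in_dl_AdI in_du_AdI, simp add: in_dl_def in_du_def)+

lemma AdIg_add: "AdIg (x + y) w = AdIg x w + AdIg y w"
  using AdI_add[of "(x, 0)" "(y, 0)" w] by simp

lemma AdIg_scale: "AdIg (scale c x) w = dscale c (AdIg x w)"
  using AdI_dscale[of c "(x, 0)" w] by (simp add: dscale_def zero_fun_def)

lemma Ad_inverse_AdI:
  assumes "set w \<subseteq> dual l" "snd X \<in> dual UNIV"
  shows "Ad_inverse UNIV (map embed w) X = AdI X w"
  using assms
proof (induction w arbitrary: X)
  case (Cons \<xi> w)
  have d: "- double_bracket UNIV (0, embed \<xi>) X = - dbl (0, lift \<xi>) X"
    using Cons.prems by (simp add: double_bracket_UNIV embed_in_dual lift_embed)
  have "snd (- dbl (0, lift \<xi>) X) \<in> dual UNIV"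
    using dual_uminus[OF snd_dbl_in_dual] by (simp add: fun_Compl_def)
  have "Ad_inverse UNIV (map embed w) (- dbl (0, lift \<xi>) X) = AdI (- dbl (0, lift \<xi>) X) w"
    by (rule Cons.IH) (use Cons.prems(1) in simp, fact)
  then show ?case using d by (simp add: Ad_inverse_def AdI_Cons')
qed (simp add: Ad_inverse_def AdI_Nil)

lemma Ad_inverse_l_AdI: "set w \<subseteq> dual l \<Longrightarrow> Ad_inverse_l w x = AdIg x w"
  by (simp add: Ad_inverse_l_def Ad_inverse_AdI)

text \<open>Iterating \<open>double_bracket_l\<close> letter by letter identifies the adjoint action
  inside the double of \<open>l\<close> with the restriction of the one in the double of
  \<open>g\<close>.\<close>

lemma Ad_inverse_subalgebra:
  assumes "set w \<subseteq> dual l" "p \<in> l" "q \<in> dual l"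
  shows "\<exists>p' q'. p' \<in> l \<and> q' \<in> dual l \<and> Ad_inverse l w (p, q) = (p', q') \<and>
    AdI (p, embed q) w = (p', embed q')"
  using assms
proof (induction w arbitrary: p q)
  case Nil
  then show ?case by (simp add: Ad_inverse_def AdI_Nil)
next
  case (Cons \<xi> w)
  then have "\<xi> \<in> dual l" by simp
  from double_bracket_l[OF this Cons.prems(2,3)] obtain p' q' where pq:
    "p' \<in> l" "q' \<in> dual l" "double_bracket l (0, \<xi>) (p, q) = (p', q')"
    "dbl (0, lift \<xi>) (p, embed q) = (p', embed q')" .
  have "- p' \<in> l" "- q' \<in> dual l"
    using pq l_subspace dual_uminus by (auto simp: subspace_neg fun_Compl_def)
  moreover have "embed (- q') = - embed q'" by (simp add: embed_def fun_eq_iff)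
  moreover have "\<exists>p'' q''. p'' \<in> l \<and> q'' \<in> dual l \<and> Ad_inverse l w (- p', - q') = (p'', q'') \<and>
      AdI (- p', embed (- q')) w = (p'', embed q'')"
    by (rule Cons.IH) (use Cons.prems(1) in simp, fact, fact)
  ultimately show ?case using pq(3,4) by (simp add: Ad_inverse_def AdI_Cons')
qed

lemma Ad_inverse_subalgebra_snd:
  assumes "set w \<subseteq> dual l" "a \<in> l" "e \<in> l"
  shows "snd (Ad_inverse l w (a, 0)) e = snd (AdIg a w) e"
proof -
  have "embed 0 = 0" by (simp add: embed_def fun_eq_iff)
  with Ad_inverse_subalgebra[OF assms(1,2), of 0] embed_l[OF assms(3)] show ?thesis by auto
qed

section \<open>The form omega\<close>

text \<open>The values of \<open>omega\<close> before truncation to words over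
  \<open>dual l\<close>. Without truncation, and with arguments in all of \<open>g\<close>,
  inductions on words need no side conditions.\<close>

definition om :: "'g \<Rightarrow> 'g \<Rightarrow> 'g functional list \<Rightarrow> complex" where
  "om x y = conv beta (AdIg x) (AdIg y)"

lemma omega_om: "omega x y = word_function (dual l) (om x y)"
proof -
  have "om x y = (\<lambda>w. \<Sum>e\<in>basis_of UNIV. conv (*) (\<lambda>w. dual_vector UNIV e (fst (AdIg x w)))
      (\<lambda>w. snd (AdIg y w) e) w)"
  proof
    fix w
    have "beta (AdIg x u) (AdIg y v) =
      (\<Sum>e\<in>basis_of UNIV. dual_vector UNIV e (fst (AdIg x u)) * snd (AdIg y v) e)" for u v
      unfolding beta_def
      by (subst dual_expansion[OF subspace_UNIV proj_in_dual UNIV_I])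
        (simp add: AdIg_snd_in_dual mult.commute)
    note e = this
    have "om x y w = conv (\<lambda>X Y. \<Sum>e\<in>basis_of UNIV. dual_vector UNIV e (fst X) * snd Y e)
        (AdIg x) (AdIg y) w"
      unfolding om_def by (rule conv_cong) (rule e)
    then show "om x y w = (\<Sum>e\<in>basis_of UNIV. conv (*) (\<lambda>w. dual_vector UNIV e (fst (AdIg x w)))
      (\<lambda>w. snd (AdIg y w) e) w)"
      by (simp add: conv_sum
          conv_compose[of "(*)" "\<lambda>X. dual_vector UNIV e (fst X)" _ "\<lambda>X. snd X e" for e])
  qed
  moreover have "omega x y = (\<Sum>e\<in>basis_of UNIV.
     word_function (dual l) (\<lambda>w. dual_vector UNIV e (fst (AdIg x w))) *
     word_function (dual l) (\<lambda>w. snd (AdIg y w) e))"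
    unfolding omega_def
    by (intro sum.cong refl arg_cong2[where f = "(*)"] word_function_cong) (simp_all add: Ad_inverse_l_AdI)
  ultimately show ?thesis by (simp add: word_function_mult word_function_sum)
qed

lemma om_Nil: "om x y [] = 0"
  by (simp add: om_def AdI_Nil beta_def)

text \<open>The two halves of the form add up to the constant \<open>form (x, 0) (y, 0)\<close>,
  which is zero because \<open>g\<close> is isotropic.\<close>

lemma om_antisym: "om y x w = - om x y w"
proof -
  have "conv form (AdIg x) (AdIg y) w = om x y w + om y x w"
    unfolding om_def conv_swap[of beta "AdIg y"] form_beta[abs_def] by (rule conv_plus)
  moreover have "conv form (AdIg x) (AdIg y) w = 0" by (simp add: AdI_form form_def)
  ultimately show ?thesis by (simp add: add_eq_0_iff)
qed

lemma om_add: "om (x + y) z w = om x z w + om y z w"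
  unfolding om_def AdIg_add[abs_def] by (rule conv_add_left) (rule beta_simps)

lemma om_add_right: "om z (x + y) w = om z x w + om z y w"
  using om_add[of x y z w] by (simp add: om_antisym[of z])

lemma om_scale: "om (scale c x) y w = c * om x y w"
proof -
  have "conv (\<lambda>x y. c * beta x y) f g w = c * conv beta f g w" for f g
    by (induction w arbitrary: f g) (simp_all add: algebra_simps)
  moreover have "conv beta (AdIg (scale c x)) (AdIg y) w = conv (\<lambda>x y. c * beta x y) (AdIg x) (AdIg y) w"
    by (rule conv_cong) (simp add: AdIg_scale beta_dscale)
  ultimately show ?thesis unfolding om_def by simp
qed

lemma om_scale_right: "om y (scale c x) w = c * om y x w"
  using om_scale[of c x y w] by (simp add: om_antisym[of y])

lemma om_in_dual: "(\<lambda>z. om x z w) \<in> dual UNIV" "(\<lambda>z. om z x w) \<in> dual UNIV"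
  by (simp_all add: dual_UNIV_iff om_add om_add_right om_scale om_scale_right)

lemma om_l_u: "x \<in> l \<Longrightarrow> y \<in> u \<Longrightarrow> om x y w = 0"
  unfolding om_def
  by (rule conv_eq_0) (use in_dl_AdIg in_du_AdIg in \<open>auto simp: beta_def in_dl_def in_du_def\<close>)

text \<open>The left derivative of \<omega>. The bracket of a letter with \<open>x\<close> has a
  \<open>g\<close> part, which changes the argument of \<omega>, and a \<open>g*\<close> part, which
  stays in \<open>g*\<close> under the adjoint action and so contributes only a constant.\<close>

lemma om_Cons:
  "om x y (\<xi> # w) = om (contract (lift \<xi>) x) y w + om x (contract (lift \<xi>) y) w
     + (if w = [] then lift \<xi> (br x y) else 0)"
proof -
  have s: "- dbl (0, lift \<xi>) (x, 0) = (contract (lift \<xi>) x, 0) + (0, \<lambda>z. - lift \<xi> (br x z))" for x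
    by (simp add: dbl_ag fun_eq_iff)
  have A: "AdIg x (\<xi> # v) = AdIg (contract (lift \<xi>) x) v + AdI (0, \<lambda>z. - lift \<xi> (br x z)) v" for x v
    by (simp only: AdI_Cons' s AdI_add)
  let ?k = "\<lambda>x. (0, \<lambda>z. - lift \<xi> (br x z))"
  have k0: "beta (AdI (?k x) v) Y = 0" for v x Y
    by (simp add: beta_def AdI_fst_0 dual_simps[OF proj_in_dual])
  have "om x y (\<xi> # w) = conv beta (\<lambda>v. AdIg x (\<xi> # v)) (AdIg y) w + conv beta (AdIg x) (\<lambda>v. AdIg y (\<xi> # v)) w"
    by (simp add: om_def)
  also have "conv beta (\<lambda>v. AdIg x (\<xi> # v)) (AdIg y) w = om (contract (lift \<xi>) x) y w
      + conv beta (AdI (?k x)) (AdIg y) w"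
    unfolding A om_def by (rule conv_add_left) (rule beta_simps)
  also have "conv beta (AdI (?k x)) (AdIg y) w = 0" by (rule conv_eq_0) (rule k0)
  also have "conv beta (AdIg x) (\<lambda>v. AdIg y (\<xi> # v)) w = om x (contract (lift \<xi>) y) w
      + conv beta (AdIg x) (AdI (?k y)) w"
    unfolding A om_def by (rule conv_add_right) (rule beta_simps)
  \<comment> \<open>Since \<open>AdI (?k y)\<close> has no \<open>g\<close> part, the missing half
    of the form is zero; once completed to \<open>form\<close>, the convolution is evaluated by
    invariance.\<close>
  also have "conv beta (AdIg x) (AdI (?k y)) w = conv form (AdIg x) (AdI (?k y)) w"
    by (rule conv_cong) (simp add: form_beta k0)
  also have "\<dots> = (if w = [] then lift \<xi> (br x y) else 0)"
    using dual_uminus[OF dual_br_right[OF lift_in_dual]]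
    by (simp add: AdI_form form_def br_antisym[of y x] dual_simps[OF lift_in_dual])
  finally show ?thesis by simp
qed

text \<open>The right derivative of \<omega>. Here the new letter acts last, on the values of
  \<open>Ad(x^-1)\<close>. The cobracket terms of the two arguments cancel, and only the letter
  evaluated on the bracket of the \<open>g\<close> parts remains.\<close>

lemma om_snoc:
  "om x y (w @ [\<xi>]) = conv (\<lambda>X Y. lift \<xi> (br (fst X) (fst Y))) (AdIg x) (AdIg y) w"
proof -
  have "om x y (w @ [\<xi>]) = conv (\<lambda>X Y. beta (- dbl (0, lift \<xi>) X) Y) (AdIg x) (AdIg y) w
      + conv (\<lambda>X Y. beta X (- dbl (0, lift \<xi>) Y)) (AdIg x) (AdIg y) w"
    unfolding om_def conv_snoc AdI_snoc
    by (simp add: conv_compose[of beta "\<lambda>Y. - dbl (0, lift \<xi>) Y" _ "\<lambda>Y. Y"]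
        conv_compose[of beta "\<lambda>Y. Y" _ "\<lambda>Y. - dbl (0, lift \<xi>) Y"])
  also have "\<dots> = conv (\<lambda>X Y. lift \<xi> (br (fst X) (fst Y))) (AdIg x) (AdIg y) w"
    unfolding conv_plus[symmetric]
  proof (rule conv_cong)
    fix v v' :: "'g functional list"
    let ?X = "AdIg x v" and ?Y = "AdIg y v'"
    have "snd (- dbl (0, lift \<xi>) ?Y) \<in> dual UNIV"
      using dual_uminus[OF snd_dbl_in_dual] by (simp add: fun_Compl_def)
    then show "beta (- dbl (0, lift \<xi>) ?X) ?Y + beta ?X (- dbl (0, lift \<xi>) ?Y) = lift \<xi> (br (fst ?X) (fst ?Y))"
      using AdIg_snd_in_dual
      by (simp add: beta_def dbl_lift dual_contract br_antisym[of "fst ?Y"] dual_simps[OF lift_in_dual])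
  qed
  finally show ?thesis .
qed

lemma om_dress:
  assumes "a \<in> l" "x \<in> u" "y \<in> u"
  shows "(\<Sum>e\<in>basis_of l. conv (*) (\<lambda>w. snd (AdIg a w) e) (\<lambda>w. om x y (w @ [dual_vector l e])) w)
    = - (om (br a x) y w + om x (br a y) w)"
proof -
  let ?t = "\<lambda>A X Y. snd A (br (fst X) (fst Y))"
  have "conv (*) (\<lambda>w. snd (AdIg a w) e) (\<lambda>w. om x y (w @ [dual_vector l e])) w
    = conv3 (\<lambda>A X Y. snd A e * lift (dual_vector l e) (br (fst X) (fst Y))) (AdIg a) (AdIg x) (AdIg y) w" for e
    unfolding om_snoc
    by (subst conv_conv_right)
      (simp_all add: distrib_left conv3_compose_left[of _ "\<lambda>A. snd A e"])
  then have "(\<Sum>e\<in>basis_of l. conv (*) (\<lambda>w. snd (AdIg a w) e) (\<lambda>w. om x y (w @ [dual_vector l e])) w)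
    = conv3 (\<lambda>A X Y. \<Sum>e\<in>basis_of l. snd A e * lift (dual_vector l e) (br (fst X) (fst Y)))
        (AdIg a) (AdIg x) (AdIg y) w"
    by (simp add: conv3_sum)
  also have "\<dots> = conv3 (\<lambda>A X Y. - (beta (dbl A X) Y + beta X (dbl A Y))) (AdIg a) (AdIg x) (AdIg y) w"
  proof (rule conv3_cong)
    fix v1 v2 v3 :: "'g functional list"
    let ?A = "AdIg a v1" and ?X = "AdIg x v2" and ?Y = "AdIg y v3"
    have A: "in_dl ?A" and X: "in_du ?X" and Y: "in_du ?Y"
      using assms by (simp_all add: in_dl_AdIg in_du_AdIg)
    let ?z = "br (fst ?X) (fst ?Y)"
    \<comment> \<open>For \<open>a\<close> in \<open>l\<close> the functional vanishes on
      \<open>u\<close>, which is why a sum over a basis of \<open>l\<close> recovers its full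
      value.\<close>
    have "snd ?A ?z = snd ?A (l_part ?z)"
      using A dual_simps(1)[of "snd ?A" "l_part ?z" "?z - l_part ?z"] l_part(2)
      by (simp add: in_dl_def)
    also have "\<dots> = (\<Sum>e\<in>basis_of l. snd ?A e * dual_vector l e (l_part ?z))"
    proof -
      \<comment> \<open>Elements of \<open>dual l\<close> are zero outside \<open>l\<close> by
        convention, so the functional is truncated before it is expanded.\<close>
      let ?r = "\<lambda>x. if x \<in> l then snd ?A x else 0"
      have "?r \<in> dual l" using A l_subspace
        by (simp add: dual_def[of l] in_dl_def dual_simps subspace_add subspace_scale)
      from dual_expansion[OF l_subspace this l_part(1)] show ?thesis
        using l_part(1) basis_of(1)[OF l_subspace]
        by (simp add: subset_iff)
    qed
    also have "\<dots> = (\<Sum>e\<in>basis_of l. snd ?A e * lift (dual_vector l e) ?z)"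
      by (simp add: lift_embed dual_vector_in_dual[OF l_subspace] embed_def)
    finally have e: "(\<Sum>e\<in>basis_of l. snd ?A e * lift (dual_vector l e) ?z) = snd ?A ?z" ..
    have "\<delta> (fst ?A) (snd ?X) (snd ?Y) = 0"
      using A X by (intro cobr_l_vanish) (auto simp: in_dl_def in_du_def)
    moreover have "proj (snd (dbl ?A ?Y)) = snd (dbl ?A ?Y)" by (simp add: snd_dbl_in_dual)
    ultimately have "beta (dbl ?A ?X) ?Y + beta ?X (dbl ?A ?Y) = - snd ?A ?z"
      using A X Y by (simp add: beta_def in_dl_def in_du_def dbl_def dual_simps dual_contract
          br_antisym[of "fst ?Y"])
    then show "(\<Sum>e\<in>basis_of l. snd ?A e * lift (dual_vector l e) ?z)
      = - (beta (dbl ?A ?X) ?Y + beta ?X (dbl ?A ?Y))" using e by simp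
  qed
  also have "\<dots> = - (om (br a x) y w + om x (br a y) w)"
  proof -
    have "conv3 (\<lambda>A X Y. beta (dbl A X) Y) (AdIg a) (AdIg x) (AdIg y) w = om (br a x) y w"
      unfolding om_def dbl_gg[symmetric] AdI_dbl[abs_def]
      by (rule conv_conv_left[symmetric]) (rule beta_simps)
    moreover have "conv3 (\<lambda>A X Y. beta X (dbl A Y)) (AdIg a) (AdIg x) (AdIg y) w = om x (br a y) w"
      unfolding om_def dbl_gg[symmetric] AdI_dbl[abs_def] conv3_swap[of _ "AdIg a"]
      by (rule conv_conv_right[symmetric]) (rule beta_simps)
    ultimately show ?thesis by (simp only: conv3_minus conv3_plus)
  qed
  finally show ?thesis .
qed

text \<open>
  \<open>graph x\<close> is \<open>x + \<omega>(x, -)\<close>. These elements span the Lagrangian subalgebra \<open>Ad(x)(g)\<close> of the double,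
  so \<open>\<langle>[-, -], -\<rangle>\<close> vanishes on them.
\<close>

definition graph :: "'g \<Rightarrow> 'g functional list \<Rightarrow> 'g \<times> 'g functional" where
  "graph x w = (if w = [] then x else 0, \<lambda>z. om x z w)"

text \<open>A differential equation for the graphs. The first summand only moves the graph within
  the family; the second is the adjoint action of the letter.\<close>

lemma graph_Cons: "graph x (\<xi> # w) = graph (contract (lift \<xi>) x) w + dbl (0, lift \<xi>) (graph x w)"
proof -
  have "\<delta> z (lift \<xi>) (\<lambda>z. om x z w) = om x (contract (lift \<xi>) z) w" for z
    using dual_contract[OF om_in_dual(1)[of x w], of "lift \<xi>" z] by simp
  moreover have "snd (graph x w) \<in> dual UNIV" by (simp add: graph_def om_in_dual)
  ultimately show ?thesis
    by (auto simp: dbl_lift) (auto simp: graph_def om_Cons contract_0 br_simps dual_simps fun_eq_iff)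
qed

lemma form3_add: "form3 (X + X') Y Z = form3 X Y Z + form3 X' Y Z"
  by (simp add: form3_def dbl_simps form_simps)

text \<open>At the empty word the graphs are elements of \<open>g\<close>, an isotropic subalgebra.
  For a longer word, the terms that move within the family vanish by induction, and the adjoint
  terms sum to zero by \<open>form3_invariant\<close>.\<close>

lemma graph_isotropic: "conv3 form3 (graph x) (graph y) (graph z) w = 0"
proof (induction w arbitrary: x y z)
  case Nil
  have "(\<lambda>z. 0) = (0 :: 'g functional)" by (simp add: zero_fun_def)
  then show ?case
    by (simp add: graph_def om_Nil form3_formula) (simp add: zero_fun_def cobr_zero_functional)
next
  case (Cons \<xi> w)
  let ?c = "contract (lift \<xi>)" and ?d = "dbl (0, lift \<xi>)"
  have 1: "conv3 form3 (\<lambda>v. graph x (\<xi> # v)) (graph y) (graph z) w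
      = conv3 (\<lambda>X Y Z. form3 (?d X) Y Z) (graph x) (graph y) (graph z) w" for x y z
    unfolding graph_Cons
    by (subst conv3_left_add) (simp_all add: form3_add Cons conv3_compose_left)
  \<comment> \<open>The second and third positions follow from the first by cyclic symmetry of
    \<open>form3\<close>.\<close>
  have 2: "conv3 form3 (graph x) (\<lambda>v. graph y (\<xi> # v)) (graph z) w
      = conv3 (\<lambda>X Y Z. form3 X (?d Y) Z) (graph x) (graph y) (graph z) w"
  proof -
    have "(\<lambda>y z x. form3 x y z) = form3" by (intro ext) (metis form3_rotate)
    then have "conv3 form3 (graph x) (\<lambda>v. graph y (\<xi> # v)) (graph z) w
       = conv3 (\<lambda>Y Z X. form3 (?d Y) Z X) (graph y) (graph z) (graph x) w"
      unfolding conv3_rotate[of form3 "graph x"] by (simp add: 1)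
    also have "\<dots> = conv3 (\<lambda>X Y Z. form3 (?d Y) Z X) (graph x) (graph y) (graph z) w"
      by (simp add: conv3_rotate[of _ "graph x"])
    finally show ?thesis by (simp add: form3_rotate[of _ "?d _", symmetric])
  qed
  have 3: "conv3 form3 (graph x) (graph y) (\<lambda>v. graph z (\<xi> # v)) w
      = conv3 (\<lambda>X Y Z. form3 X Y (?d Z)) (graph x) (graph y) (graph z) w"
  proof -
    have "(\<lambda>z x y. form3 x y z) = form3" by (intro ext) (metis form3_rotate)
    then have "conv3 form3 (graph x) (graph y) (\<lambda>v. graph z (\<xi> # v)) w
       = conv3 (\<lambda>Z X Y. form3 (?d Z) X Y) (graph z) (graph x) (graph y) w"
      unfolding conv3_rotate[of form3 "graph x"] conv3_rotate[of _ "graph y"] by (simp add: 1)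
    also have "\<dots> = conv3 (\<lambda>X Y Z. form3 (?d Z) X Y) (graph x) (graph y) (graph z) w"
      by (simp add: conv3_rotate[of _ "graph z"])
    finally show ?thesis by (simp add: form3_rotate[of "?d _"])
  qed
  have "conv3 form3 (graph x) (graph y) (graph z) (\<xi> # w) =
    conv3 (\<lambda>X Y Z. form3 (?d X) Y Z + form3 X (?d Y) Z + form3 X Y (?d Z)) (graph x) (graph y) (graph z) w"
    by (simp only: conv3.simps 1 2 3 conv3_plus)
  also have "\<dots> = 0" by (rule conv3_eq_0) (rule form3_invariant)
  finally show ?case .
qed

text \<open>This is \<open>graph_isotropic\<close> expanded by \<open>form3_formula\<close>. The
  \<open>g\<close> parts of the graphs are constant functions, so three of the six terms contain no
  product of functions and the others contain one.\<close>

lemma om_lagrangian: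
  "om x (br y z) w + om y (br z x) w + om z (br x y) w
   + conv (\<delta> x) (\<lambda>v t. om y t v) (\<lambda>v t. om z t v) w
   + conv (\<delta> y) (\<lambda>v t. om z t v) (\<lambda>v t. om x t v) w
   + conv (\<delta> z) (\<lambda>v t. om x t v) (\<lambda>v t. om y t v) w = 0"
proof -
  let ?A = "\<lambda>X Y Z. proj (snd Z) (br (fst X) (fst Y))"
  let ?B = "\<lambda>X Y Z. \<delta> (fst X) (proj (snd Y)) (proj (snd Z))"
  have A: "conv3 ?A (graph x) (graph y) (graph z) w = om z (br x y) w" for x y z
  proof -
    have "conv3 ?A (graph x) (graph y) (graph z) w
      = conv3 (\<lambda>x y f. proj f (br x y)) (\<lambda>v. fst (graph x v)) (\<lambda>v. fst (graph y v)) (\<lambda>v. snd (graph z v)) w"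
      by (rule conv3_compose[symmetric])
    also have "\<dots> = proj (\<lambda>t. om z t w) (br x y)"
      unfolding graph_def fst_conv snd_conv
      by (rule conv3_unit2) (simp_all add: br_simps dual_simps(3)[OF proj_in_dual])
    finally show ?thesis by (simp add: om_in_dual)
  qed
  have B: "conv3 ?B (graph x) (graph y) (graph z) w = conv (\<delta> x) (\<lambda>v t. om y t v) (\<lambda>v t. om z t v) w"
    for x y z
  proof -
    have "conv3 ?B (graph x) (graph y) (graph z) w
      = conv3 (\<lambda>x f g. \<delta> x (proj f) (proj g)) (\<lambda>v. fst (graph x v)) (\<lambda>v. snd (graph y v)) (\<lambda>v. snd (graph z v)) w"
      by (rule conv3_compose[symmetric])
    also have "\<dots> = conv (\<lambda>f g. \<delta> x (proj f) (proj g)) (\<lambda>v t. om y t v) (\<lambda>v t. om z t v) w"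
      unfolding graph_def fst_conv snd_conv by (rule conv3_unit1) (rule cobr_zero)
    also have "\<dots> = conv (\<delta> x) (\<lambda>v t. om y t v) (\<lambda>v t. om z t v) w"
      by (rule conv_cong) (simp add: om_in_dual)
    finally show ?thesis .
  qed
  have "0 = conv3 (\<lambda>X Y Z. ?A X Y Z + ?A Y Z X + ?A Z X Y + ?B X Y Z + ?B Y Z X + ?B Z X Y)
      (graph x) (graph y) (graph z) w"
    using graph_isotropic[of x y z w] unfolding form3_formula[abs_def] by simp
  also have "\<dots> = conv3 ?A (graph x) (graph y) (graph z) w + conv3 ?A (graph y) (graph z) (graph x) w
    + conv3 ?A (graph z) (graph x) (graph y) w + conv3 ?B (graph x) (graph y) (graph z) w
    + conv3 ?B (graph y) (graph z) (graph x) w + conv3 ?B (graph z) (graph x) (graph y) w"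
    unfolding conv3_plus conv3_rotate[of _ "graph x" "graph y"] conv3_rotate[of "\<lambda>Y Z X. _ Z X Y" "graph y"]
    by (simp only: conv3_rotate[of "\<lambda>X Y Z. _ Z X Y" "graph y"] conv3_rotate[of "\<lambda>X Y Z. _ Z X Y" "graph z"])
  also have "\<dots> = om z (br x y) w + om x (br y z) w + om y (br z x) w
   + conv (\<delta> x) (\<lambda>v t. om y t v) (\<lambda>v t. om z t v) w
   + conv (\<delta> y) (\<lambda>v t. om z t v) (\<lambda>v t. om x t v) w
   + conv (\<delta> z) (\<lambda>v t. om x t v) (\<lambda>v t. om y t v) w" by (simp only: A B)
  finally show ?thesis by (simp only: ac_simps)
qed

section \<open>Omega as a matrix of formal functions\<close>

lemma dual_l_closed:
  "\<phi> \<in> dual l \<Longrightarrow> \<psi> \<in> dual l \<Longrightarrow> \<phi> + \<psi> \<in> dual l"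
  "\<phi> \<in> dual l \<Longrightarrow> (\<lambda>x. c * \<phi> x) \<in> dual l"
  using dual_add[of \<phi> l \<psi>] dual_scale[of \<phi> l c] by (simp_all add: plus_fun_def)

interpretation dl: letters "\<lambda>c \<phi> x. c * \<phi> x" "dual l" "dual_bracket l"
  by unfold_locales (simp_all add: dual_l_closed dual_bracket_in_dual)

lemmas dual_l_FF =
  dl.FF_mult[folded dual_group_functions_def] dl.FF_sum[folded dual_group_functions_def]
  dl.FF_det[folded dual_group_functions_def] dl.FF_wconst[folded dual_group_functions_def]

text \<open>Matrix coefficients of a representation are functions on the formal group; here the
  representation is the adjoint one of \<open>l*\<close> on the double.\<close>

lemma AdI_in_dual_group_functions:
  assumes add: "\<And>X Y. h (X + Y) = h X + h Y" and scale: "\<And>c X. h (dscale c X) = c * h X"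
  shows "word_function (dual l) (\<lambda>w. h (AdI X w)) \<in> dual_group_functions l"
  unfolding dual_group_functions_def
proof (rule dl.FF_I)
  have "additive h" by (simp add: additive_def add)
  note h = add additive.minus[OF this] additive.diff[OF this]
  note hA = AdI_append[of X] AdI_Cons AdI_add AdI_uminus AdI_diff h
  let ?L = "\<lambda>\<xi>. (0 :: 'g, lift \<xi>)"
  fix p q :: "'g functional list" assume pq: "set p \<subseteq> dual l" "set q \<subseteq> dual l"
  fix x y c assume x: "x \<in> dual l"
  have "?L (\<lambda>z. c * x z) = dscale c (?L x)" by (simp add: lift_scale dscale_def)
  then show "wcoeff (word_function (dual l) (\<lambda>w. h (AdI X w))) (p @ [\<lambda>z. c * x z] @ q)
    = c * wcoeff (word_function (dual l) (\<lambda>w. h (AdI X w))) (p @ [x] @ q)"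
    using pq x by (simp add: wcoeff_word_function dual_l_closed hA dbl_dscale AdI_dscale scale)
  assume y: "y \<in> dual l"
  have "?L (x + y) = ?L x + ?L y" by (simp add: lift_add fun_eq_iff)
  then have "dbl (?L (x + y)) Y = dbl (?L x) Y + dbl (?L y) Y" for Y by (simp only: dbl_simps)
  then show "wcoeff (word_function (dual l) (\<lambda>w. h (AdI X w))) (p @ [x + y] @ q)
    = wcoeff (word_function (dual l) (\<lambda>w. h (AdI X w))) (p @ [x] @ q)
      + wcoeff (word_function (dual l) (\<lambda>w. h (AdI X w))) (p @ [y] @ q)"
    using pq x y by (simp add: wcoeff_word_function dual_l_closed hA dbl_simps)
  let ?Y = "AdI X p"
  \<comment> \<open>Because of the inversion, the word \<open>[x, y]\<close> acts by
    \<open>ad y\<close> after \<open>ad x\<close>. The difference with the opposite order is minus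
    \<open>ad\<close> of the bracket, which is exactly how a single letter acts.\<close>
  have "dbl (?L x) (?L y) = ?L (dual_bracket l x y)"
    using x y by (simp add: dbl_aa lift_embed dual_bracket_in_dual embed_dual_bracket embed_in_dual)
  then have "dbl (?L x) (dbl (?L y) ?Y) = dbl (?L (dual_bracket l x y)) ?Y + dbl (?L y) (dbl (?L x) ?Y)"
    using dbl_derivation[of "?L x" "?L y" ?Y] by simp
  then show "wcoeff (word_function (dual l) (\<lambda>w. h (AdI X w))) (p @ [x, y] @ q)
      - wcoeff (word_function (dual l) (\<lambda>w. h (AdI X w))) (p @ [y, x] @ q)
    = wcoeff (word_function (dual l) (\<lambda>w. h (AdI X w))) (p @ [dual_bracket l x y] @ q)"
    using pq x y
    by (simp add: wcoeff_word_function dual_bracket_in_dual hA dbl_simps)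
qed (simp add: word_function_def)

lemma omega_in_dual_group_functions: "omega x y \<in> dual_group_functions l"
proof -
  have "omega x y = (\<Sum>e\<in>basis_of UNIV.
     word_function (dual l) (\<lambda>w. dual_vector UNIV e (fst (AdIg x w))) *
     word_function (dual l) (\<lambda>w. snd (AdIg y w) e))"
    unfolding omega_def
    by (intro sum.cong refl arg_cong2[where f = "(*)"] word_function_cong) (simp_all add: Ad_inverse_l_AdI)
  also have "\<dots> \<in> dual_group_functions l"
    by (intro dual_l_FF(1,2) AdI_in_dual_group_functions)
      (simp_all add: dscale_def dual_simps[OF dual_vector_in_dual[OF subspace_UNIV]])
  finally show ?thesis .
qed

lemma omega_antisym: "omega y x = - omega x y"
  unfolding omega_om word_function_uminus by (rule word_function_cong) (rule om_antisym)

lemma omega_add: "omega (x + y) z = omega x z + omega y z"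
  by (simp add: omega_om word_function_add om_add[abs_def])

lemma omega_scale: "omega (scale c x) y = wconst c * omega x y"
  by (rule wfun_eqI) (simp add: omega_om wcoeff_wconst_mult word_function_def om_scale)

lemma omega_zero: "omega 0 y = 0"
  using omega_scale[of 0 0 y] by (simp add: wconst_simps)

lemma omega_expansion: "x \<in> u \<Longrightarrow> omega x y = (\<Sum>e\<in>basis_of u. wconst (u_coord e x) * omega e y)"
proof -
  assume x: "x \<in> u"
  have "omega (\<Sum>e\<in>I. f e) y = (\<Sum>e\<in>I. omega (f e) y)" for I :: "'g set" and f
    by (induction I rule: infinite_finite_induct) (simp_all add: omega_zero omega_add)
  then show ?thesis by (subst u_expansion[OF x]) (simp add: omega_scale)
qed

lemma omega_l_u: "x \<in> l \<Longrightarrow> y \<in> u \<Longrightarrow> omega x y = 0"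
  by (rule wfun_eqI) (simp add: omega_om word_function_def om_l_u)

text \<open>Since \<omega> vanishes at the identity, only the constant of \<open>om_Cons\<close>
  survives. Nondegeneracy of the splitting is a statement about this term.\<close>

lemma omega_linear_term:
  "wcoeff (omega x y) [] = 0"
  "\<xi> \<in> dual l \<Longrightarrow> wcoeff (omega x y) [\<xi>] = \<xi> (l_part (br x y))"
  by (simp_all add: omega_om word_function_def om_Nil om_Cons lift_embed embed_def)

lemma L_der_omega:
  assumes "\<xi> \<in> dual l"
  shows "L_der \<xi> (omega x y) = - omega (contract (embed \<xi>) x) y - omega x (contract (embed \<xi>) y)
    - wconst (embed \<xi> (br x y))"
  using assms
  by (intro wfun_eqI)
    (auto simp: omega_om L_der_def om_Cons lift_embed word_function_def wconst_def)

lemma dress_omega: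
  assumes "a \<in> l" "x \<in> u" "y \<in> u"
  shows "dress l a (omega x y) = omega (br a x) y + omega x (br a y)"
proof -
  have "dress l a (omega x y) = - (\<Sum>e\<in>basis_of l.
     word_function (dual l) (\<lambda>w. snd (AdIg a w) e) *
     word_function (dual l) (\<lambda>w. om x y (w @ [dual_vector l e])))"
    unfolding dress_def omega_om
    using assms(1) basis_of(1)[OF l_subspace]
    by (intro arg_cong[where f = uminus] sum.cong refl arg_cong2[where f = "(*)"] word_function_cong
        Ad_inverse_subalgebra_snd R_der_word_function dual_vector_in_dual l_subspace) auto
  then show ?thesis
    unfolding word_function_mult word_function_sum om_dress[OF assms] omega_om
    by (simp add: word_function_uminus word_function_add add.commute)
qed

lemma omega_lagrangian:
  assumes "x \<in> u" "y \<in> u" "z \<in> u"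
  defines "B \<equiv> basis_of u"
  defines "q \<equiv> \<lambda>x y z. \<Sum>i\<in>B. \<Sum>j\<in>B. wconst (\<delta> x (u_coord i) (u_coord j)) * (omega y i * omega z j)"
  shows "omega x (br y z) + omega y (br z x) + omega z (br x y) + q x y z + q y z x + q z x y = 0"
proof -
  have q: "q x y z = word_function (dual l) (conv (\<delta> x) (\<lambda>v t. om y t v) (\<lambda>v t. om z t v))"
    if "x \<in> u" "y \<in> u" "z \<in> u" for x y z
  proof -
    \<comment> \<open>For \<open>y\<close> in \<open>u\<close> the functional \<omega>(y, -)
      vanishes on \<open>l\<close>, so it is expanded in the coordinates of \<open>u\<close>
      alone.\<close>
    have e: "(\<lambda>t. om y t v) = (\<lambda>t. \<Sum>i\<in>B. om y i v * u_coord i t)" if "y \<in> u" for y v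
    proof
      fix t show "om y t v = (\<Sum>i\<in>B. om y i v * u_coord i t)"
        using dual_split[OF om_in_dual(1)[of y v], of t] om_l_u[OF l_part(1) that, of t v]
        by (simp add: B_def om_antisym[of y "l_part t"])
    qed
    have "\<delta> x (\<lambda>t. om y t v) (\<lambda>t. om z t v') =
      (\<Sum>i\<in>B. \<Sum>j\<in>B. \<delta> x (u_coord i) (u_coord j) * (om y i v * om z j v'))" for v v'
      by (subst e[OF that(2)], subst e[OF that(3)])
        (simp only: cobr_sum_left[OF u_coord_in_dual] cobr_sum_right[OF u_coord_in_dual]
          sum_distrib_left, simp only: mult_ac)
    then have "conv (\<delta> x) (\<lambda>v t. om y t v) (\<lambda>v t. om z t v) w
      = conv (\<lambda>f g. \<Sum>i\<in>B. \<Sum>j\<in>B. \<delta> x (u_coord i) (u_coord j) * (f i * g j)) (\<lambda>v t. om y t v) (\<lambda>v t. om z t v) w" for w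
      by (intro conv_cong)
    also have "\<dots> w = (\<Sum>i\<in>B. \<Sum>j\<in>B. \<delta> x (u_coord i) (u_coord j) * conv (*) (om y i) (om z j) w)" for w
    proof -
      have "conv (\<lambda>f g. c * (f i * g j)) F G w = c * conv (*) (\<lambda>v. F v i) (\<lambda>v. G v j) w"
        for c i j and F G :: "'g functional list \<Rightarrow> 'g \<Rightarrow> complex"
        by (induction w arbitrary: F G) (simp_all add: distrib_left)
      then show ?thesis by (simp add: conv_sum)
    qed
    finally have c: "conv (\<delta> x) (\<lambda>v t. om y t v) (\<lambda>v t. om z t v) =
      (\<lambda>w. \<Sum>i\<in>B. \<Sum>j\<in>B. \<delta> x (u_coord i) (u_coord j) * conv (*) (om y i) (om z j) w)" by (rule ext)
    have "wconst c * word_function (dual l) F = word_function (dual l) (\<lambda>w. c * F w)" for c F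
      by (rule wfun_eqI) (simp add: wcoeff_wconst_mult word_function_def)
    then show ?thesis
      unfolding c q_def omega_om word_function_mult by (simp add: word_function_sum)
  qed
  show ?thesis
    unfolding q[OF assms(1,2,3)] q[OF assms(2,3,1)] q[OF assms(3,1,2)] omega_om word_function_add
      om_lagrangian word_function_zero ..
qed

end

section \<open>Inverses of skew-symmetric matrices\<close>

text \<open>As matrices, \<open>W\<close> times the transpose of \<open>s\<close> is the identity.
  This is the shape in which the defining equation of \<sigma> arrives; \<open>W\<close> will be
  \<omega> and \<open>D\<close> below a derivative on fractions.\<close>

locale skew_inverse =
  fixes I :: "'i set" and W s :: "'i \<Rightarrow> 'i \<Rightarrow> 'k::field"
  assumes finite_I: "finite I"
    and W_skew: "i \<in> I \<Longrightarrow> j \<in> I \<Longrightarrow> W j i = - W i j"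
    and W_s: "i \<in> I \<Longrightarrow> k \<in> I \<Longrightarrow> (\<Sum>j\<in>I. W k j * s i j) = (if i = k then 1 else 0)"
begin

lemma sum_unit:
  assumes "i \<in> I"
  shows "(\<Sum>j\<in>I. (if i = j then 1 else 0) * f j) = (f i :: 'k)" "(\<Sum>j\<in>I. (if j = i then 1 else 0) * f j) = f i"
proof -
  have "(\<Sum>j\<in>I. (if i = j then 1 else 0) * f j) = (\<Sum>j\<in>I. if i = j then f j else 0)"
    by (rule sum.cong) simp_all
  then show "(\<Sum>j\<in>I. (if i = j then 1 else 0) * f j) = f i" using finite_I assms by simp
  then show "(\<Sum>j\<in>I. (if j = i then 1 else 0) * f j) = f i" by (simp add: eq_commute[of _ i])
qed

text \<open>The usual comparison of a left with a right inverse, with a transposition supplied by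
  the skewness of \<open>W\<close>. Taking \<open>s\<close> for \<open>s'\<close> gives skewness of
  \<open>s\<close>; using it for a second solution gives uniqueness of \<sigma>.\<close>

lemma s_eqI:
  assumes s': "\<And>i k. i \<in> I \<Longrightarrow> k \<in> I \<Longrightarrow> (\<Sum>j\<in>I. W k j * s' i j) = (if i = k then 1 else 0)"
    and i: "i \<in> I" and m: "m \<in> I"
  shows "s' i m = - s m i"
proof -
  have "s' i m = (\<Sum>j\<in>I. (if m = j then 1 else 0) * s' i j)" by (simp add: sum_unit m)
  also have "\<dots> = (\<Sum>j\<in>I. (\<Sum>k\<in>I. W j k * s m k) * s' i j)"
    by (intro sum.cong refl) (simp add: W_s m)
  also have "\<dots> = (\<Sum>k\<in>I. (\<Sum>j\<in>I. W j k * s' i j) * s m k)"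
    by (simp add: sum_distrib_left sum_distrib_right mult_ac) (rule sum.swap)
  also have "\<dots> = (\<Sum>k\<in>I. - (\<Sum>j\<in>I. W k j * s' i j) * s m k)"
  proof (intro sum.cong refl arg_cong2[where f = "(*)"])
    fix k assume "k \<in> I"
    then show "(\<Sum>j\<in>I. W j k * s' i j) = - (\<Sum>j\<in>I. W k j * s' i j)"
      unfolding sum_negf[symmetric] by (intro sum.cong refl) (simp add: W_skew[of k])
  qed
  also have "\<dots> = (\<Sum>k\<in>I. - ((if i = k then 1 else 0) * s m k))"
    by (intro sum.cong refl) (simp add: s' i)
  also have "\<dots> = - (\<Sum>k\<in>I. (if i = k then 1 else 0) * s m k)" by (rule sum_negf)
  also have "\<dots> = - s m i" by (simp add: sum_unit i)
  finally show ?thesis .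
qed

lemma s_skew: "i \<in> I \<Longrightarrow> m \<in> I \<Longrightarrow> s i m = - s m i"
  by (rule s_eqI) (rule W_s)

lemma s_W: "i \<in> I \<Longrightarrow> k \<in> I \<Longrightarrow> (\<Sum>j\<in>I. W j k * s j i) = (if i = k then 1 else 0)"
proof -
  assume ik: "i \<in> I" "k \<in> I"
  have "(\<Sum>j\<in>I. W j k * s j i) = (\<Sum>j\<in>I. W k j * s i j)"
    by (intro sum.cong refl) (simp add: W_skew[of k] s_skew[of _ i] ik)
  then show ?thesis using W_s ik by simp
qed

context
  fixes D :: "'k \<Rightarrow> 'k" assumes D: "derivation D"
begin

text \<open>Differentiate the relation \<open>W_s\<close> and multiply by the inverse.\<close>

lemma derivation_s:
  assumes i: "i \<in> I" and m: "m \<in> I"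
  shows "D (s i m) = - (\<Sum>k\<in>I. \<Sum>j\<in>I. s k m * D (W k j) * s i j)"
proof -
  have *: "(\<Sum>j\<in>I. W k j * D (s i j)) = - (\<Sum>j\<in>I. D (W k j) * s i j)" if "k \<in> I" for k
  proof -
    have "D (\<Sum>j\<in>I. W k j * s i j) = 0"
      using W_s[OF i that] by (simp add: derivation_0[OF D] derivation_1[OF D])
    then show ?thesis
      by (simp add: derivation_sum[OF D] derivation_mult[OF D] sum.distrib add_eq_0_iff)
  qed
  have "D (s i m) = (\<Sum>j\<in>I. (if m = j then 1 else 0) * D (s i j))" by (simp add: sum_unit m)
  also have "\<dots> = (\<Sum>j\<in>I. (\<Sum>k\<in>I. W k j * s k m) * D (s i j))"
    by (intro sum.cong refl) (simp add: s_W m)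
  also have "\<dots> = (\<Sum>k\<in>I. s k m * (\<Sum>j\<in>I. W k j * D (s i j)))"
    by (simp add: sum_distrib_left sum_distrib_right mult_ac) (rule sum.swap)
  also have "\<dots> = (\<Sum>k\<in>I. s k m * - (\<Sum>j\<in>I. D (W k j) * s i j))"
    by (intro sum.cong refl) (simp add: *)
  also have "\<dots> = - (\<Sum>k\<in>I. \<Sum>j\<in>I. s k m * D (W k j) * s i j)"
    by (simp add: sum_negf sum_distrib_left mult_ac)
  finally show ?thesis .
qed

text \<open>When the derivative of \<open>W\<close> is a matrix times \<open>W\<close>, one of the
  two copies of \<open>s\<close> around it cancels.\<close>

lemma derivation_s_sandwich:
  assumes "i \<in> I" "m \<in> I"
  shows "(\<Sum>k\<in>I. \<Sum>j\<in>I. s k m * (\<Sum>r\<in>I. \<alpha> k r * W r j) * s i j) = (\<Sum>k\<in>I. \<alpha> k i * s k m)"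
    "(\<Sum>k\<in>I. \<Sum>j\<in>I. s k m * (\<Sum>r\<in>I. \<alpha> j r * W k r) * s i j) = (\<Sum>j\<in>I. \<alpha> j m * s i j)"
proof -
  have "(\<Sum>k\<in>I. \<Sum>j\<in>I. s k m * (\<Sum>r\<in>I. \<alpha> k r * W r j) * s i j)
     = (\<Sum>k\<in>I. s k m * (\<Sum>r\<in>I. (\<Sum>j\<in>I. W r j * s i j) * \<alpha> k r))"
    by (simp add: sum_distrib_left sum_distrib_right mult_ac) (intro sum.cong refl sum.swap)
  also have "\<dots> = (\<Sum>k\<in>I. s k m * (\<Sum>r\<in>I. (if i = r then 1 else 0) * \<alpha> k r))"
    by (intro sum.cong refl arg_cong2[where f = "(*)"]) (simp_all add: W_s assms)
  also have "\<dots> = (\<Sum>k\<in>I. s k m * \<alpha> k i)" by (simp only: sum_unit(1)[OF assms(1)])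
  also have "\<dots> = (\<Sum>k\<in>I. \<alpha> k i * s k m)" by (simp only: mult.commute)
  finally show "(\<Sum>k\<in>I. \<Sum>j\<in>I. s k m * (\<Sum>r\<in>I. \<alpha> k r * W r j) * s i j) = (\<Sum>k\<in>I. \<alpha> k i * s k m)" .
  have "(\<Sum>k\<in>I. \<Sum>j\<in>I. s k m * (\<Sum>r\<in>I. \<alpha> j r * W k r) * s i j)
     = (\<Sum>j\<in>I. \<Sum>k\<in>I. s k m * (\<Sum>r\<in>I. \<alpha> j r * W k r) * s i j)" by (rule sum.swap)
  also have "\<dots> = (\<Sum>j\<in>I. s i j * (\<Sum>r\<in>I. (\<Sum>k\<in>I. W k r * s k m) * \<alpha> j r))"
    by (simp add: sum_distrib_left sum_distrib_right mult_ac) (intro sum.cong refl sum.swap)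
  also have "\<dots> = (\<Sum>j\<in>I. s i j * (\<Sum>r\<in>I. (if m = r then 1 else 0) * \<alpha> j r))"
    by (intro sum.cong refl arg_cong2[where f = "(*)"]) (simp_all add: s_W assms)
  also have "\<dots> = (\<Sum>j\<in>I. s i j * \<alpha> j m)" by (simp only: sum_unit(1)[OF assms(2)])
  also have "\<dots> = (\<Sum>j\<in>I. \<alpha> j m * s i j)" by (simp only: mult.commute)
  finally show "(\<Sum>k\<in>I. \<Sum>j\<in>I. s k m * (\<Sum>r\<in>I. \<alpha> j r * W k r) * s i j) = (\<Sum>j\<in>I. \<alpha> j m * s i j)" .
qed

lemma derivation_s_invariant:
  assumes "i \<in> I" "m \<in> I"
    and DW: "\<And>p q. p \<in> I \<Longrightarrow> q \<in> I \<Longrightarrow> D (W p q) = (\<Sum>r\<in>I. \<alpha> p r * W r q) + (\<Sum>r\<in>I. \<alpha> q r * W p r)"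
  shows "D (s i m) + (\<Sum>k\<in>I. \<alpha> k i * s k m) + (\<Sum>k\<in>I. \<alpha> k m * s i k) = 0"
proof -
  have "D (s i m) = - (\<Sum>k\<in>I. \<Sum>j\<in>I. s k m * ((\<Sum>r\<in>I. \<alpha> k r * W r j) + (\<Sum>r\<in>I. \<alpha> j r * W k r)) * s i j)"
    unfolding derivation_s[OF assms(1,2)] by (intro arg_cong[where f = uminus] sum.cong refl) (simp add: DW)
  also have "\<dots> = - ((\<Sum>k\<in>I. \<Sum>j\<in>I. s k m * (\<Sum>r\<in>I. \<alpha> k r * W r j) * s i j)
      + (\<Sum>k\<in>I. \<Sum>j\<in>I. s k m * (\<Sum>r\<in>I. \<alpha> j r * W k r) * s i j))"
    by (simp only: distrib_left distrib_right sum.distrib)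
  finally show ?thesis unfolding derivation_s_sandwich[OF assms(1,2)] by simp
qed

text \<open>Intended reading: for \<xi> in \<open>l*\<close>, \<open>D\<close> is the left
  derivative along \<xi>, \<open>c p r\<close> is \<delta>(p) paired with \<xi> and the coordinate
  \<open>r\<close>, and \<open>L p q\<close> is \<xi>([p, q]). The hypothesis on \<open>D\<close> is
  then the left derivative of \<omega>, and the terms of the conclusion come from
  \<open>CYB\<close>, \<open>dL\<close> and the cobracket.\<close>

lemma dynamical_identity_luu:
  assumes j: "j \<in> I" and k: "k \<in> I"
    and skew: "\<And>p q. L q p = - L p q"
    and DW: "\<And>p q. p \<in> I \<Longrightarrow> q \<in> I \<Longrightarrow>
      D (W p q) = - ((\<Sum>r\<in>I. c p r * W r q) + (\<Sum>r\<in>I. c q r * W p r)) - L p q"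
  shows "(\<Sum>p\<in>I. \<Sum>q\<in>I. L p q * s p j * s q k) - D (s j k)
    + (\<Sum>p\<in>I. c p j * s p k) - (\<Sum>p\<in>I. c p k * s p j) = 0"
proof -
  have "D (s j k) = - (\<Sum>p\<in>I. \<Sum>q\<in>I. s p k *
      (- ((\<Sum>r\<in>I. c p r * W r q) + (\<Sum>r\<in>I. c q r * W p r)) - L p q) * s j q)"
    unfolding derivation_s[OF j k] by (intro arg_cong[where f = uminus] sum.cong refl) (simp add: DW)
  also have "\<dots> = (\<Sum>p\<in>I. \<Sum>q\<in>I. s p k * (\<Sum>r\<in>I. c p r * W r q) * s j q)
      + (\<Sum>p\<in>I. \<Sum>q\<in>I. s p k * (\<Sum>r\<in>I. c q r * W p r) * s j q)
      + (\<Sum>p\<in>I. \<Sum>q\<in>I. s p k * L p q * s j q)"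
    by (simp only: left_diff_distrib right_diff_distrib distrib_left distrib_right sum.distrib
        sum_negf sum_subtractf mult_minus_left mult_minus_right minus_diff_eq minus_add_distrib) simp
  also have "\<dots> = (\<Sum>p\<in>I. c p j * s p k) + (\<Sum>q\<in>I. c q k * s j q)
      + (\<Sum>p\<in>I. \<Sum>q\<in>I. s p k * L p q * s j q)"
    unfolding derivation_s_sandwich[OF j k] ..
  also have "(\<Sum>q\<in>I. c q k * s j q) = - (\<Sum>q\<in>I. c q k * s q j)"
    unfolding sum_negf[symmetric] by (intro sum.cong refl) (simp add: s_skew[of j] j)
  also have "(\<Sum>p\<in>I. \<Sum>q\<in>I. s p k * L p q * s j q) = (\<Sum>q\<in>I. \<Sum>p\<in>I. s p k * L p q * s j q)"
    by (rule sum.swap)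
  also have "\<dots> = (\<Sum>q\<in>I. \<Sum>p\<in>I. L q p * s q j * s p k)"
  proof (intro sum.cong refl)
    fix p q assume "q \<in> I"
    then show "s p k * L p q * s j q = L q p * s q j * s p k"
      by (simp add: s_skew[OF j] skew[of q p])
  qed
  finally show ?thesis by simp
qed

end

text \<open>Contraction with the first index of \<open>s\<close>. It cancels a factor
  \<open>W\<close>, so three contractions turn an identity for \<omega> into one for
  \<sigma>.\<close>

definition ctr :: "'i \<Rightarrow> ('i \<Rightarrow> 'k) \<Rightarrow> 'k" where
  "ctr i f = (\<Sum>a\<in>I. s a i * f a)"

lemma ctr_add: "ctr i (\<lambda>a. f a + g a) = ctr i f + ctr i g"
  and ctr_scale: "ctr i (\<lambda>a. c * f a) = c * ctr i f"
  and ctr_scale': "ctr i (\<lambda>a. f a * c) = ctr i f * c"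
  and ctr_sum: "ctr i (\<lambda>a. \<Sum>j\<in>J. h j a) = (\<Sum>j\<in>J. ctr i (h j))"
  and ctr_0: "ctr i (\<lambda>a. 0) = 0"
  unfolding ctr_def
  by (simp_all add: distrib_left sum.distrib sum_distrib_left sum_distrib_right mult_ac) (rule sum.swap)

lemma ctr_swap: "ctr i (\<lambda>a. ctr j (\<lambda>b. f a b)) = ctr j (\<lambda>b. ctr i (\<lambda>a. f a b))"
  unfolding ctr_def sum_distrib_left by (subst sum.swap) (simp only: mult_ac)

lemma ctr_W: "i \<in> I \<Longrightarrow> i' \<in> I \<Longrightarrow> ctr i (\<lambda>a. W a i') = (if i = i' then 1 else 0)"
  unfolding ctr_def using s_W[of i i'] by (simp add: mult.commute)

lemma ctr_sum_W:
  assumes "i \<in> I"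
  shows "ctr i (\<lambda>a. \<Sum>r\<in>I. W a r * h r) = h i"
proof -
  have "ctr i (\<lambda>a. \<Sum>r\<in>I. W a r * h r) = (\<Sum>r\<in>I. (if i = r then 1 else 0) * h r)"
    unfolding ctr_sum ctr_scale' by (intro sum.cong refl) (simp add: ctr_W assms)
  then show ?thesis by (simp add: sum_unit assms)
qed

lemma ctr_cong: "(\<And>a. a \<in> I \<Longrightarrow> f a = g a) \<Longrightarrow> ctr i f = ctr i g"
  unfolding ctr_def by simp

text \<open>With \<tau> the structure constants of the bracket and \<open>d\<close> those of the
  cobracket on \<open>u\<close>, the cyclic sum of \<open>H\<close> is the Lagrangian identity for
  \<omega>. Contracting all three indices with \<open>s\<close> gives the cyclic sum of
  \<open>U\<close>.\<close>

lemma dynamical_identity_uuu: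
  fixes \<tau> d :: "'i \<Rightarrow> 'i \<Rightarrow> 'i \<Rightarrow> 'k"
  defines "H \<equiv> \<lambda>a b c. (\<Sum>r\<in>I. W a r * \<tau> r b c) + (\<Sum>r\<in>I. \<Sum>t\<in>I. d c r t * (W a r * W b t))"
    and "U \<equiv> \<lambda>i j k. (\<Sum>p\<in>I. \<Sum>q\<in>I. \<tau> i p q * s p j * s q k) + (\<Sum>p\<in>I. d p i j * s p k)"
  assumes H: "\<And>a b c. a \<in> I \<Longrightarrow> b \<in> I \<Longrightarrow> c \<in> I \<Longrightarrow> H a b c + H b c a + H c a b = 0"
    and ijk: "i \<in> I" "j \<in> I" "k \<in> I"
  shows "U i j k + U j k i + U k i j = 0"
proof -
  have c: "ctr i (\<lambda>a. ctr j (\<lambda>b. ctr k (\<lambda>c. H a b c))) = U i j k"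
    if ijk: "i \<in> I" "j \<in> I" "k \<in> I" for i j k
  proof -
    have "ctr i (\<lambda>a. ctr j (\<lambda>b. ctr k (\<lambda>c. \<Sum>r\<in>I. W a r * \<tau> r b c)))
      = ctr i (\<lambda>a. \<Sum>r\<in>I. W a r * ctr j (\<lambda>b. ctr k (\<lambda>c. \<tau> r b c)))"
      by (simp add: ctr_sum ctr_scale)
    also have "\<dots> = ctr j (\<lambda>b. ctr k (\<lambda>c. \<tau> i b c))" by (rule ctr_sum_W[OF ijk(1)])
    also have "\<dots> = (\<Sum>p\<in>I. \<Sum>q\<in>I. \<tau> i p q * s p j * s q k)"
      by (simp add: ctr_def sum_distrib_left mult_ac)
    finally have 1: "ctr i (\<lambda>a. ctr j (\<lambda>b. ctr k (\<lambda>c. \<Sum>r\<in>I. W a r * \<tau> r b c))) = \<dots>" .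
    have "ctr i (\<lambda>a. ctr j (\<lambda>b. ctr k (\<lambda>c. \<Sum>r\<in>I. \<Sum>t\<in>I. d c r t * (W a r * W b t))))
      = ctr i (\<lambda>a. \<Sum>r\<in>I. W a r * ctr j (\<lambda>b. \<Sum>t\<in>I. W b t * ctr k (\<lambda>c. d c r t)))"
      by (simp add: ctr_sum ctr_scale ctr_scale' sum_distrib_left mult_ac)
    also have "\<dots> = ctr k (\<lambda>c. d c i j)" by (simp only: ctr_sum_W[OF ijk(1)] ctr_sum_W[OF ijk(2)])
    also have "\<dots> = (\<Sum>p\<in>I. d p i j * s p k)" by (simp add: ctr_def mult.commute)
    finally show ?thesis using 1 by (simp add: H_def U_def ctr_add)
  qed
  have "U i j k + U j k i + U k i j =
    ctr i (\<lambda>a. ctr j (\<lambda>b. ctr k (\<lambda>c. H a b c))) + ctr j (\<lambda>b. ctr k (\<lambda>c. ctr i (\<lambda>a. H b c a)))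
    + ctr k (\<lambda>c. ctr i (\<lambda>a. ctr j (\<lambda>b. H c a b)))" by (simp add: c ijk)
  also have "ctr j (\<lambda>b. ctr k (\<lambda>c. ctr i (\<lambda>a. H b c a))) = ctr i (\<lambda>a. ctr j (\<lambda>b. ctr k (\<lambda>c. H b c a)))"
    by (simp only: ctr_swap[of k i]) (simp only: ctr_swap[of j i])
  also have "ctr k (\<lambda>c. ctr i (\<lambda>a. ctr j (\<lambda>b. H c a b))) = ctr i (\<lambda>a. ctr j (\<lambda>b. ctr k (\<lambda>c. H c a b)))"
    by (simp only: ctr_swap[of k i]) (simp only: ctr_swap[of k j])
  also have "ctr i (\<lambda>a. ctr j (\<lambda>b. ctr k (\<lambda>c. H a b c))) + ctr i (\<lambda>a. ctr j (\<lambda>b. ctr k (\<lambda>c. H b c a)))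
     + ctr i (\<lambda>a. ctr j (\<lambda>b. ctr k (\<lambda>c. H c a b)))
     = ctr i (\<lambda>a. ctr j (\<lambda>b. ctr k (\<lambda>c. H a b c + H b c a + H c a b)))"
    by (simp only: ctr_add)
  also have "\<dots> = ctr i (\<lambda>a. ctr j (\<lambda>b. ctr k (\<lambda>c. 0)))"
    by (intro ctr_cong H)
  finally show ?thesis by (simp add: ctr_0)
qed

end

section \<open>Restriction to a line\<close>

text \<open>Restriction to a one-parameter subgroup, f(exp(t \<xi>)). The factorials make it a ring
  homomorphism to power series in one variable, where lowest order terms are easy to
  extract.\<close>

definition on_line :: "'a \<Rightarrow> 'a wfun \<Rightarrow> complex fps" where
  "on_line \<xi> f = Abs_fps (\<lambda>m. wcoeff f (replicate m \<xi>) / fact m)"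

lemma on_line_deriv: "fps_deriv (on_line \<xi> f) = on_line \<xi> (wtail \<xi> f)"
  by (rule fps_ext) (simp add: on_line_def field_simps del: of_nat_Suc)

lemma on_line_add: "on_line \<xi> (f + g) = on_line \<xi> f + on_line \<xi> g"
  by (rule fps_ext) (simp add: on_line_def add_divide_distrib)

lemma on_line_mult: "on_line \<xi> (f * g) = on_line \<xi> f * on_line \<xi> g"
proof -
  have "fps_nth (on_line \<xi> (f * g)) m = fps_nth (on_line \<xi> f * on_line \<xi> g) m" for m
  proof (induction m arbitrary: f g)
    case (Suc m)
    \<comment> \<open>A coefficient is a multiple of one coefficient of the derivative, and
      differentiation satisfies the Leibniz rule on both sides.\<close>
    have "fps_nth (fps_deriv (on_line \<xi> (f * g))) m = fps_nth (fps_deriv (on_line \<xi> f * on_line \<xi> g)) m"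
      by (simp add: on_line_deriv wtail_simps on_line_add Suc)
    then have "of_nat (Suc m) * fps_nth (on_line \<xi> (f * g)) (Suc m)
      = of_nat (Suc m) * fps_nth (on_line \<xi> f * on_line \<xi> g) (Suc m)"
      unfolding fps_deriv_nth by simp
    then show ?case by (simp del: of_nat_Suc)
  qed (simp add: on_line_def wcoeff_times)
  then show ?thesis by (rule fps_ext)
qed

lemma on_line_hom: "comm_ring_hom (on_line \<xi>)"
proof
  show "on_line \<xi> 1 = 1"
    by (rule fps_ext) (simp add: on_line_def one_wfun_def wconst_def fps_one_nth)
  show "on_line \<xi> 0 = 0" by (rule fps_ext) (simp add: on_line_def)
qed (simp_all add: on_line_add on_line_mult)

text \<open>On the line every entry is divisible by the variable, so the determinant is its
  \<open>n\<close>-th power times a series whose constant term is the determinant of the linear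
  parts.\<close>

lemma det_nonzero_of_linear_part:
  assumes A: "A \<in> carrier_mat n n"
    and A0: "\<And>i j. i < n \<Longrightarrow> j < n \<Longrightarrow> wcoeff (A $$ (i, j)) [] = 0"
    and A1: "det (mat n n (\<lambda>(i, j). wcoeff (A $$ (i, j)) [\<xi>])) \<noteq> 0"
  shows "det A \<noteq> 0"
proof
  assume "det A = 0"
  interpret ol: comm_ring_hom "on_line \<xi>" by (rule on_line_hom)
  interpret c0: comm_ring_hom "\<lambda>f :: complex fps. fps_nth f 0" by unfold_locales simp_all
  let ?G = "mat n n (\<lambda>(i, j). fps_shift 1 (on_line \<xi> (A $$ (i, j))))"
  have "on_line \<xi> (A $$ (i, j)) = fps_X * fps_shift 1 (on_line \<xi> (A $$ (i, j)))" if "i < n" "j < n" for i j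
    using A0[OF that] by (intro fps_ext) (simp add: on_line_def)
  then have "map_mat (on_line \<xi>) A = fps_X \<cdot>\<^sub>m ?G" using A by (intro eq_matI) auto
  then have "fps_X ^ n * det ?G = on_line \<xi> (det A)" using ol.hom_det[of A] by simp
  then have "det ?G = 0" using \<open>det A = 0\<close> by simp
  then have "fps_nth (det ?G) 0 = 0" by simp
  then have "det (map_mat (\<lambda>f. fps_nth f 0) ?G) = 0" by (simp only: c0.hom_det)
  moreover have "map_mat (\<lambda>f. fps_nth f 0) ?G = mat n n (\<lambda>(i, j). wcoeff (A $$ (i, j)) [\<xi>])"
    by (intro eq_matI) (auto simp: on_line_def)
  ultimately show False using A1 by metis
qed

lemma wconst_hom: "comm_ring_hom wconst"
  by unfold_locales (simp_all add: wconst_simps)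

section \<open>The tensor sigma\<close>

lemma Fract_1_simps:
  "Fract (a + b) 1 = Fract a 1 + Fract b 1" "Fract (a * b) 1 = Fract a 1 * Fract b 1"
  "Fract (- a) 1 = - Fract a 1" "Fract (a - b) 1 = Fract a 1 - Fract b 1" "Fract 0 1 = 0"
  by (simp_all add: fract_collapse)

lemma Fract_1_sum: "Fract (\<Sum>i\<in>I. f i) 1 = (\<Sum>i\<in>I. Fract (f i) 1)"
  by (induction I rule: infinite_finite_induct) (simp_all add: Fract_1_simps del: add_fract)

lemma Fract_wconst: "Fract (wconst c) 1 = fract_const c"
  by (simp add: fract_const_def)

context split_lie_bialgebra
begin

abbreviation "B \<equiv> basis_of u"

lemma finite_B: "finite B" and B_u: "e \<in> B \<Longrightarrow> e \<in> u"
  using finite_basis_of[OF u_subspace] basis_of(1)[OF u_subspace] by auto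

lemma u_coord_B: "e \<in> B \<Longrightarrow> e' \<in> B \<Longrightarrow> u_coord e e' = (if e' = e then 1 else 0)"
  by (simp add: u_coord_u B_u dual_vector_basis[OF u_subspace])

definition omf :: "'g \<Rightarrow> 'g \<Rightarrow> 'g fractions" where
  "omf x y = Fract (omega x y) 1"

lemma omf_skew: "omf y x = - omf x y"
  by (simp add: omf_def omega_antisym[of y x])

lemma omf_expansion:
  "x \<in> u \<Longrightarrow> omf x y = (\<Sum>e\<in>B. fract_const (u_coord e x) * omf e y)"
  "x \<in> u \<Longrightarrow> omf y x = (\<Sum>e\<in>B. fract_const (u_coord e x) * omf y e)"
proof -
  show l: "omf x y = (\<Sum>e\<in>B. fract_const (u_coord e x) * omf e y)" if "x \<in> u" for x y
    unfolding omf_def omega_expansion[OF that, of y] Fract_1_sum Fract_1_simps(2) Fract_wconst ..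
  show "omf y x = (\<Sum>e\<in>B. fract_const (u_coord e x) * omf y e)" if "x \<in> u" for x y
    using l[OF that, of y] by (simp add: omf_skew[of y] sum_negf)
qed

text \<open>The defining equation of \<sigma> for \<open>v = k\<close>, read off at the coefficient
  of \<open>i\<close>. Hence the second index of \<open>s\<close> is the one summed against
  \<omega>.\<close>

abbreviation is_inverse :: "('g \<Rightarrow> 'g \<Rightarrow> 'g fractions) \<Rightarrow> bool" where
  "is_inverse s \<equiv> \<forall>i\<in>B. \<forall>k\<in>B. (\<Sum>j\<in>B. omf k j * s i j) = (if i = k then 1 else 0)"

lemma skew_inverseI: "is_inverse s \<Longrightarrow> skew_inverse B omf s"
  by unfold_locales (simp_all add: finite_B omf_skew[symmetric])

definition tensor_of :: "('g \<Rightarrow> 'g \<Rightarrow> 'g fractions) \<Rightarrow> ('g, 'g fractions) tensor2" where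
  "tensor_of s = (\<lambda>\<phi> \<psi>. if \<phi> \<in> dual UNIV \<and> \<psi> \<in> dual UNIV
     then \<Sum>i\<in>B. \<Sum>j\<in>B. fract_const (\<phi> i) * fract_const (\<psi> j) * s i j else 0)"

lemma fract_const_expansion:
  "\<phi> \<in> dual UNIV \<Longrightarrow> x \<in> u \<Longrightarrow> fract_const (\<phi> x) = (\<Sum>e\<in>B. fract_const (\<phi> e) * fract_const (u_coord e x))"
  using dual_split[of \<phi> x] by (simp add: l_part_u dual_simps(3) fract_const_sum fract_const_simps)

lemma tensor_sum_eq_tensor_of:
  assumes "\<And>m. m < n \<Longrightarrow> a m \<in> u" "\<And>m. m < n \<Longrightarrow> b m \<in> u"
  shows "tensor_sum n a b f = tensor_of (\<lambda>i j. \<Sum>m<n. fract_const (u_coord i (a m)) * fract_const (u_coord j (b m)) * f m)"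
proof (intro ext)
  fix \<phi> \<psi>
  show "tensor_sum n a b f \<phi> \<psi> = tensor_of (\<lambda>i j. \<Sum>m<n. fract_const (u_coord i (a m)) * fract_const (u_coord j (b m)) * f m) \<phi> \<psi>"
  proof (cases "\<phi> \<in> dual UNIV \<and> \<psi> \<in> dual UNIV")
    case True
    have "tensor_sum n a b f \<phi> \<psi> = (\<Sum>m<n. (\<Sum>i\<in>B. fract_const (\<phi> i) * fract_const (u_coord i (a m)))
        * (\<Sum>j\<in>B. fract_const (\<psi> j) * fract_const (u_coord j (b m))) * f m)"
      unfolding tensor_sum_def
      by (intro sum.cong refl)
        (use True assms in \<open>simp add: pure2_def fract_const_simps fract_const_expansion[symmetric]\<close>)
    also have "\<dots> = (\<Sum>m<n. \<Sum>i\<in>B. \<Sum>j\<in>B. fract_const (\<phi> i) * fract_const (\<psi> j) *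
         (fract_const (u_coord i (a m)) * fract_const (u_coord j (b m)) * f m))"
      by (simp only: sum_product, simp only: sum_distrib_right, simp only: mult_ac)
    also have "\<dots> = (\<Sum>i\<in>B. \<Sum>m<n. \<Sum>j\<in>B. fract_const (\<phi> i) * fract_const (\<psi> j) *
         (fract_const (u_coord i (a m)) * fract_const (u_coord j (b m)) * f m))" by (rule sum.swap)
    also have "\<dots> = (\<Sum>i\<in>B. \<Sum>j\<in>B. \<Sum>m<n. fract_const (\<phi> i) * fract_const (\<psi> j) *
         (fract_const (u_coord i (a m)) * fract_const (u_coord j (b m)) * f m))"
      by (intro sum.cong refl sum.swap)
    finally show ?thesis using True by (simp add: tensor_of_def sum_distrib_left)
  qed (auto simp: tensor_of_def tensor_sum_def pure2_def fract_const_simps)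
qed

lemma tensor_of_cong: "(\<And>i j. i \<in> B \<Longrightarrow> j \<in> B \<Longrightarrow> s i j = s' i j) \<Longrightarrow> tensor_of s = tensor_of s'"
  unfolding tensor_of_def by (intro ext if_cong refl sum.cong arg_cong2[where f = "(*)"])

text \<open>An enumeration of pairs of basis vectors turns the double sum into the singly indexed
  form of \<open>tensor_sum\<close>; the clause for \<open>F\<close> transports other sums along
  it.\<close>

lemma tensor_of_tensor_sum:
  assumes "\<And>i j. i \<in> B \<Longrightarrow> j \<in> B \<Longrightarrow> s i j \<in> S"
  obtains n a b f where "\<And>m. m < n \<Longrightarrow> a m \<in> B \<and> b m \<in> B \<and> f m = s (a m) (b m) \<and> f m \<in> S"
    "tensor_of s = tensor_sum n a b f" "\<And>F. (\<Sum>m<n. F (a m) (b m)) = (\<Sum>i\<in>B. \<Sum>j\<in>B. F i j :: 'g fractions)"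
proof -
  obtain h where h: "bij_betw h {..<card (B \<times> B)} (B \<times> B)"
    using ex_bij_betw_nat_finite[of "B \<times> B"] finite_B by (auto simp: atLeast0LessThan)
  let ?n = "card (B \<times> B)" and ?a = "\<lambda>m. fst (h m)" and ?b = "\<lambda>m. snd (h m)"
  have ab: "?a m \<in> B" "?b m \<in> B" if "m < ?n" for m
    using bij_betwE[OF h] that by (auto simp: mem_Times_iff)
  have S: "(\<Sum>m<?n. F (?a m) (?b m)) = (\<Sum>i\<in>B. \<Sum>j\<in>B. F i j)" for F :: "'g \<Rightarrow> 'g \<Rightarrow> 'g fractions"
    using sum.reindex_bij_betw[OF h, of "\<lambda>p. F (fst p) (snd p)"]
    by (simp add: sum.cartesian_product split_beta)
  have "tensor_of s = tensor_sum ?n ?a ?b (\<lambda>m. s (?a m) (?b m))"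
  proof (intro ext)
    fix \<phi> \<psi>
    show "tensor_of s \<phi> \<psi> = tensor_sum ?n ?a ?b (\<lambda>m. s (?a m) (?b m)) \<phi> \<psi>"
      unfolding tensor_sum_def S[of "\<lambda>i j. fract_const (pure2 i j \<phi> \<psi>) * s i j"]
      by (auto simp: tensor_of_def pure2_def fract_const_simps)
  qed
  then show ?thesis using that[of ?n ?a ?b "\<lambda>m. s (?a m) (?b m)"] ab assms S by blast
qed

lemma tensor_of_skew:
  assumes "is_inverse s"
  shows "tensor_of s \<psi> \<phi> = - tensor_of s \<phi> \<psi>"
proof -
  interpret skew_inverse B omf s by (rule skew_inverseI[OF assms])
  have "(\<Sum>i\<in>B. \<Sum>j\<in>B. fract_const (\<psi> i) * fract_const (\<phi> j) * s i j)
    = (\<Sum>j\<in>B. \<Sum>i\<in>B. fract_const (\<psi> i) * fract_const (\<phi> j) * s i j)" by (rule sum.swap)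
  also have "\<dots> = (\<Sum>j\<in>B. \<Sum>i\<in>B. - (fract_const (\<phi> j) * fract_const (\<psi> i) * s j i))"
  proof (intro sum.cong refl)
    fix i j assume "i \<in> B" "j \<in> B"
    then show "fract_const (\<psi> i) * fract_const (\<phi> j) * s i j = - (fract_const (\<phi> j) * fract_const (\<psi> i) * s j i)"
      by (simp add: s_skew[of i j])
  qed
  finally show ?thesis by (simp add: tensor_of_def sum_negf)
qed

lemma is_sigma_tensor_of:
  assumes s: "is_inverse s"
    and S: "\<And>i j. i \<in> B \<Longrightarrow> j \<in> B \<Longrightarrow> s i j \<in> localization (dual_group_functions l) (P_det \<iota>)"
  shows "is_sigma \<iota> (tensor_of s)"
proof -
  let ?S = "localization (dual_group_functions l) (P_det \<iota>)"
  obtain n a b f where n: "\<And>m. m < n \<Longrightarrow> a m \<in> B \<and> b m \<in> B \<and> f m = s (a m) (b m) \<and> f m \<in> ?S"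
    and t: "tensor_of s = tensor_sum n a b f"
    and sm: "\<And>F. (\<Sum>m<n. F (a m) (b m)) = (\<Sum>i\<in>B. \<Sum>j\<in>B. F i j :: 'g fractions)"
    using tensor_of_tensor_sum[of s ?S, OF S] by blast
  have n': "\<forall>m<n. a m \<in> u \<and> b m \<in> u \<and> f m \<in> ?S" using n B_u by blast
  have "(\<Sum>m<n. fract_const (\<phi> (a m)) * (Fract (omega v (b m)) 1 * f m)) = fract_const (\<phi> v)"
    if v: "v \<in> u" and phi: "\<phi> \<in> dual UNIV" for v \<phi>
  proof -
    have "(\<Sum>m<n. fract_const (\<phi> (a m)) * (Fract (omega v (b m)) 1 * f m))
      = (\<Sum>m<n. fract_const (\<phi> (a m)) * (omf v (b m) * s (a m) (b m)))"
      by (intro sum.cong refl) (use n in \<open>simp add: omf_def\<close>)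
    also have "\<dots> = (\<Sum>i\<in>B. \<Sum>j\<in>B. fract_const (\<phi> i) * (omf v j * s i j))" by (rule sm)
    also have "\<dots> = (\<Sum>i\<in>B. fract_const (\<phi> i) * fract_const (u_coord i v))"
    proof (intro sum.cong refl)
      fix i assume i: "i \<in> B"
      have "(\<Sum>j\<in>B. omf v j * s i j) = (\<Sum>j\<in>B. \<Sum>k\<in>B. fract_const (u_coord k v) * (omf k j * s i j))"
        by (subst omf_expansion(1)[OF v]) (simp only: sum_distrib_right mult.assoc)
      also have "\<dots> = (\<Sum>k\<in>B. \<Sum>j\<in>B. fract_const (u_coord k v) * (omf k j * s i j))" by (rule sum.swap)
      also have "\<dots> = (\<Sum>k\<in>B. fract_const (u_coord k v) * (if i = k then 1 else 0))"
        unfolding sum_distrib_left[symmetric] by (intro sum.cong refl) (use s i in simp)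
      also have "\<dots> = fract_const (u_coord i v)" using i finite_B by (simp add: if_distrib cong: if_cong)
      finally show "(\<Sum>j\<in>B. fract_const (\<phi> i) * (omf v j * s i j)) = fract_const (\<phi> i) * fract_const (u_coord i v)"
        by (simp only: sum_distrib_left[symmetric])
    qed
    also have "\<dots> = fract_const (\<phi> v)" by (rule fract_const_expansion[OF phi v, symmetric])
    finally show ?thesis .
  qed
  then have "\<exists>n a b f. (\<forall>j<n. a j \<in> u \<and> b j \<in> u \<and> f j \<in> ?S) \<and> tensor_of s = tensor_sum n a b f \<and>
          (\<forall>v\<in>u. \<forall>\<phi>\<in>dual UNIV.
             (\<Sum>j<n. fract_const (\<phi> (a j)) * (Fract (omega v (b j)) 1 * f j)) = fract_const (\<phi> v))"
    using n' t by blast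
  moreover have "tensor_of s \<in> wedge2_over u ?S"
    unfolding wedge2_over_def using n' t tensor_of_skew[OF s] by blast
  ultimately show ?thesis unfolding is_sigma_def Let_def by blast
qed

text \<open>Testing the defining equation on basis vectors with coordinate functionals shows that
  the coefficients of any solution are again an inverse of \<omega>, and the inverse is
  unique.\<close>

lemma is_sigma_unique:
  assumes s: "is_inverse s" and "is_sigma \<iota> \<sigma>"
  shows "\<sigma> = tensor_of s"
proof -
  interpret skew_inverse B omf s by (rule skew_inverseI[OF s])
  obtain n a b f where ab: "\<And>m. m < n \<Longrightarrow> a m \<in> u" "\<And>m. m < n \<Longrightarrow> b m \<in> u" and t: "\<sigma> = tensor_sum n a b f"
    and eq: "\<And>v \<phi>. v \<in> u \<Longrightarrow> \<phi> \<in> dual UNIV \<Longrightarrow>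
      (\<Sum>j<n. fract_const (\<phi> (a j)) * (Fract (omega v (b j)) 1 * f j)) = fract_const (\<phi> v)"
    using assms(2) unfolding is_sigma_def Let_def by blast
  define s' where "s' = (\<lambda>i j. \<Sum>m<n. fract_const (u_coord i (a m)) * fract_const (u_coord j (b m)) * f m)"
  have s': "(\<Sum>j\<in>B. omf k j * s' i j) = (if i = k then 1 else 0)" if "i \<in> B" "k \<in> B" for i k
  proof -
    have "(\<Sum>j\<in>B. omf k j * s' i j) = (\<Sum>j\<in>B. \<Sum>m<n. fract_const (u_coord i (a m)) * ((fract_const (u_coord j (b m)) * omf k j) * f m))"
      unfolding s'_def sum_distrib_left by (simp only: mult_ac)
    also have "\<dots> = (\<Sum>m<n. \<Sum>j\<in>B. fract_const (u_coord i (a m)) * ((fract_const (u_coord j (b m)) * omf k j) * f m))"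
      by (rule sum.swap)
    also have "\<dots> = (\<Sum>m<n. fract_const (u_coord i (a m)) * (Fract (omega k (b m)) 1 * f m))"
    proof (intro sum.cong refl)
      fix m assume "m \<in> {..<n}"
      then have "b m \<in> u" using ab by simp
      show "(\<Sum>j\<in>B. fract_const (u_coord i (a m)) * ((fract_const (u_coord j (b m)) * omf k j) * f m))
        = fract_const (u_coord i (a m)) * (Fract (omega k (b m)) 1 * f m)"
        unfolding omf_def[symmetric] omf_expansion(2)[OF \<open>b m \<in> u\<close>, of k] sum_distrib_left sum_distrib_right ..
    qed
    also have "\<dots> = fract_const (u_coord i k)" by (rule eq) (use B_u that in auto)
    finally show ?thesis using that by (auto simp: u_coord_B fract_const_simps)
  qed
  have "\<sigma> = tensor_of s'" unfolding t s'_def by (rule tensor_sum_eq_tensor_of) (use ab in auto)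
  also have "\<dots> = tensor_of s"
  proof (rule tensor_of_cong)
    fix i j assume ij: "i \<in> B" "j \<in> B"
    have "s' i j = - s j i" by (rule s_eqI[OF s' ij])
    then show "s' i j = s i j" using s_skew[OF ij] by simp
  qed
  finally show ?thesis .
qed

section \<open>Invertibility of omega\<close>

lemmas wconst_in_FF = dual_l_FF(4)

lemma mult_in_FF: "f \<in> dual_group_functions l \<Longrightarrow> g \<in> dual_group_functions l \<Longrightarrow> f * g \<in> dual_group_functions l"
  and det_in_FF: "A \<in> carrier_mat n n \<Longrightarrow> (\<And>i j. i < n \<Longrightarrow> j < n \<Longrightarrow> A $$ (i, j) \<in> dual_group_functions l)
     \<Longrightarrow> det A \<in> dual_group_functions l"
  by (fact dual_l_FF(1)) (rule dual_l_FF(3))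

text \<open>\<open>es\<close> is literally the choice made inside \<open>P_det\<close>, so all
  matrices below use the same order of the basis.\<close>

context
  fixes \<iota> :: "'g \<Rightarrow> 'g functional" and es :: "'g list" and n :: nat
  assumes iso: "linear_iso_to_dual \<iota>" and nondeg: nondegenerate
  defines "es \<equiv> SOME es. distinct es \<and> set es = B" and "n \<equiv> length es"
begin

lemma es: "distinct es" "set es = B"
proof -
  have "\<exists>es. distinct es \<and> set es = B" using finite_distinct_list[OF finite_B] by blast
  from someI_ex[OF this] show "distinct es" "set es = B" unfolding es_def by blast+
qed

lemma bij_es: "bij_betw ((!) es) {..<n} B"
  unfolding n_def using es bij_betw_nth by blast

lemma es_B: "i < n \<Longrightarrow> es ! i \<in> B" and es_u: "i < n \<Longrightarrow> es ! i \<in> u"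
  using bij_betwE[OF bij_es] B_u by auto

lemma es_cases: "e \<in> B \<Longrightarrow> \<exists>i<n. e = es ! i"
  using bij_betw_imp_surj_on[OF bij_es] by (metis imageE lessThan_iff)

lemma sum_B: "(\<Sum>e\<in>B. F e) = (\<Sum>i<n. F (es ! i))"
  by (rule sum.reindex_bij_betw[OF bij_es, symmetric])

definition omega_mat :: "'g functional wfun mat" where
  "omega_mat = mat n n (\<lambda>(i, j). omega (es ! i) (es ! j))"

lemma omega_mat_carrier: "omega_mat \<in> carrier_mat n n"
  by (simp add: omega_mat_def)

lemma dual_vector_es: "i < n \<Longrightarrow> j < n \<Longrightarrow> dual_vector u (es ! i) (es ! j) = (if i = j then 1 else 0)"
  using es(1) by (simp add: dual_vector_basis[OF u_subspace] es_B nth_eq_iff_index_eq n_def eq_commute)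

text \<open>At one nondegenerate \<xi>, a kernel vector of the linear term of \<omega> is the
  coordinate vector of an element in the radical of the form \<xi>([y, z]), hence zero.\<close>

lemma det_omega_mat: "det omega_mat \<noteq> 0"
proof -
  obtain p :: "'g functional \<Rightarrow> complex" where p: "\<exists>\<phi>\<in>dual l. p \<phi> \<noteq> 0"
    "\<forall>\<phi>\<in>dual l. p \<phi> \<noteq> 0 \<longrightarrow> (\<forall>x\<in>u. (\<forall>y\<in>u. \<phi> (l_part (br x y)) = 0) \<longrightarrow> x = 0)"
    using nondeg unfolding nondegenerate_def generic_in_dual_def by blast
  then obtain \<xi> where xi: "\<xi> \<in> dual l" and nd: "\<forall>x\<in>u. (\<forall>y\<in>u. \<xi> (l_part (br x y)) = 0) \<longrightarrow> x = 0" by blast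
  let ?K = "mat n n (\<lambda>(i, j). wcoeff (omega_mat $$ (i, j)) [\<xi>])"
  have K: "?K $$ (i, j) = embed \<xi> (br (es ! i) (es ! j))" if "i < n" "j < n" for i j
    using that xi by (simp add: omega_mat_def omega_linear_term embed_def)
  have "det ?K \<noteq> 0"
  proof
    assume "det ?K = 0"
    then obtain v where v: "v \<in> carrier_vec n" "v \<noteq> 0\<^sub>v n" "?K *\<^sub>v v = 0\<^sub>v n"
      using det_0_iff_vec_prod_zero[of ?K n] by auto
    define x where "x = (\<Sum>j<n. scale (v $ j) (es ! j))"
    note D = dual_simps[OF embed_in_dual[OF xi]]
    have xu: "x \<in> u" unfolding x_def
      by (intro subspace_sum subspace_scale u_subspace es_u) simp_all
    have x0: "embed \<xi> (br x (es ! i)) = 0" if "i < n" for i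
    proof -
      note Dr = dual_simps[OF dual_br_right[OF embed_in_dual[OF xi], of "es ! i"]]
      have "0 = (?K *\<^sub>v v) $ i" using v(3) that by simp
      also have "\<dots> = (\<Sum>j<n. embed \<xi> (br (es ! i) (es ! j)) * v $ j)"
        using that v(1) K[OF that] by (simp add: scalar_prod_def atLeast0LessThan)
      also have "\<dots> = embed \<xi> (br (es ! i) x)"
        unfolding x_def Dr(6) Dr(2) by (simp only: mult.commute)
      finally show ?thesis by (simp add: br_antisym[of x] D)
    qed
    have "embed \<xi> (br x y) = 0" if "y \<in> u" for y
    proof -
      note D' = dual_simps[OF dual_br_right[OF embed_in_dual[OF xi], of x]]
      have "embed \<xi> (br x y) = (\<Sum>e\<in>B. u_coord e y * embed \<xi> (br x e))"
        by (subst u_expansion[OF that], subst D'(6), subst D'(2)) (rule refl)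
      also have "\<dots> = 0" unfolding sum_B by (rule sum.neutral) (simp add: x0)
      finally show ?thesis .
    qed
    then have "x = 0" using nd xu by (simp add: embed_def)
    have "v $ i = 0" if "i < n" for i
    proof -
      have "u_coord (es ! i) x = (\<Sum>j<n. v $ j * u_coord (es ! i) (es ! j))"
        unfolding x_def by (simp add: dual_simps[OF u_coord_in_dual])
      also have "\<dots> = (\<Sum>j<n. if i = j then v $ j else 0)"
        by (intro sum.cong refl) (use that in \<open>simp add: u_coord_u es_u dual_vector_es\<close>)
      also have "\<dots> = v $ i" using that by simp
      finally show ?thesis using \<open>x = 0\<close> by (simp add: dual_simps[OF u_coord_in_dual])
    qed
    then have "v = 0\<^sub>v n" using v(1) by (intro eq_vecI) auto
    then show False using v(2) by blast
  qed
  then show ?thesis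
    by (intro det_nonzero_of_linear_part[OF omega_mat_carrier]) (simp_all add: omega_mat_def omega_linear_term)
qed

text \<open>The matrix of the inverse of \<iota> with respect to the dual basis and the
  basis.\<close>

definition iota_mat :: "complex mat" where
  "iota_mat = mat n n (\<lambda>(j, i). dual_vector u (es ! j) (inv_into u \<iota> (dual_vector u (es ! i))))"

lemma inv_iota_linear:
  assumes "\<phi> \<in> dual u" "e \<in> B"
  shows "dual_vector u e (inv_into u \<iota> \<phi>)
    = (\<Sum>i<n. dual_vector u e (inv_into u \<iota> (dual_vector u (es ! i))) * \<phi> (es ! i))"
proof -
  have bij: "bij_betw \<iota> u (dual u)" and add: "\<And>x y z. x \<in> u \<Longrightarrow> y \<in> u \<Longrightarrow> \<iota> (x + y) z = \<iota> x z + \<iota> y z"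
    and sc: "\<And>c x z. x \<in> u \<Longrightarrow> \<iota> (scale c x) z = c * \<iota> x z"
    using iso unfolding linear_iso_to_dual_def by blast+
  let ?g = "\<lambda>i. inv_into u \<iota> (dual_vector u (es ! i))"
  have g: "?g i \<in> u" "\<iota> (?g i) = dual_vector u (es ! i)" for i
    using bij dual_vector_in_dual[OF u_subspace]
    by (auto simp: bij_betw_def inv_into_into f_inv_into_f)
  let ?x = "\<Sum>i<n. scale (\<phi> (es ! i)) (?g i)"
  have lin: "\<iota> (\<Sum>i<m. scale (c i) (?g i)) z = (\<Sum>i<m. c i * dual_vector u (es ! i) z) \<and> (\<Sum>i<m. scale (c i) (?g i)) \<in> u" for m c z
  proof (induction m)
    case 0
    have "\<iota> (scale 0 (?g 0)) z = 0 * \<iota> (?g 0) z" by (rule sc) (rule g)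
    then show ?case by (simp add: subspace_0[OF u_subspace])
  next
    case (Suc m)
    then show ?case
      using g subspace_scale[OF u_subspace] by (simp add: add sc subspace_add[OF u_subspace])
  qed
  have x: "?x \<in> u" "\<iota> ?x = (\<lambda>z. \<Sum>i<n. \<phi> (es ! i) * dual_vector u (es ! i) z)"
    using lin[where m = n] by (simp_all add: fun_eq_iff)
  have "\<iota> ?x = \<phi>" unfolding x(2) sum_B[symmetric, of "\<lambda>e. \<phi> e * dual_vector u e _"]
    by (rule dual_eq_sum[OF u_subspace assms(1), symmetric])
  then have "inv_into u \<iota> \<phi> = ?x" using bij x(1) by (metis bij_betw_inv_into_left)
  moreover have "dual_vector u e y = u_coord e y" if "y \<in> u" for y using that by (simp add: u_coord_u)
  ultimately show ?thesis using x(1) g(1)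
    by (simp add: dual_simps[OF u_coord_in_dual] mult.commute)
qed

lemma det_iota_mat: "det iota_mat \<noteq> 0"
proof -
  let ?Q = "mat n n (\<lambda>(i, k). \<iota> (es ! k) (es ! i))"
  have bij: "bij_betw \<iota> u (dual u)" using iso by (simp add: linear_iso_to_dual_def)
  have "iota_mat * ?Q = 1\<^sub>m n"
  proof (rule eq_matI)
    fix j k assume "j < dim_row (1\<^sub>m n :: complex mat)" "k < dim_col (1\<^sub>m n :: complex mat)"
    then have jk: "j < n" "k < n" by simp_all
    have "\<iota> (es ! k) \<in> dual u" using bij es_u[OF jk(2)] bij_betwE by blast
    from inv_iota_linear[OF this es_B[OF jk(1)]]
    have "(iota_mat * ?Q) $$ (j, k) = dual_vector u (es ! j) (inv_into u \<iota> (\<iota> (es ! k)))"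
      using jk by (simp add: iota_mat_def scalar_prod_def atLeast0LessThan)
    also have "inv_into u \<iota> (\<iota> (es ! k)) = es ! k" using bij es_u[OF jk(2)] by (rule bij_betw_inv_into_left)
    finally show "(iota_mat * ?Q) $$ (j, k) = 1\<^sub>m n $$ (j, k)" using jk by (simp add: dual_vector_es)
  qed (simp_all add: iota_mat_def)
  then have "det iota_mat * det ?Q = 1"
    using det_mult[of iota_mat n ?Q] by (simp add: iota_mat_def)
  then show ?thesis by auto
qed

text \<open>The endomorphism in \<open>P_det\<close> is \<omega> followed by the inverse of \<iota>.
  The row of \<omega> at a basis vector becomes a column of the endomorphism, which accounts for the
  transpose in the proof.\<close>

lemma P_det_eq: "P_det \<iota> = wconst (det iota_mat) * det omega_mat"
proof -
  interpret wc: comm_ring_hom "wconst :: complex \<Rightarrow> 'g functional wfun" by (rule wconst_hom)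
  let ?M = "mat n n (\<lambda>(j, k). Wfun (\<lambda>w. dual_vector u (es ! j) (omega_endo \<iota> (es ! k) w)))"
  have "?M = map_mat wconst iota_mat * transpose_mat omega_mat"
  proof (rule eq_matI)
    fix j k assume "j < dim_row (map_mat wconst iota_mat * transpose_mat omega_mat)"
      "k < dim_col (map_mat wconst iota_mat * transpose_mat omega_mat)"
    then have jk: "j < n" "k < n" by (simp_all add: iota_mat_def omega_mat_def)
    have "wcoeff (?M $$ (j, k)) w = wcoeff (\<Sum>i<n. wconst (iota_mat $$ (j, i)) * omega (es ! k) (es ! i)) w" for w
    proof -
      let ?\<phi> = "\<lambda>z. if z \<in> u then wcoeff (omega (es ! k) z) w else 0"
      have add: "wcoeff (omega z (x + y)) w = wcoeff (omega z x) w + wcoeff (omega z y) w"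
        and sc: "wcoeff (omega z (scale c x)) w = c * wcoeff (omega z x) w" for x y z c
        by (simp_all add: omega_antisym[of z] omega_add omega_scale wcoeff_wconst_mult)
      have "?\<phi> \<in> dual u"
        by (simp add: dual_def[of u] subspace_add[OF u_subspace] subspace_scale[OF u_subspace] add sc)
      from inv_iota_linear[OF this es_B[OF jk(1)]] have "wcoeff (?M $$ (j, k)) w
         = (\<Sum>i<n. dual_vector u (es ! j) (inv_into u \<iota> (dual_vector u (es ! i))) * ?\<phi> (es ! i))"
        using jk by (simp add: omega_endo_def)
      also have "\<dots> = (\<Sum>i<n. iota_mat $$ (j, i) * wcoeff (omega (es ! k) (es ! i)) w)"
        by (intro sum.cong refl) (use jk es_u in \<open>simp add: iota_mat_def\<close>)
      also have "\<dots> = wcoeff (\<Sum>i<n. wconst (iota_mat $$ (j, i)) * omega (es ! k) (es ! i)) w"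
      proof -
        have "wcoeff (\<Sum>i\<in>I. F i) w = (\<Sum>i\<in>I. wcoeff (F i) w)" for I and F :: "nat \<Rightarrow> 'g functional wfun"
          by (induction I rule: infinite_finite_induct) simp_all
        then show ?thesis by (simp add: wcoeff_wconst_mult)
      qed
      finally show ?thesis .
    qed
    then have "?M $$ (j, k) = (\<Sum>i<n. wconst (iota_mat $$ (j, i)) * omega (es ! k) (es ! i))" by (rule wfun_eqI)
    then show "?M $$ (j, k) = (map_mat wconst iota_mat * transpose_mat omega_mat) $$ (j, k)"
      using jk by (simp add: iota_mat_def omega_mat_def scalar_prod_def atLeast0LessThan)
  qed (simp_all add: iota_mat_def omega_mat_def)
  moreover have "P_det \<iota> = det ?M" by (simp add: P_det_def Let_def es_def n_def)
  ultimately have "P_det \<iota> = det (map_mat wconst iota_mat) * det (transpose_mat omega_mat)"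
    using det_mult[of "map_mat wconst iota_mat" n "transpose_mat omega_mat"]
    by (simp add: iota_mat_def omega_mat_def)
  also have "det (transpose_mat omega_mat) = det omega_mat" by (rule det_transpose[OF omega_mat_carrier])
  also have "det (map_mat (wconst :: complex \<Rightarrow> 'g functional wfun) iota_mat) = wconst (det iota_mat)"
    by (rule wc.hom_det)
  finally show ?thesis .
qed

lemma P_det_nonzero: "P_det \<iota> \<noteq> 0"
  by (simp add: P_det_eq det_omega_mat wconst_eq_0_iff det_iota_mat)

lemma P_det_in_FF: "P_det \<iota> \<in> dual_group_functions l"
  unfolding P_det_eq
  by (intro mult_in_FF wconst_in_FF det_in_FF[OF omega_mat_carrier])
    (simp add: omega_mat_def omega_in_dual_group_functions)

lemma cofactor_in_FF:
  assumes "i < n" "j < n"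
  shows "cofactor omega_mat i j \<in> dual_group_functions l"
proof -
  have e: "(- 1) ^ (i + j) = (wconst ((- 1) ^ (i + j)) :: 'g functional wfun)"
    by (cases "even (i + j)") (simp_all add: wconst_simps)
  have "mat_delete omega_mat i j \<in> carrier_mat (n - 1) (n - 1)"
    using omega_mat_carrier by (rule mat_delete_carrier)
  then have "det (mat_delete omega_mat i j) \<in> dual_group_functions l"
    by (rule det_in_FF) (auto simp: mat_delete_def omega_mat_def omega_in_dual_group_functions)
  then show ?thesis unfolding cofactor_def e by (intro mult_in_FF wconst_in_FF)
qed

text \<open>Cramer's rule. The cofactors are functions on \<open>L*\<close>, so one power of the
  denominator suffices.\<close>

lemma inverse_exists:
  "\<exists>s. is_inverse s \<and> (\<forall>i\<in>B. \<forall>j\<in>B. s i j \<in> localization (dual_group_functions l) (P_det \<iota>))"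
proof -
  let ?c = "wconst (det iota_mat) :: 'g functional wfun"
  define ix where "ix = inv_into {..<n} ((!) es)"
  have ix: "ix (es ! i) = i" if "i < n" for i
    unfolding ix_def using bij_betw_inv_into_left[OF bij_es] that by simp
  \<comment> \<open>The factor \<open>?c\<close> compensates for the denominator, which is
    \<open>?c\<close> times the determinant of \<omega>.\<close>
  define s where "s i j = Fract (?c * adj_mat omega_mat $$ (ix j, ix i)) (P_det \<iota>)" for i j
  have adj: "adj_mat omega_mat $$ (j, i) = cofactor omega_mat i j" if "i < n" "j < n" for i j
    using that omega_mat_carrier by (simp add: adj_mat_def)
  have "(\<Sum>j\<in>B. omf k j * s i j) = (if i = k then 1 else 0)" if ik: "i \<in> B" "k \<in> B" for i k
  proof -
    obtain i' k' where i': "i' < n" "i = es ! i'" and k': "k' < n" "k = es ! k'"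
      using es_cases[OF ik(1)] es_cases[OF ik(2)] by metis
    have "(\<Sum>j\<in>B. omf k j * s i j) = (\<Sum>j<n. Fract (?c * (omega_mat $$ (k', j) * adj_mat omega_mat $$ (j, i'))) (P_det \<iota>))"
      unfolding sum_B by (intro sum.cong refl) (simp add: omf_def s_def i' k' ix omega_mat_def mult_ac)
    also have "\<dots> = Fract (\<Sum>j<n. ?c * (omega_mat $$ (k', j) * adj_mat omega_mat $$ (j, i'))) (P_det \<iota>)"
    proof -
      have "(\<Sum>j\<in>J. Fract (F j) (P_det \<iota>)) = Fract (\<Sum>j\<in>J. F j) (P_det \<iota>)" for J and F :: "nat \<Rightarrow> 'g functional wfun"
      proof (induction J rule: infinite_finite_induct)
        case (insert j J)
        have "Fract (F j) (P_det \<iota>) + Fract (\<Sum>j\<in>J. F j) (P_det \<iota>) = Fract (F j + (\<Sum>j\<in>J. F j)) (P_det \<iota>)"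
          using P_det_nonzero by (simp add: eq_fract algebra_simps)
        then show ?case using insert by simp
      qed (simp_all add: fract_collapse)
      then show ?thesis .
    qed
    also have "(\<Sum>j<n. ?c * (omega_mat $$ (k', j) * adj_mat omega_mat $$ (j, i'))) = ?c * (omega_mat * adj_mat omega_mat) $$ (k', i')"
      using i' k' omega_mat_carrier adj_mat(1)[OF omega_mat_carrier]
      by (simp add: scalar_prod_def atLeast0LessThan sum_distrib_left)
    also have "\<dots> = (if i = k then P_det \<iota> else 0)"
      using i' k' es(1)
      by (auto simp: adj_mat(2)[OF omega_mat_carrier] P_det_eq n_def nth_eq_iff_index_eq)
    finally have "(\<Sum>j\<in>B. omf k j * s i j) = Fract (if i = k then P_det \<iota> else 0) (P_det \<iota>)" .
    moreover have "Fract (P_det \<iota>) (P_det \<iota>) = 1"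
      unfolding One_fract_def using P_det_nonzero by (subst eq_fract(1)) simp_all
    ultimately show ?thesis by (simp add: fract_collapse)
  qed
  moreover have "s i j \<in> localization (dual_group_functions l) (P_det \<iota>)" if ik: "i \<in> B" "j \<in> B" for i j
  proof -
    obtain i' j' where ij: "i' < n" "i = es ! i'" "j' < n" "j = es ! j'"
      using es_cases[OF ik(1)] es_cases[OF ik(2)] by metis
    then have "?c * adj_mat omega_mat $$ (ix j, ix i) \<in> dual_group_functions l"
      by (simp add: ix adj mult_in_FF wconst_in_FF cofactor_in_FF)
    then show ?thesis unfolding localization_def s_def mem_Collect_eq by (metis power_one_right)
  qed
  ultimately show ?thesis by blast
qed

lemma sigma_eq_tensor_of:
  obtains s where "is_inverse s" "sigma \<iota> = tensor_of s"
    "\<And>i j. i \<in> B \<Longrightarrow> j \<in> B \<Longrightarrow> s i j \<in> localization (dual_group_functions l) (P_det \<iota>)"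
proof -
  obtain s where s: "is_inverse s"
    "\<And>i j. i \<in> B \<Longrightarrow> j \<in> B \<Longrightarrow> s i j \<in> localization (dual_group_functions l) (P_det \<iota>)"
    using inverse_exists by blast
  have "sigma \<iota> = tensor_of s"
    unfolding sigma_def
  proof (rule the_equality)
    show "is_sigma \<iota> (tensor_of s)" by (rule is_sigma_tensor_of[OF s])
  qed (rule is_sigma_unique[OF s(1)])
  then show ?thesis using that s by blast
qed

end

end

section \<open>The dynamical Yang-Baxter equation\<close>

lemma sum_product_contract:
  fixes A :: "'a \<Rightarrow> 'a \<Rightarrow> 'k::comm_ring_1" and d :: "'a \<Rightarrow> 'b \<Rightarrow> 'k"
  shows "(\<Sum>e\<in>X. \<Sum>e'\<in>X. A e e' * ((\<Sum>p\<in>I. d e p * f p) * (\<Sum>q\<in>I. d e' q * g q)))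
    = (\<Sum>p\<in>I. \<Sum>q\<in>I. (\<Sum>e\<in>X. \<Sum>e'\<in>X. A e e' * (d e p * d e' q)) * (f p * g q))"
proof -
  have "(\<Sum>e\<in>X. \<Sum>e'\<in>X. A e e' * ((\<Sum>p\<in>I. d e p * f p) * (\<Sum>q\<in>I. d e' q * g q)))
    = (\<Sum>e\<in>X. \<Sum>e'\<in>X. \<Sum>p\<in>I. \<Sum>q\<in>I. A e e' * (d e p * d e' q) * (f p * g q))"
    by (simp only: sum_product, simp only: sum_distrib_left, simp only: mult_ac)
  also have "\<dots> = (\<Sum>e\<in>X. \<Sum>p\<in>I. \<Sum>e'\<in>X. \<Sum>q\<in>I. A e e' * (d e p * d e' q) * (f p * g q))"
    by (intro sum.cong refl sum.swap)
  also have "\<dots> = (\<Sum>p\<in>I. \<Sum>e\<in>X. \<Sum>e'\<in>X. \<Sum>q\<in>I. A e e' * (d e p * d e' q) * (f p * g q))"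
    by (rule sum.swap)
  also have "\<dots> = (\<Sum>p\<in>I. \<Sum>e\<in>X. \<Sum>q\<in>I. \<Sum>e'\<in>X. A e e' * (d e p * d e' q) * (f p * g q))"
    by (intro sum.cong refl sum.swap)
  also have "\<dots> = (\<Sum>p\<in>I. \<Sum>q\<in>I. \<Sum>e\<in>X. \<Sum>e'\<in>X. A e e' * (d e p * d e' q) * (f p * g q))"
    by (intro sum.cong refl sum.swap)
  finally show ?thesis by (simp only: sum_distrib_right)
qed

lemma fract_der_const: "derivation D \<Longrightarrow> D (wconst c) = 0 \<Longrightarrow> fract_der D (fract_const c) = 0"
  by (simp add: fract_const_def fract_der_of_wfun fract_collapse)

context split_lie_bialgebra
begin

abbreviation \<kappa> :: "complex \<Rightarrow> 'g fractions" where "\<kappa> \<equiv> fract_const"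

lemma derivation_dress: "derivation (dress l a)"
  unfolding dress_def by (intro derivation_neg derivation_scaled_sum derivation_R_der)

lemma dress_wconst: "dress l a (wconst c) = 0"
proof -
  have "R_der \<xi> (wconst c) = 0" for \<xi> :: "'g functional"
    by (rule wfun_eqI) (simp add: R_der_def wconst_def)
  then show ?thesis by (simp add: dress_def)
qed

definition dl_part :: "'g functional \<Rightarrow> 'g functional" where
  "dl_part \<phi> = (\<lambda>x. \<phi> (l_part x))"

lemma dl_part_in_dual: "\<phi> \<in> dual UNIV \<Longrightarrow> dl_part \<phi> \<in> dual UNIV"
  by (simp add: dual_UNIV_iff dl_part_def l_part_add l_part_scale)

lemma dl_part_u: "\<phi> \<in> dual UNIV \<Longrightarrow> x \<in> u \<Longrightarrow> dl_part \<phi> x = 0"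
  by (simp add: dl_part_def l_part_u dual_simps(3))

lemma dl_part_sum:
  assumes "\<phi> \<in> dual UNIV"
  shows "dl_part \<phi> = (\<lambda>x. \<Sum>e\<in>basis_of l. \<phi> e * embed (dual_vector l e) x)"
proof
  fix x
  show "dl_part \<phi> x = (\<Sum>e\<in>basis_of l. \<phi> e * embed (dual_vector l e) x)"
    unfolding dl_part_def embed_def
    using arg_cong[OF basis_expansion[OF l_subspace l_part(1)[of x]], of \<phi>]
    by (simp add: dual_simps[OF assms] mult.commute)
qed

lemma functional_split:
  assumes "\<phi> \<in> dual UNIV"
  shows "\<kappa> (\<phi> x) = \<kappa> (dl_part \<phi> x) + (\<Sum>e\<in>B. \<kappa> (\<phi> e) * \<kappa> (u_coord e x))"
  using dual_split[OF assms, of x] by (simp add: dl_part_def fract_const_sum fract_const_simps)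

text \<open>The components of \<delta>(p) in l \<otimes> u, u \<otimes> l and u \<otimes> u;
  antisymmetry gives the minus sign of the second, and the component in l \<otimes> l is zero for
  \<open>p\<close> in \<open>u\<close>.\<close>

lemma cobr_split:
  assumes phi: "\<phi> \<in> dual UNIV" and psi: "\<psi> \<in> dual UNIV" and p: "p \<in> u"
  shows "\<kappa> (\<delta> p \<phi> \<psi>) = (\<Sum>j\<in>B. \<kappa> (\<psi> j) * \<kappa> (\<delta> p (dl_part \<phi>) (u_coord j)))
    - (\<Sum>i\<in>B. \<kappa> (\<phi> i) * \<kappa> (\<delta> p (dl_part \<psi>) (u_coord i)))
    + (\<Sum>i\<in>B. \<Sum>j\<in>B. \<kappa> (\<phi> i) * \<kappa> (\<psi> j) * \<kappa> (\<delta> p (u_coord i) (u_coord j)))"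
proof -
  let ?u = "\<lambda>\<phi> x. \<Sum>e\<in>B. \<phi> e * u_coord e x"
  have s: "\<phi> = (\<lambda>x. dl_part \<phi> x + ?u \<phi> x)" if "\<phi> \<in> dual UNIV" for \<phi>
    unfolding dl_part_def by (rule ext) (rule dual_split[OF that])
  have ud: "?u \<phi> \<in> dual UNIV" for \<phi> by (intro dual_sum dual_scale u_coord_in_dual)
  have "\<delta> p \<phi> \<psi> = \<delta> p (\<lambda>x. dl_part \<phi> x + ?u \<phi> x) (\<lambda>x. dl_part \<psi> x + ?u \<psi> x)"
    using s[OF phi] s[OF psi] by simp
  also have "\<dots> = \<delta> p (dl_part \<phi>) (dl_part \<psi>) + \<delta> p (dl_part \<phi>) (?u \<psi>)
     + (\<delta> p (?u \<phi>) (dl_part \<psi>) + \<delta> p (?u \<phi>) (?u \<psi>))"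
    by (simp only: cobr_linear_left(1)[OF dl_part_in_dual[OF phi] ud]
        cobr_linear_right(1)[OF dl_part_in_dual[OF psi] ud])
  also have "\<delta> p (dl_part \<phi>) (dl_part \<psi>) = 0"
    using phi psi by (intro cobr_u_vanish[OF p]) (simp_all add: dl_part_u)
  also have "\<delta> p (?u \<phi>) (dl_part \<psi>) = - \<delta> p (dl_part \<psi>) (?u \<phi>)" by (rule cobr_antisym)
  also have "\<delta> p (?u \<phi>) (?u \<psi>) = (\<Sum>i\<in>B. \<Sum>j\<in>B. \<phi> i * \<psi> j * \<delta> p (u_coord i) (u_coord j))"
    unfolding cobr_sum_left[OF u_coord_in_dual] cobr_sum_right[OF u_coord_in_dual] sum_distrib_left
    by (simp only: mult.assoc)
  finally show ?thesis
    unfolding cobr_sum_right[OF u_coord_in_dual] by (simp add: fract_const_sum fract_const_simps)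
qed

section \<open>Both axioms for the tensor of an inverse of omega\<close>

context
  fixes s assumes s: "is_inverse s"
begin

interpretation skew_inverse B omf s by (rule skew_inverseI[OF s])

lemma tensor_of_derivation:
  assumes D: "derivation D" "\<And>c. D (\<kappa> c) = 0" and "\<phi> \<in> dual UNIV" "\<psi> \<in> dual UNIV"
  shows "D (tensor_of s \<phi> \<psi>) = (\<Sum>i\<in>B. \<Sum>j\<in>B. \<kappa> (\<phi> i) * \<kappa> (\<psi> j) * D (s i j))"
  using assms(3,4)
  by (simp add: tensor_of_def derivation_sum[OF D(1)] derivation_mult[OF D(1)] D(2))

text \<open>Since \<open>a\<close> preserves \<open>u\<close>, one matrix \<open>?\<alpha>\<close>
  describes both its action on the tensor and the dressing derivative of \<omega>;
  \<open>derivation_s_invariant\<close> then compares them entry by entry.\<close>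

lemma tensor_of_invariant:
  assumes a: "a \<in> l" and phi: "\<phi> \<in> dual UNIV" and psi: "\<psi> \<in> dual UNIV"
  shows "fract_der (dress l a) (tensor_of s \<phi> \<psi>) + ad2 br a (tensor_of s) \<phi> \<psi> = 0"
proof -
  let ?D = "fract_der (dress l a)" and ?\<alpha> = "\<lambda>p r. \<kappa> (u_coord r (br a p))"
  have D: "derivation ?D" "?D (\<kappa> c) = 0" for c
    by (intro derivation_fract_der fract_der_const derivation_dress dress_wconst)+
  have DW: "?D (omf p q) = (\<Sum>r\<in>B. ?\<alpha> p r * omf r q) + (\<Sum>r\<in>B. ?\<alpha> q r * omf p r)"
    if "p \<in> B" "q \<in> B" for p q
  proof -
    have "?D (omf p q) = omf (br a p) q + omf p (br a q)"
      unfolding omf_def using dress_omega[OF a B_u B_u, OF that]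
      by (simp add: fract_der_of_wfun[OF derivation_dress])
    then show ?thesis
      using omf_expansion(1)[OF br_l_u[OF a B_u[OF that(1)]], of q]
        omf_expansion(2)[OF br_l_u[OF a B_u[OF that(2)]], of p] by simp
  qed
  have ad: "\<kappa> (\<theta> (br a i)) = (\<Sum>r\<in>B. \<kappa> (\<theta> r) * ?\<alpha> i r)" if "\<theta> \<in> dual UNIV" "i \<in> B" for \<theta> i
    by (rule fract_const_expansion[OF that(1) br_l_u[OF a B_u[OF that(2)]]])
  have "tensor_of s (\<lambda>z. \<phi> (br a z)) \<psi> = (\<Sum>i\<in>B. \<Sum>j\<in>B. \<kappa> (\<phi> (br a i)) * \<kappa> (\<psi> j) * s i j)"
    using phi psi by (simp add: tensor_of_def dual_br_right)
  also have "\<dots> = (\<Sum>i\<in>B. \<Sum>j\<in>B. \<Sum>r\<in>B. \<kappa> (\<phi> r) * \<kappa> (\<psi> j) * (?\<alpha> i r * s i j))"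
    by (intro sum.cong refl) (simp add: ad[OF phi] sum_distrib_left mult_ac)
  also have "\<dots> = (\<Sum>i\<in>B. \<Sum>r\<in>B. \<Sum>j\<in>B. \<kappa> (\<phi> r) * \<kappa> (\<psi> j) * (?\<alpha> i r * s i j))"
    by (intro sum.cong refl sum.swap)
  also have "\<dots> = (\<Sum>r\<in>B. \<Sum>i\<in>B. \<Sum>j\<in>B. \<kappa> (\<phi> r) * \<kappa> (\<psi> j) * (?\<alpha> i r * s i j))" by (rule sum.swap)
  also have "\<dots> = (\<Sum>r\<in>B. \<Sum>j\<in>B. \<Sum>i\<in>B. \<kappa> (\<phi> r) * \<kappa> (\<psi> j) * (?\<alpha> i r * s i j))"
    by (intro sum.cong refl sum.swap)
  finally have 1: "tensor_of s (\<lambda>z. \<phi> (br a z)) \<psi> = \<dots>" .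
  have "tensor_of s \<phi> (\<lambda>z. \<psi> (br a z)) = (\<Sum>i\<in>B. \<Sum>j\<in>B. \<kappa> (\<phi> i) * \<kappa> (\<psi> (br a j)) * s i j)"
    using phi psi by (simp add: tensor_of_def dual_br_right)
  also have "\<dots> = (\<Sum>i\<in>B. \<Sum>j\<in>B. \<Sum>r\<in>B. \<kappa> (\<phi> i) * \<kappa> (\<psi> r) * (?\<alpha> j r * s i j))"
    by (intro sum.cong refl) (simp add: ad[OF psi] sum_distrib_left mult_ac)
  also have "\<dots> = (\<Sum>i\<in>B. \<Sum>r\<in>B. \<Sum>j\<in>B. \<kappa> (\<phi> i) * \<kappa> (\<psi> r) * (?\<alpha> j r * s i j))"
    by (intro sum.cong refl sum.swap)
  finally have 2: "tensor_of s \<phi> (\<lambda>z. \<psi> (br a z)) = \<dots>" .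
  have "?D (tensor_of s \<phi> \<psi>) + ad2 br a (tensor_of s) \<phi> \<psi> = (\<Sum>i\<in>B. \<Sum>j\<in>B. \<kappa> (\<phi> i) * \<kappa> (\<psi> j) *
      (?D (s i j) + (\<Sum>k\<in>B. ?\<alpha> k i * s k j) + (\<Sum>k\<in>B. ?\<alpha> k j * s i k)))"
    unfolding tensor_of_derivation[OF D phi psi] ad2_def 1 2
    by (simp only: distrib_left sum.distrib sum_distrib_left add.assoc)
  also have "\<dots> = 0"
    by (intro sum.neutral ballI) (simp add: derivation_s_invariant[OF D(1) _ _ DW])
  finally show ?thesis .
qed

text \<open>The coefficient at \<open>p\<close> of the tensor after its second leg has been paired
  with \<psi>.\<close>

definition row :: "'g \<Rightarrow> 'g functional \<Rightarrow> 'g fractions" where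
  "row p \<psi> = (\<Sum>j\<in>B. \<kappa> (\<psi> j) * s p j)"

definition cyb1 :: "('g, 'g fractions) tensor3" where
  "cyb1 \<phi> \<psi> \<chi> = (\<Sum>p\<in>B. \<Sum>q\<in>B. \<kappa> (\<phi> (br p q)) * (row p \<psi> * row q \<chi>))"

lemma tensor_of_row:
  "\<phi> \<in> dual UNIV \<Longrightarrow> \<psi> \<in> dual UNIV \<Longrightarrow> tensor_of s \<phi> \<psi> = (\<Sum>p\<in>B. \<kappa> (\<phi> p) * row p \<psi>)"
  by (simp add: tensor_of_def row_def sum_distrib_left mult.assoc)

lemma br_expansion:
  assumes "\<phi> \<in> dual UNIV"
  shows "(\<Sum>e\<in>basis_of UNIV. \<Sum>e'\<in>basis_of UNIV.
    \<kappa> (\<phi> (br e e')) * (\<kappa> (dual_vector UNIV e p) * \<kappa> (dual_vector UNIV e' q))) = \<kappa> (\<phi> (br p q))"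
proof -
  have 1: "\<phi> (br p q) = (\<Sum>e\<in>basis_of UNIV. \<phi> (br e q) * dual_vector UNIV e p)" for p q
    using dual_expansion[OF subspace_UNIV dual_br_left[OF assms, of q] UNIV_I, of p] .
  have 2: "\<phi> (br e q) = (\<Sum>e'\<in>basis_of UNIV. \<phi> (br e e') * dual_vector UNIV e' q)" for e q
    using dual_expansion[OF subspace_UNIV dual_br_right[OF assms, of e] UNIV_I, of q] .
  have "\<phi> (br p q) = (\<Sum>e\<in>basis_of UNIV. \<Sum>e'\<in>basis_of UNIV.
    \<phi> (br e e') * (dual_vector UNIV e p * dual_vector UNIV e' q))"
    by (subst 1, subst 2) (simp add: sum_distrib_left sum_distrib_right mult_ac)
  then show ?thesis by (simp add: fract_const_sum fract_const_simps)
qed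

lemma cyb1_expansion:
  assumes "\<phi> \<in> dual UNIV" "\<psi> \<in> dual UNIV" "\<chi> \<in> dual UNIV"
  shows "(\<Sum>e\<in>basis_of UNIV. \<Sum>e'\<in>basis_of UNIV. \<kappa> (\<phi> (br e e')) *
    (tensor_of s (dual_vector UNIV e) \<psi> * tensor_of s (dual_vector UNIV e') \<chi>)) = cyb1 \<phi> \<psi> \<chi>"
  using assms
  by (simp add: tensor_of_row dual_vector_in_dual[OF subspace_UNIV] sum_product_contract br_expansion cyb1_def)

lemma cyb1_swap:
  assumes "\<phi> \<in> dual UNIV"
  shows "cyb1 \<phi> \<chi> \<psi> = - cyb1 \<phi> \<psi> \<chi>"
proof -
  have "cyb1 \<phi> \<chi> \<psi> = (\<Sum>q\<in>B. \<Sum>p\<in>B. \<kappa> (\<phi> (br p q)) * (row p \<chi> * row q \<psi>))"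
    unfolding cyb1_def by (rule sum.swap)
  also have "\<dots> = (\<Sum>q\<in>B. \<Sum>p\<in>B. - (\<kappa> (\<phi> (br q p)) * (row q \<psi> * row p \<chi>)))"
  proof (intro sum.cong refl)
    fix p q
    have "\<phi> (br p q) = - \<phi> (br q p)"
      unfolding br_antisym[of p q] by (rule dual_simps(4)[OF assms])
    then show "\<kappa> (\<phi> (br p q)) * (row p \<chi> * row q \<psi>) = - (\<kappa> (\<phi> (br q p)) * (row q \<psi> * row p \<chi>))"
      by (simp add: fract_const_simps)
  qed
  finally show ?thesis by (simp add: cyb1_def sum_negf)
qed

text \<open>Skewness of the tensor turns the second and third commutators into the first one with
  its arguments rotated. \<open>CYB\<close> becomes a cyclic sum, matching the two terms with
  \<open>Alt\<close>.\<close>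

lemma CYB_cyb1:
  assumes "\<phi> \<in> dual UNIV" "\<psi> \<in> dual UNIV" "\<chi> \<in> dual UNIV"
  shows "CYB (tensor_of s) \<phi> \<psi> \<chi> = cyb1 \<phi> \<psi> \<chi> + cyb1 \<psi> \<chi> \<phi> + cyb1 \<chi> \<phi> \<psi>"
proof -
  note sk = tensor_of_skew[OF s, of \<phi>] tensor_of_skew[OF s, of \<psi>]
  show ?thesis
    unfolding CYB_def Let_def cyb1_expansion[OF assms(1,2,3)] sk(1) sk(2)[of "dual_vector UNIV _"]
    using cyb1_expansion[OF assms(2,1,3)] cyb1_expansion[OF assms(3,1,2)] cyb1_swap[OF assms(2), of \<phi> \<chi>]
    by (simp add: sum_negf)
qed

lemma cobracket_first_row:
  "\<chi> \<in> dual UNIV \<Longrightarrow> cobracket_first \<delta> (tensor_of s) \<phi> \<psi> \<chi> = (\<Sum>p\<in>B. \<kappa> (\<delta> p \<phi> \<psi>) * row p \<chi>)"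
  unfolding cobracket_first_def by (simp add: tensor_of_row cobr_dual)

text \<open>The left derivative along the restriction of \<chi> to \<open>l\<close>. Pairing the
  last leg of \<open>dL\<close> with \<chi> gives a single derivation, up to sign.\<close>

definition dL_der :: "'g functional \<Rightarrow> 'g fractions \<Rightarrow> 'g fractions" where
  "dL_der \<chi> f = (\<Sum>e\<in>basis_of l. \<kappa> (\<chi> e) * fract_der (L_der (dual_vector l e)) f)"

lemma dL_eq: "dL l \<rho> \<phi> \<psi> \<chi> = - dL_der \<chi> (\<rho> \<phi> \<psi>)"
  by (simp add: dL_def dL_der_def)

lemma derivation_dL_der: "derivation (dL_der \<chi>)"
  unfolding dL_der_def by (intro derivation_scaled_sum derivation_fract_der derivation_L_der)

lemma dL_der_const: "dL_der \<chi> (\<kappa> c) = 0"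
proof -
  have "L_der \<xi> (wconst c) = 0" for \<xi> :: "'g functional"
    by (rule wfun_eqI) (simp add: L_der_def wconst_def)
  then show ?thesis by (simp add: dL_der_def fract_der_const derivation_L_der)
qed

lemma fract_der_L_der_omf:
  assumes xi: "\<xi> \<in> dual l" and p: "p \<in> u" and q: "q \<in> u"
  shows "fract_der (L_der \<xi>) (omf p q) = - ((\<Sum>r\<in>B. \<kappa> (\<delta> p (embed \<xi>) (u_coord r)) * omf r q)
    + (\<Sum>r\<in>B. \<kappa> (\<delta> q (embed \<xi>) (u_coord r)) * omf p r)) - \<kappa> (embed \<xi> (br p q))"
proof -
  have cu: "contract (embed \<xi>) p \<in> u" if "p \<in> u" for p
    using xi lift_u by (intro contract_u[OF that]) (simp add: embed_in_dual lift_embed[symmetric])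
  have uc: "u_coord r (contract (embed \<xi>) p) = \<delta> p (embed \<xi>) (u_coord r)" for r p
    using xi by (simp add: dual_contract embed_in_dual)
  have "fract_der (L_der \<xi>) (omf p q)
     = - omf (contract (embed \<xi>) p) q - omf p (contract (embed \<xi>) q) - \<kappa> (embed \<xi> (br p q))"
    unfolding omf_def fract_der_of_wfun[OF derivation_L_der] L_der_omega[OF xi] Fract_1_simps Fract_wconst ..
  then show ?thesis
    using omf_expansion(1)[OF cu[OF p], of q] omf_expansion(2)[OF cu[OF q], of p] by (simp add: uc)
qed

lemma dL_der_omf:
  assumes chi: "\<chi> \<in> dual UNIV" and p: "p \<in> B" and q: "q \<in> B"
  shows "dL_der \<chi> (omf p q) = - ((\<Sum>r\<in>B. \<kappa> (\<delta> p (dl_part \<chi>) (u_coord r)) * omf r q)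
    + (\<Sum>r\<in>B. \<kappa> (\<delta> q (dl_part \<chi>) (u_coord r)) * omf p r)) - \<kappa> (dl_part \<chi> (br p q))"
proof -
  let ?e = "\<lambda>e. embed (dual_vector l e)"
  have ed: "?e e \<in> dual UNIV" for e by (rule embed_in_dual[OF dual_vector_in_dual[OF l_subspace]])
  have c: "\<kappa> (\<delta> x (dl_part \<chi>) \<psi>) = (\<Sum>e\<in>basis_of l. \<kappa> (\<chi> e) * \<kappa> (\<delta> x (?e e) \<psi>))" for x \<psi>
    unfolding dl_part_sum[OF chi] cobr_sum_left[OF ed] by (simp add: fract_const_sum fract_const_simps)
  have b: "\<kappa> (dl_part \<chi> x) = (\<Sum>e\<in>basis_of l. \<kappa> (\<chi> e) * \<kappa> (?e e x))" for x
    unfolding dl_part_sum[OF chi] by (simp add: fract_const_sum fract_const_simps)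
  have sw: "(\<Sum>e\<in>basis_of l. \<kappa> (\<chi> e) * (\<Sum>r\<in>B. F e r * G r)) = (\<Sum>r\<in>B. (\<Sum>e\<in>basis_of l. \<kappa> (\<chi> e) * F e r) * G r)"
    for F G
    by (simp add: sum_distrib_left sum_distrib_right mult_ac) (rule sum.swap)
  have "dL_der \<chi> (omf p q) = (\<Sum>e\<in>basis_of l. \<kappa> (\<chi> e) *
    (- ((\<Sum>r\<in>B. \<kappa> (\<delta> p (?e e) (u_coord r)) * omf r q) + (\<Sum>r\<in>B. \<kappa> (\<delta> q (?e e) (u_coord r)) * omf p r))
      - \<kappa> (?e e (br p q))))"
    unfolding dL_der_def fract_der_L_der_omf[OF dual_vector_in_dual[OF l_subspace] B_u[OF p] B_u[OF q]] ..
  also have "\<dots> = - ((\<Sum>e\<in>basis_of l. \<kappa> (\<chi> e) * (\<Sum>r\<in>B. \<kappa> (\<delta> p (?e e) (u_coord r)) * omf r q))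
     + (\<Sum>e\<in>basis_of l. \<kappa> (\<chi> e) * (\<Sum>r\<in>B. \<kappa> (\<delta> q (?e e) (u_coord r)) * omf p r)))
     - (\<Sum>e\<in>basis_of l. \<kappa> (\<chi> e) * \<kappa> (?e e (br p q)))"
    by (simp only: right_diff_distrib mult_minus_right distrib_left sum.distrib sum_subtractf sum_negf)
  finally show ?thesis unfolding sw c b .
qed

lemma luu_identity:
  assumes "\<phi> \<in> dual UNIV" "j \<in> B" "k \<in> B"
  shows "(\<Sum>p\<in>B. \<Sum>q\<in>B. \<kappa> (dl_part \<phi> (br p q)) * s p j * s q k) - dL_der \<phi> (s j k)
    + (\<Sum>p\<in>B. \<kappa> (\<delta> p (dl_part \<phi>) (u_coord j)) * s p k)
    - (\<Sum>p\<in>B. \<kappa> (\<delta> p (dl_part \<phi>) (u_coord k)) * s p j) = 0"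
proof (rule dynamical_identity_luu[OF derivation_dL_der assms(2,3)])
  show "\<kappa> (dl_part \<phi> (br q p)) = - \<kappa> (dl_part \<phi> (br p q))" for p q
    unfolding br_antisym[of q p] dual_simps(4)[OF dl_part_in_dual[OF assms(1)]] fract_const_simps ..
qed (rule dL_der_omf[OF assms(1)])

lemma uuu_identity:
  fixes i j k
  defines "U \<equiv> \<lambda>i j k. (\<Sum>p\<in>B. \<Sum>q\<in>B. \<kappa> (u_coord i (br p q)) * s p j * s q k)
    + (\<Sum>p\<in>B. \<kappa> (\<delta> p (u_coord i) (u_coord j)) * s p k)"
  assumes "i \<in> B" "j \<in> B" "k \<in> B"
  shows "U i j k + U j k i + U k i j = 0"
  unfolding U_def
proof (rule dynamical_identity_uuu[OF _ assms(2-4)])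
  fix a b c assume abc: "a \<in> B" "b \<in> B" "c \<in> B"
  \<comment> \<open>A bracket of elements of \<open>u\<close> may have a part in \<open>l\<close>,
    but \<omega>(a, -) does not see it, so the coordinates on \<open>u\<close> determine the
    value.\<close>
  have br: "(\<Sum>r\<in>B. omf a r * \<kappa> (u_coord r (br b c))) = omf a (br b c)" if "a \<in> B" for a b c
  proof -
    let ?z = "br b c"
    have z: "?z = (?z - l_part ?z) + l_part ?z" by simp
    have uc: "u_coord r (?z - l_part ?z) = u_coord r ?z" for r
      by (simp add: dual_simps[OF u_coord_in_dual] u_coord_l l_part)
    have "omega a ?z = omega a (?z - l_part ?z) + omega a (l_part ?z)"
      by (subst (1) z) (simp only: omega_antisym[of a] omega_add minus_add_distrib)
    also have "omega a (l_part ?z) = 0"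
      using omega_l_u[OF l_part(1) B_u[OF that]] by (simp add: omega_antisym[of a])
    finally have "omf a ?z = omf a (?z - l_part ?z)" by (simp add: omf_def)
    also have "\<dots> = (\<Sum>r\<in>B. \<kappa> (u_coord r ?z) * omf a r)"
      unfolding omf_expansion(2)[OF l_part(2)] uc ..
    finally show ?thesis by (simp only: mult.commute)
  qed
  let ?q = "\<lambda>x y z. \<Sum>i\<in>B. \<Sum>j\<in>B. wconst (\<delta> x (u_coord i) (u_coord j)) * (omega y i * omega z j)"
  have q: "(\<Sum>r\<in>B. \<Sum>t\<in>B. \<kappa> (\<delta> c (u_coord r) (u_coord t)) * (omf a r * omf b t)) = Fract (?q c a b) 1" for a b c
    unfolding omf_def Fract_1_sum Fract_1_simps Fract_wconst ..
  have "Fract (omega a (br b c) + omega b (br c a) + omega c (br a b) + ?q a b c + ?q b c a + ?q c a b) 1 = 0"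
    unfolding omega_lagrangian[OF B_u B_u B_u, OF abc] by (rule Fract_1_simps)
  then have "omf a (br b c) + omf b (br c a) + omf c (br a b)
      + Fract (?q a b c) 1 + Fract (?q b c a) 1 + Fract (?q c a b) 1 = 0"
    unfolding omf_def Fract_1_simps(1) .
  then show "(\<Sum>r\<in>B. omf a r * \<kappa> (u_coord r (br b c)))
      + (\<Sum>r\<in>B. \<Sum>t\<in>B. \<kappa> (\<delta> c (u_coord r) (u_coord t)) * (omf a r * omf b t))
    + ((\<Sum>r\<in>B. omf b r * \<kappa> (u_coord r (br c a)))
      + (\<Sum>r\<in>B. \<Sum>t\<in>B. \<kappa> (\<delta> a (u_coord r) (u_coord t)) * (omf b r * omf c t)))
    + ((\<Sum>r\<in>B. omf c r * \<kappa> (u_coord r (br a b)))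
      + (\<Sum>r\<in>B. \<Sum>t\<in>B. \<kappa> (\<delta> b (u_coord r) (u_coord t)) * (omf c r * omf a t))) = 0"
    unfolding q br[OF abc(1)] br[OF abc(2)] br[OF abc(3)] by (simp only: ac_simps)
qed

definition triple :: "('g \<Rightarrow> 'g \<Rightarrow> 'g \<Rightarrow> 'g fractions) \<Rightarrow> ('g, 'g fractions) tensor3" where
  "triple F \<phi> \<psi> \<chi> = (\<Sum>i\<in>B. \<Sum>j\<in>B. \<Sum>k\<in>B. \<kappa> (\<phi> i) * (\<kappa> (\<psi> j) * (\<kappa> (\<chi> k) * F i j k)))"

lemma triple_rotate: "triple F \<psi> \<chi> \<phi> = triple (\<lambda>i j k. F j k i) \<phi> \<psi> \<chi>"
proof -
  have "triple F \<psi> \<chi> \<phi> = (\<Sum>j\<in>B. \<Sum>k\<in>B. \<Sum>i\<in>B. \<kappa> (\<phi> i) * (\<kappa> (\<psi> j) * (\<kappa> (\<chi> k) * F j k i)))"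
    unfolding triple_def by (simp only: mult_ac)
  also have "\<dots> = (\<Sum>j\<in>B. \<Sum>i\<in>B. \<Sum>k\<in>B. \<kappa> (\<phi> i) * (\<kappa> (\<psi> j) * (\<kappa> (\<chi> k) * F j k i)))"
    by (intro sum.cong refl sum.swap)
  also have "\<dots> = triple (\<lambda>i j k. F j k i) \<phi> \<psi> \<chi>" unfolding triple_def by (rule sum.swap)
  finally show ?thesis .
qed

lemma sum_row_row:
  "(\<Sum>p\<in>B. \<Sum>q\<in>B. L p q * (row p \<psi> * row q \<chi>))
    = (\<Sum>j\<in>B. \<Sum>k\<in>B. \<kappa> (\<psi> j) * (\<kappa> (\<chi> k) * (\<Sum>p\<in>B. \<Sum>q\<in>B. L p q * s p j * s q k)))"
proof -
  have r: "row p \<psi> = (\<Sum>j\<in>B. s p j * \<kappa> (\<psi> j))" for p \<psi>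
    unfolding row_def by (simp only: mult.commute)
  show ?thesis unfolding r sum_product_contract by (simp only: mult_ac)
qed

lemma sum_row:
  "(\<Sum>p\<in>B. (\<Sum>j\<in>B. \<kappa> (\<psi> j) * c p j) * row p \<chi>)
    = (\<Sum>j\<in>B. \<Sum>k\<in>B. \<kappa> (\<psi> j) * (\<kappa> (\<chi> k) * (\<Sum>p\<in>B. c p j * s p k)))"
proof -
  have "(\<Sum>p\<in>B. (\<Sum>j\<in>B. \<kappa> (\<psi> j) * c p j) * row p \<chi>)
    = (\<Sum>p\<in>B. \<Sum>j\<in>B. \<Sum>k\<in>B. \<kappa> (\<psi> j) * (\<kappa> (\<chi> k) * (c p j * s p k)))"
    unfolding row_def sum_product by (simp only: mult_ac)
  also have "\<dots> = (\<Sum>j\<in>B. \<Sum>p\<in>B. \<Sum>k\<in>B. \<kappa> (\<psi> j) * (\<kappa> (\<chi> k) * (c p j * s p k)))" by (rule sum.swap)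
  also have "\<dots> = (\<Sum>j\<in>B. \<Sum>k\<in>B. \<Sum>p\<in>B. \<kappa> (\<psi> j) * (\<kappa> (\<chi> k) * (c p j * s p k)))"
    by (intro sum.cong refl sum.swap)
  finally show ?thesis by (simp only: sum_distrib_left)
qed

text \<open>All terms whose \<phi> leg lies in \<open>l\<close>: a commutator, a left derivative,
  and the two cobrackets in which \<phi> is one of the two legs of \<delta>.\<close>

lemma luu_part:
  assumes phi: "\<phi> \<in> dual UNIV" and psi: "\<psi> \<in> dual UNIV" and chi: "\<chi> \<in> dual UNIV"
  shows "(\<Sum>p\<in>B. \<Sum>q\<in>B. \<kappa> (dl_part \<phi> (br p q)) * (row p \<psi> * row q \<chi>)) - dL_der \<phi> (tensor_of s \<psi> \<chi>)
    + (\<Sum>p\<in>B. (\<Sum>j\<in>B. \<kappa> (\<psi> j) * \<kappa> (\<delta> p (dl_part \<phi>) (u_coord j))) * row p \<chi>)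
    - (\<Sum>p\<in>B. (\<Sum>k\<in>B. \<kappa> (\<chi> k) * \<kappa> (\<delta> p (dl_part \<phi>) (u_coord k))) * row p \<psi>) = 0"
proof -
  let ?c = "\<lambda>p j. \<kappa> (\<delta> p (dl_part \<phi>) (u_coord j))"
  have 4: "(\<Sum>p\<in>B. (\<Sum>k\<in>B. \<kappa> (\<chi> k) * ?c p k) * row p \<psi>)
    = (\<Sum>j\<in>B. \<Sum>k\<in>B. \<kappa> (\<psi> j) * (\<kappa> (\<chi> k) * (\<Sum>p\<in>B. ?c p k * s p j)))"
    unfolding sum_row by (subst sum.swap) (simp only: mult.left_commute)
  have 2: "dL_der \<phi> (tensor_of s \<psi> \<chi>) = (\<Sum>j\<in>B. \<Sum>k\<in>B. \<kappa> (\<psi> j) * (\<kappa> (\<chi> k) * dL_der \<phi> (s j k)))"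
    by (simp only: tensor_of_derivation[OF derivation_dL_der dL_der_const psi chi] mult.assoc)
  have "(\<Sum>j\<in>B. \<Sum>k\<in>B. \<kappa> (\<psi> j) * (\<kappa> (\<chi> k) *
     ((\<Sum>p\<in>B. \<Sum>q\<in>B. \<kappa> (dl_part \<phi> (br p q)) * s p j * s q k) - dL_der \<phi> (s j k)
    + (\<Sum>p\<in>B. ?c p j * s p k) - (\<Sum>p\<in>B. ?c p k * s p j)))) = 0"
    by (intro sum.neutral ballI) (simp only: luu_identity[OF phi] mult_zero_right)
  then show ?thesis
    unfolding 4 unfolding 2 sum_row_row sum_row
    by (simp only: right_diff_distrib distrib_left sum.distrib sum_subtractf)
qed

lemma uuu_part:
  "(\<Sum>p\<in>B. \<Sum>q\<in>B. (\<Sum>i\<in>B. \<kappa> (\<phi> i) * \<kappa> (u_coord i (br p q))) * (row p \<psi> * row q \<chi>))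
    + (\<Sum>p\<in>B. (\<Sum>i\<in>B. \<Sum>j\<in>B. \<kappa> (\<phi> i) * \<kappa> (\<psi> j) * \<kappa> (\<delta> p (u_coord i) (u_coord j))) * row p \<chi>)
   = triple (\<lambda>i j k. (\<Sum>p\<in>B. \<Sum>q\<in>B. \<kappa> (u_coord i (br p q)) * s p j * s q k)
      + (\<Sum>p\<in>B. \<kappa> (\<delta> p (u_coord i) (u_coord j)) * s p k)) \<phi> \<psi> \<chi>"
proof -
  have "(\<Sum>p\<in>B. \<Sum>q\<in>B. (\<Sum>i\<in>B. \<kappa> (\<phi> i) * \<kappa> (u_coord i (br p q))) * (row p \<psi> * row q \<chi>))
    = (\<Sum>p\<in>B. \<Sum>q\<in>B. \<Sum>i\<in>B. \<kappa> (\<phi> i) * (\<kappa> (u_coord i (br p q)) * (row p \<psi> * row q \<chi>)))"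
    by (simp only: sum_distrib_right mult.assoc)
  also have "\<dots> = (\<Sum>p\<in>B. \<Sum>i\<in>B. \<Sum>q\<in>B. \<kappa> (\<phi> i) * (\<kappa> (u_coord i (br p q)) * (row p \<psi> * row q \<chi>)))"
    by (intro sum.cong refl sum.swap)
  also have "\<dots> = (\<Sum>i\<in>B. \<Sum>p\<in>B. \<Sum>q\<in>B. \<kappa> (\<phi> i) * (\<kappa> (u_coord i (br p q)) * (row p \<psi> * row q \<chi>)))"
    by (rule sum.swap)
  also have "\<dots> = (\<Sum>i\<in>B. \<kappa> (\<phi> i) * (\<Sum>p\<in>B. \<Sum>q\<in>B. \<kappa> (u_coord i (br p q)) * (row p \<psi> * row q \<chi>)))"
    by (simp only: sum_distrib_left)
  finally have 1: "(\<Sum>p\<in>B. \<Sum>q\<in>B. (\<Sum>i\<in>B. \<kappa> (\<phi> i) * \<kappa> (u_coord i (br p q))) * (row p \<psi> * row q \<chi>)) = \<dots>" .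
  have "(\<Sum>p\<in>B. (\<Sum>i\<in>B. \<Sum>j\<in>B. \<kappa> (\<phi> i) * \<kappa> (\<psi> j) * \<kappa> (\<delta> p (u_coord i) (u_coord j))) * row p \<chi>)
    = (\<Sum>p\<in>B. \<Sum>i\<in>B. \<kappa> (\<phi> i) * ((\<Sum>j\<in>B. \<kappa> (\<psi> j) * \<kappa> (\<delta> p (u_coord i) (u_coord j))) * row p \<chi>))"
    by (simp only: sum_distrib_left[symmetric] sum_distrib_right mult.assoc)
  also have "\<dots> = (\<Sum>i\<in>B. \<Sum>p\<in>B. \<kappa> (\<phi> i) * ((\<Sum>j\<in>B. \<kappa> (\<psi> j) * \<kappa> (\<delta> p (u_coord i) (u_coord j))) * row p \<chi>))"
    by (rule sum.swap)
  also have "\<dots> = (\<Sum>i\<in>B. \<kappa> (\<phi> i) * (\<Sum>p\<in>B. (\<Sum>j\<in>B. \<kappa> (\<psi> j) * \<kappa> (\<delta> p (u_coord i) (u_coord j))) * row p \<chi>))"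
    by (simp only: sum_distrib_left)
  finally show ?thesis
    unfolding 1 sum_row_row sum_row triple_def
    by (simp only: distrib_left sum.distrib sum_distrib_left)
qed

lemma tensor_of_dynamical:
  assumes phi: "\<phi> \<in> dual UNIV" and psi: "\<psi> \<in> dual UNIV" and chi: "\<chi> \<in> dual UNIV"
  shows "CYB (tensor_of s) \<phi> \<psi> \<chi> + Alt (dL l (tensor_of s)) \<phi> \<psi> \<chi>
    + Alt (cobracket_first \<delta> (tensor_of s)) \<phi> \<psi> \<chi> = 0"
proof -
  let ?Cl = "\<lambda>\<phi> \<psi> \<chi>. \<Sum>p\<in>B. \<Sum>q\<in>B. \<kappa> (dl_part \<phi> (br p q)) * (row p \<psi> * row q \<chi>)"
  let ?Cu = "\<lambda>\<phi> \<psi> \<chi>. \<Sum>p\<in>B. \<Sum>q\<in>B. (\<Sum>i\<in>B. \<kappa> (\<phi> i) * \<kappa> (u_coord i (br p q))) * (row p \<psi> * row q \<chi>)"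
  let ?A = "\<lambda>\<phi> \<psi> \<chi>. \<Sum>p\<in>B. (\<Sum>j\<in>B. \<kappa> (\<psi> j) * \<kappa> (\<delta> p (dl_part \<phi>) (u_coord j))) * row p \<chi>"
  let ?Q = "\<lambda>\<phi> \<psi> \<chi>. \<Sum>p\<in>B. (\<Sum>i\<in>B. \<Sum>j\<in>B. \<kappa> (\<phi> i) * \<kappa> (\<psi> j) * \<kappa> (\<delta> p (u_coord i) (u_coord j))) * row p \<chi>"
  let ?U = "\<lambda>i j k. (\<Sum>p\<in>B. \<Sum>q\<in>B. \<kappa> (u_coord i (br p q)) * s p j * s q k)
      + (\<Sum>p\<in>B. \<kappa> (\<delta> p (u_coord i) (u_coord j)) * s p k)"
  have C: "cyb1 \<phi> \<psi> \<chi> = ?Cl \<phi> \<psi> \<chi> + ?Cu \<phi> \<psi> \<chi>" if "\<phi> \<in> dual UNIV" for \<phi> \<psi> \<chi>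
    unfolding cyb1_def functional_split[OF that, of "br _ _"] by (simp only: distrib_right sum.distrib)
  have cob: "cobracket_first \<delta> (tensor_of s) \<phi> \<psi> \<chi> = ?A \<phi> \<psi> \<chi> - ?A \<psi> \<phi> \<chi> + ?Q \<phi> \<psi> \<chi>"
    if "\<phi> \<in> dual UNIV" "\<psi> \<in> dual UNIV" "\<chi> \<in> dual UNIV" for \<phi> \<psi> \<chi>
  proof -
    have "cobracket_first \<delta> (tensor_of s) \<phi> \<psi> \<chi> = (\<Sum>p\<in>B.
      ((\<Sum>j\<in>B. \<kappa> (\<psi> j) * \<kappa> (\<delta> p (dl_part \<phi>) (u_coord j)))
      - (\<Sum>i\<in>B. \<kappa> (\<phi> i) * \<kappa> (\<delta> p (dl_part \<psi>) (u_coord i)))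
      + (\<Sum>i\<in>B. \<Sum>j\<in>B. \<kappa> (\<phi> i) * \<kappa> (\<psi> j) * \<kappa> (\<delta> p (u_coord i) (u_coord j)))) * row p \<chi>)"
      unfolding cobracket_first_row[OF that(3)]
      by (intro sum.cong refl) (simp only: cobr_split[OF that(1,2) B_u])
    then show ?thesis by (simp only: distrib_right left_diff_distrib sum.distrib sum_subtractf)
  qed
  have U: "?Cu \<phi> \<psi> \<chi> + ?Q \<phi> \<psi> \<chi> + (?Cu \<psi> \<chi> \<phi> + ?Q \<psi> \<chi> \<phi>) + (?Cu \<chi> \<phi> \<psi> + ?Q \<chi> \<phi> \<psi>) = 0"
  proof -
    have "triple ?U \<phi> \<psi> \<chi> + triple ?U \<psi> \<chi> \<phi> + triple ?U \<chi> \<phi> \<psi>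
      = triple (\<lambda>i j k. ?U i j k + ?U j k i + ?U k i j) \<phi> \<psi> \<chi>"
      unfolding triple_rotate[of ?U \<psi> \<chi> \<phi>] triple_rotate[of ?U \<chi> \<phi> \<psi>] triple_rotate[of _ \<psi> \<chi> \<phi>]
      by (simp only: triple_def distrib_left sum.distrib)
    also have "\<dots> = 0"
      unfolding triple_def by (intro sum.neutral ballI) (simp only: uuu_identity mult_zero_right)
    finally show ?thesis unfolding uuu_part .
  qed
  note L = luu_part[OF phi psi chi] luu_part[OF psi chi phi] luu_part[OF chi phi psi]
  \<comment> \<open>Regrouping by the functional paired with the leg in \<open>l\<close>. The two
    \<open>?A\<close> terms with \<phi> in that place come from the cobracket terms at (\<phi>,
    \<psi>, \<chi>) and at (\<chi>, \<phi>, \<psi>), and likewise after rotation.\<close>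
  have "CYB (tensor_of s) \<phi> \<psi> \<chi> + Alt (dL l (tensor_of s)) \<phi> \<psi> \<chi> + Alt (cobracket_first \<delta> (tensor_of s)) \<phi> \<psi> \<chi>
    = (?Cl \<phi> \<psi> \<chi> - dL_der \<phi> (tensor_of s \<psi> \<chi>) + ?A \<phi> \<psi> \<chi> - ?A \<phi> \<chi> \<psi>)
    + (?Cl \<psi> \<chi> \<phi> - dL_der \<psi> (tensor_of s \<chi> \<phi>) + ?A \<psi> \<chi> \<phi> - ?A \<psi> \<phi> \<chi>)
    + (?Cl \<chi> \<phi> \<psi> - dL_der \<chi> (tensor_of s \<phi> \<psi>) + ?A \<chi> \<phi> \<psi> - ?A \<chi> \<psi> \<phi>)
    + (?Cu \<phi> \<psi> \<chi> + ?Q \<phi> \<psi> \<chi> + (?Cu \<psi> \<chi> \<phi> + ?Q \<psi> \<chi> \<phi>) + (?Cu \<chi> \<phi> \<psi> + ?Q \<chi> \<phi> \<psi>))"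
    unfolding CYB_cyb1[OF phi psi chi] Alt_def dL_eq C[OF phi] C[OF psi] C[OF chi]
      cob[OF phi psi chi] cob[OF psi chi phi] cob[OF chi phi psi]
    by (simp only: diff_conv_add_uminus ac_simps)
  then show ?thesis unfolding L U by simp
qed

end

section \<open>The r-matrix property of sigma\<close>

lemma wedge2_over_mono:
  assumes "A \<subseteq> A'"
  shows "wedge2_over A S \<subseteq> wedge2_over A' S"
proof
  fix T assume "T \<in> wedge2_over A S"
  then have T: "\<exists>n a b f. (\<forall>i<n. a i \<in> A \<and> b i \<in> A \<and> f i \<in> S) \<and> T = tensor_sum n a b f"
    "\<forall>\<phi> \<psi>. T \<psi> \<phi> = - T \<phi> \<psi>"
    unfolding wedge2_over_def mem_Collect_eq by (rule conjunct1, rule conjunct2)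
  from T(1) have "\<exists>n a b f. (\<forall>i<n. a i \<in> A' \<and> b i \<in> A' \<and> f i \<in> S) \<and> T = tensor_sum n a b f"
    using assms by blast
  with T(2) show "T \<in> wedge2_over A' S" unfolding wedge2_over_def mem_Collect_eq by (intro conjI)
qed

lemma sigma_PL_dynamical_r_matrix:
  assumes nondegenerate "linear_iso_to_dual \<iota>"
  shows "PL_dynamical_r_matrix l (\<lambda>_ _ _. 0) (sigma \<iota>)"
proof -
  let ?S = "localization (dual_group_functions l) (P_det \<iota>)"
  obtain s where s: "is_inverse s" "sigma \<iota> = tensor_of s" "\<And>i j. i \<in> B \<Longrightarrow> j \<in> B \<Longrightarrow> s i j \<in> ?S"
    using sigma_eq_tensor_of[OF assms(2,1)] by blast
  have "is_sigma \<iota> (tensor_of s)" using s by (intro is_sigma_tensor_of)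
  then have "tensor_of s \<in> wedge2_over u ?S" unfolding is_sigma_def Let_def by (rule conjunct1)
  then have "tensor_of s \<in> wedge2_over UNIV ?S" using wedge2_over_mono[of u UNIV] by blast
  moreover have "P_det \<iota> \<in> dual_group_functions l" "P_det \<iota> \<noteq> 0"
    using assms by (simp_all add: P_det_in_FF P_det_nonzero)
  moreover have "admissible_trivector (\<lambda>_ _ _. 0)"
    unfolding admissible_trivector_def wedge3_def
    by (auto simp: Alt_def intro!: exI[of _ "0::nat"])
  ultimately show ?thesis
    unfolding PL_dynamical_r_matrix_def s(2)
    using l_subbialgebra tensor_of_invariant[OF s(1)] tensor_of_dynamical[OF s(1)]
    by (auto simp: fract_const_simps)
qed

end

theorem theorem2p2:
  fixes scale :: "complex \<Rightarrow> 'g::ab_group_add \<Rightarrow> 'g"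
    and br :: "'g \<Rightarrow> 'g \<Rightarrow> 'g"
    and \<delta> :: "'g \<Rightarrow> ('g, complex) tensor2"
    and l u :: "'g set"
    and \<iota> :: "'g \<Rightarrow> 'g functional"
  assumes "split_lie_bialgebra scale br \<delta> l u"
    and "split_lie_bialgebra.nondegenerate scale br l u"
    and "split_lie_bialgebra.linear_iso_to_dual scale u \<iota>"
  shows "lie_bialgebra.PL_dynamical_r_matrix scale br \<delta> l (\<lambda>_ _ _. 0)
           (split_lie_bialgebra.sigma scale br \<delta> l u \<iota>)"
  using assms by (rule split_lie_bialgebra.sigma_PL_dynamical_r_matrix)

end
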